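(* Let $0<r<1/2$, $s=\frac{r}{2-4r}$ and $P_0>0$. There is $c_0=c_0(P_0)>0$ such that, if the number of cells satisfies $k_n\asymp n^{2-4r}=n^{\frac{2}{1+4s}}$ and $k_n>c_0n^{2-4r}$, then the ball $U=\mathbb B^s_{2\infty}(P_0)$ in the Besov space $\mathbb B^s_{2\infty}$ is a maxiset for the $\chi^2$-test statistics $T_n(\hat F_n)$; that is: (i) with $V_n=\{g\in U:\|g\|\ge cn^{-r}\}$ ($c>0$ a fixed constant; only $g$ such that $1+g$ is a density are considered), there is a sequence of tests $K_n$ generated by $T_n$, with $\alpha(K_n)=\alpha(1+o(1))$, $0<\alpha<1$, such that $\limsup_{n\to\infty}(\alpha(K_n)+\beta(K_n,V_n))<1$; (ii) for every $f\in\mathbb L_2^{per}(0,1)$, $f\notin\mathbb B^s_{2\infty}$, $\int_0^1f(x)dx=0$, there are sequences of positive integers $i_n\to\infty$ and $m_n$ and constants $0<c_1<C_1$ with $c_1m_n^{-r}<\|\tilde f_{i_n}\|<C_1m_n^{-r}$ such that, if $1+\tilde f_{i_n}(x)\ge0$ for all $x\in[0,1]$, then any sequence of tests $K_{m_n}$ generated by $T_{m_n}$ with $\alpha(K_{m_n})=\alpha(1+o(1))$, $0<\alpha<1$, satisfies $\liminf_{n\to\infty}(\alpha(K_{m_n})+\beta(K_{m_n},\tilde f_{i_n}))\ge1$.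
   Context: Model: $X_1,\dots,X_n$ are i.i.d. with c.d.f. $F$ on $(0,1)$ having density $1+f$, $f\in\mathbb L_2^{per}(0,1)$ (1-periodic functions, square integrable on $(0,1)$), so $\int_0^1f=0$ and $1+f\ge0$. $\|\cdot\|$ is the $\mathbb L_2(0,1)$ norm. The hypothesis is $H_0:f=0$. $\alpha(K_n)$, $\beta(K_n,f)$ are the type I error probability and the type II error probability at $f$ of a test $K_n$; $\beta(K_n,V)=\sup_{f\in V}\beta(K_n,f)$. A test is generated by $T_n$ if it rejects $H_0$ when $T_n$ exceeds a threshold. $a_n\asymp b_n$ means $ca_n\le b_n\le Ca_n$ for all $n$ with constants $0<c\le C$. $\chi^2$-statistics: with $\hat F_n$ the empirical c.d.f., $\hat p_{in}=\hat F_n(i/k_n)-\hat F_n((i-1)/k_n)$, $1\le i\le k_n$, $T_n(\hat F_n)=k_nn\sum_{i=1}^{k_n}(\hat p_{in}-1/k_n)^2$. Balls: with $\phi_j(x)=\exp\{2\pi ijx\}$, $\mathbb B^s_{2\infty}(P_0)=\{f=\sum_{j\in\mathbb Z}\theta_j\phi_j:\ \sup_{\lambda>0}\lambda^{2s}\sum_{|j|>\lambda}|\theta_j|^2\le P_0\}$, where here $\int_0^1f=0$, i.e. $\theta_0=0$; $\mathbb B^s_{2\infty}=\bigcup_{P_0>0}\mathbb B^s_{2\infty}(P_0)$. For $f=\sum_j\theta_j\phi_j$ put $\tilde f_i=\sum_{|j|>i}\theta_j\phi_j$ (the remainder of $f$ after projection on $\mathrm{span}\{\phi_j:|j|\le i\}$).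 *)

theory Defs
  imports "HOL-Probability.Probability"
begin

section \<open>Periodic square integrable functions and their Fourier expansion\<close>

text \<open>Square integrable functions are represented by Borel measurable functions on the line, not by
  classes modulo null sets.\<close>

definition L2_per :: "(real \<Rightarrow> real) set" where
  "L2_per = {f \<in> borel_measurable borel.
     (\<forall>x. f (x + 1) = f x) \<and> set_integrable lborel {0<..<1} (\<lambda>x. (f x)\<^sup>2)}"

definition L2_norm :: "(real \<Rightarrow> real) \<Rightarrow> real" where
  "L2_norm f = sqrt (LINT x:{0<..<1}|lborel. (f x)\<^sup>2)"

definition trig :: "int \<Rightarrow> real \<Rightarrow> complex" where
  "trig j x = exp (2 * of_real pi * \<i> * of_int j * of_real x)"

definition fourier_coeff :: "(real \<Rightarrow> real) \<Rightarrow> int \<Rightarrow> complex" where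
  "fourier_coeff f j = (LINT x:{0<..<1}|lborel. of_real (f x) * cnj (trig j x))"

text \<open>The family of squared coefficients is summable for every function in \<open>L2_per\<close>
  (Bessel), so the infinite sum below never takes its default value.\<close>

definition besov_ball :: "real \<Rightarrow> real \<Rightarrow> (real \<Rightarrow> real) set" where
  "besov_ball s P0 = {f \<in> L2_per. fourier_coeff f 0 = 0 \<and>
     (\<forall>l>0. l powr (2 * s) *
        (\<Sum>\<^sub>\<infinity>j\<in>{j::int. real_of_int \<bar>j\<bar> > l}. (cmod (fourier_coeff f j))\<^sup>2) \<le> P0)}"

definition besov_space :: "real \<Rightarrow> (real \<Rightarrow> real) set" where
  "besov_space s = (\<Union>P0\<in>{0<..}. besov_ball s P0)"

text \<open>The subtracted partial sum is real, since the coefficients with indices \<open>j\<close> and \<open>- j\<close> of a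
  real function are conjugate; \<open>Re\<close> only adjusts the type.\<close>

definition fourier_remainder :: "(real \<Rightarrow> real) \<Rightarrow> nat \<Rightarrow> real \<Rightarrow> real" where
  "fourier_remainder f i x =
     f x - Re (\<Sum>j\<in>{- int i..int i}. fourier_coeff f j * trig j x)"

section \<open>The sampling model\<close>

definition perturbs_to_density :: "(real \<Rightarrow> real) \<Rightarrow> bool" where
  "perturbs_to_density f \<longleftrightarrow>
     (AE x in lborel. x \<in> {0<..<1} \<longrightarrow> 0 \<le> 1 + f x) \<and>
     (LINT x:{0<..<1}|lborel. 1 + f x) = 1"

definition obs_law :: "(real \<Rightarrow> real) \<Rightarrow> real measure" where
  "obs_law f = density lborel (\<lambda>x. ennreal (1 + f x) * indicator {0<..<1} x)"

definition sample_law :: "nat \<Rightarrow> (real \<Rightarrow> real) \<Rightarrow> (nat \<Rightarrow> real) measure" where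
  "sample_law n f = (\<Pi>\<^sub>M j\<in>{1..n}. obs_law f)"

section \<open>The chi-squared statistic and tests\<close>

definition empirical_cdf :: "nat \<Rightarrow> (nat \<Rightarrow> real) \<Rightarrow> real \<Rightarrow> real" where
  "empirical_cdf n X x = real (card {j \<in> {1..n}. X j \<le> x}) / real n"

definition cell_frequency :: "nat \<Rightarrow> nat \<Rightarrow> (nat \<Rightarrow> real) \<Rightarrow> nat \<Rightarrow> real" where
  "cell_frequency n k X i =
     empirical_cdf n X (real i / real k) - empirical_cdf n X ((real i - 1) / real k)"

definition chi2_stat :: "nat \<Rightarrow> nat \<Rightarrow> (nat \<Rightarrow> real) \<Rightarrow> real" where
  "chi2_stat n k X =
     real k * real n * (\<Sum>i=1..k. (cell_frequency n k X i - 1 / real k)\<^sup>2)"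

text \<open>A test is identified with its rejection region.\<close>

definition generated_by :: "(nat \<Rightarrow> real) set \<Rightarrow> ((nat \<Rightarrow> real) \<Rightarrow> real) \<Rightarrow> bool" where
  "generated_by K T \<longleftrightarrow> (\<exists>t. K = {X. T X > t})"

definition type_I_error :: "nat \<Rightarrow> (nat \<Rightarrow> real) set \<Rightarrow> real" where
  "type_I_error n K =
     measure (sample_law n (\<lambda>_. 0)) {X \<in> space (sample_law n (\<lambda>_. 0)). X \<in> K}"

definition type_II_error :: "nat \<Rightarrow> (nat \<Rightarrow> real) set \<Rightarrow> (real \<Rightarrow> real) \<Rightarrow> real" where
  "type_II_error n K f = measure (sample_law n f) {X \<in> space (sample_law n f). X \<notin> K}"

text \<open>The supremum is taken in \<open>ereal\<close>, so that it is meaningful also for an empty set of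
  alternatives (which may occur for finitely many sample sizes).\<close>

definition type_II_error_sup :: "nat \<Rightarrow> (nat \<Rightarrow> real) set \<Rightarrow> (real \<Rightarrow> real) set \<Rightarrow> ereal" where
  "type_II_error_sup n K V = (SUP f\<in>V. ereal (type_II_error n K f))"

text \<open>Sequences are indexed by the sample size, which is at least one.\<close>

definition same_order :: "(nat \<Rightarrow> real) \<Rightarrow> (nat \<Rightarrow> real) \<Rightarrow> bool" where
  "same_order a b \<longleftrightarrow>
     (\<exists>c C. 0 < c \<and> c \<le> C \<and> (\<forall>n\<ge>1. c * a n \<le> b n \<and> b n \<le> C * a n))"

end

theory Submission
  imports Defs
begin

text \<open>
  Up to an affine change the statistic is the degenerate U-statistic \<open>W\<close> with kernel
  \<open>h (x, y) = k [x = y] - 1\<close> in the cell numbers of the observations. Under the hypothesis \<open>h\<close> is a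
  projection kernel, so the conditional variance of the martingale increments of \<open>W\<close> is a constant
  plus a multiple of \<open>W\<close> itself; multiplying the characteristic functions step by step then gives
  asymptotic normality of \<open>W / (n sqrt (k / 2))\<close> whenever \<open>n\<close> and \<open>k\<close> tend to infinity and
  \<open>k / n\<^sup>2\<close> tends to 0.

  Alternatives need no limit theorem of their own. If the cells have probabilities \<open>1 / k + d l\<close>, a
  maximal coupling with uniform cells changes \<open>W / (n sqrt k)\<close> by a shift proportional to
  \<open>x = n sqrt k (\<Sum>l. (d l)\<^sup>2)\<close> up to an error whose variance is negligible. Hence the power exceeds the
  level if \<open>x\<close> stays away from 0, and does not if \<open>x\<close> tends to 0.

  It remains to estimate \<open>k (\<Sum>l. (d l)\<^sup>2)\<close>, the energy of the projection to step functions. Poincare's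
  inequality on the cells shows that frequencies below a small multiple of \<open>k\<close> are retained, and the
  Besov condition makes the remaining ones negligible, which gives (i). A function with frequencies
  above \<open>i\<close> has projected energy at most of order \<open>(k / i) \<parallel>f\<parallel>\<^sup>2\<close>. If \<open>f\<close> is outside the Besov space,
  \<open>i\<close> can be chosen along a sequence such that the remainder is much larger than \<open>i powr (- s)\<close>; matching it with
  \<open>m powr (- r)\<close> makes \<open>k\<close> much smaller than \<open>i\<close>, which gives (ii).
\<close>

section \<open>U-statistics of independent variables with finite support\<close>

text \<open>For \<open>r < 1/4\<close> the exponent \<open>2 - 4 * r\<close> exceeds 1: cells
  eventually outnumber observations and most are empty, so no normal approximation of single cell
  counts is available and the limit has to come from the sum over pairs. Its scale shows what
  accuracy suffices: an increment has conditional variance \<open>n (k - 1) + 2 W\<close> with the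
  mean of \<open>\<bar>W\<bar>\<close> at most \<open>n sqrt k\<close>, so treating it as constant
  costs only order \<open>1 / sqrt k\<close> after all \<open>n\<close> steps.

  Alternatives are merely square integrable, change with the sample size and enter (i) through a
  supremum. The coupling estimate therefore depends on the alternative through \<open>x\<close>
  alone. Relative to \<open>x^2\<close> its error decreases in \<open>x\<close>, so distant
  alternatives are no worse than near ones.

  In (ii) the thresholds are arbitrary; monotonicity of rejection probabilities allows comparison
  with one fixed normal quantile.

  Remainders and primitives are estimated through their coefficients, which requires Parseval for
  every square integrable function; this is derived from Stone-Weierstrass and a monotone class
  argument.\<close>

abbreviation expec :: "'a pmf \<Rightarrow> ('a \<Rightarrow> 'b) \<Rightarrow> 'b::{banach, second_countable_topology}" where
  "expec \<equiv> measure_pmf.expectation"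

text \<open>Indices run over \<open>{1..n}\<close> and the value elsewhere is
  \<open>undefined\<close>, as for the extensional functions of \<open>sample_law\<close>; so a
  sample determines one cell vector in \<open>law_link\<close>.\<close>

definition iid_pmf :: "nat \<Rightarrow> 'a pmf \<Rightarrow> (nat \<Rightarrow> 'a) pmf" where
  "iid_pmf n q = Pi_pmf {1..n} undefined (\<lambda>_. q)"

definition psum :: "('a \<Rightarrow> real) \<Rightarrow> nat \<Rightarrow> (nat \<Rightarrow> 'a) \<Rightarrow> real" where
  "psum g n w = (\<Sum>a\<in>{1..n}. g (w a))"

text \<open>Pairs are grouped by their larger index, so that the inner sums are the increments of a
  process in \<open>n\<close>; the diagonal is left out.\<close>

definition ustat :: "('a \<Rightarrow> 'a \<Rightarrow> real) \<Rightarrow> nat \<Rightarrow> (nat \<Rightarrow> 'a) \<Rightarrow> real" where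
  "ustat h n w = (\<Sum>b\<in>{1..n}. \<Sum>a\<in>{1..<b}. h (w a) (w b))"

lemma psum_0 [simp]: "psum g 0 w = 0"
  by (simp add: psum_def)

lemma ustat_0 [simp]: "ustat h 0 w = 0"
  by (simp add: ustat_def)

lemma psum_upd [simp]: "psum g n (w(Suc n := z)) = psum g n w"
  by (auto simp: psum_def intro!: sum.cong)

lemma psum_Suc: "psum g (Suc n) w = psum g n w + g (w (Suc n))"
  by (simp add: psum_def)

lemma ustat_Suc: "ustat h (Suc n) w = ustat h n w + psum (\<lambda>x. h x (w (Suc n))) n w"
  by (simp add: psum_def ustat_def atLeastLessThanSuc_atLeastAtMost)

lemma ustat_upd [simp]: "ustat h n (w(Suc n := z)) = ustat h n w"
  unfolding ustat_def by (intro sum.cong refl) simp_all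

lemma expec_swap:
  fixes F :: "'a \<Rightarrow> 'b \<Rightarrow> 'c::{banach, second_countable_topology}"
  assumes "finite (set_pmf p)" "finite (set_pmf q)"
  shows "expec p (\<lambda>x. expec q (\<lambda>y. F x y)) = expec q (\<lambda>y. expec p (\<lambda>x. F x y))"
  using assms
  by (simp add: integral_measure_pmf[of "set_pmf p"] integral_measure_pmf[of "set_pmf q"]
        scaleR_sum_right sum.swap[of _ "set_pmf p"] mult.commute)

lemma expec_mono:
  fixes f g :: "'a \<Rightarrow> real"
  assumes "finite (set_pmf p)" "\<And>x. x \<in> set_pmf p \<Longrightarrow> f x \<le> g x"
  shows "expec p f \<le> expec p g"
  using assms by (intro integral_mono_AE integrable_measure_pmf_finite) (auto simp: AE_measure_pmf_iff)

lemma expec_cong: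
  assumes "\<And>x. x \<in> set_pmf p \<Longrightarrow> f x = g x"
  shows "expec p f = expec p g"
  using assms by (intro integral_cong_AE) (auto simp: AE_measure_pmf_iff)

lemma expec_abs_le:
  fixes f :: "'a \<Rightarrow> real"
  assumes fin: "finite (set_pmf p)"
  shows "expec p (\<lambda>x. \<bar>f x\<bar>) \<le> sqrt (expec p (\<lambda>x. (f x)\<^sup>2))"
proof (rule real_le_rsqrt)
  note [simp] = integrable_measure_pmf_finite[OF fin]
  define m where "m = expec p (\<lambda>x. \<bar>f x\<bar>)"
  have "0 \<le> expec p (\<lambda>x. (\<bar>f x\<bar> - m)\<^sup>2)" by simp
  also have "\<dots> = expec p (\<lambda>x. (f x)\<^sup>2 + (m\<^sup>2 - 2 * m * \<bar>f x\<bar>))"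
    by (simp add: power2_diff algebra_simps)
  also have "\<dots> = expec p (\<lambda>x. (f x)\<^sup>2) - m\<^sup>2"
    by (simp add: m_def power2_eq_square)
  finally show "(expec p (\<lambda>x. \<bar>f x\<bar>))\<^sup>2 \<le> expec p (\<lambda>x. (f x)\<^sup>2)" by (simp add: m_def)
qed

text \<open>Finite support makes every function integrable, which removes the integrability
  conditions from all computations with conditional expectations.\<close>

locale finite_pmf =
  fixes q :: "'a pmf"
  assumes fin: "finite (set_pmf q)"
begin

lemma int_q [simp]: "integrable (measure_pmf q) (f :: 'a \<Rightarrow> 'b::{banach, second_countable_topology})"
  by (simp add: fin integrable_measure_pmf_finite)

lemma fin_iid [simp]: "finite (set_pmf (iid_pmf n q))"
  unfolding iid_pmf_def by (subst set_Pi_pmf) (auto simp: fin)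

lemma int_iid [simp]:
  "integrable (measure_pmf (iid_pmf n q)) (f :: (nat \<Rightarrow> 'a) \<Rightarrow> 'b::{banach, second_countable_topology})"
  by (simp add: integrable_measure_pmf_finite)

text \<open>Integrating out the newest draw first is the conditional expectation given the first
  \<open>n\<close> draws; the moment formulas below are inductions on this step.\<close>

lemma expec_Suc:
  fixes F :: "(nat \<Rightarrow> 'a) \<Rightarrow> 'b::{banach, second_countable_topology}"
  shows "expec (iid_pmf (Suc n) q) F = expec (iid_pmf n q) (\<lambda>w. expec q (\<lambda>z. F (w(Suc n := z))))"
proof -
  have eq: "iid_pmf (Suc n) q =
      bind_pmf q (\<lambda>y. map_pmf (\<lambda>f. f(Suc n := y)) (iid_pmf n q))"
    unfolding iid_pmf_def
    by (subst atLeastAtMostSuc_conv, simp, subst Pi_pmf_insert') (simp_all add: map_pmf_def)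
  have "expec (iid_pmf (Suc n) q) F = expec q (\<lambda>z. expec (iid_pmf n q) (\<lambda>w. F (w(Suc n := z))))"
    unfolding eq
    by (subst pmf_expectation_bind[of "set_pmf q"])
      (auto simp: fin integral_measure_pmf[of "set_pmf q" q])
  also have "\<dots> = expec (iid_pmf n q) (\<lambda>w. expec q (\<lambda>z. F (w(Suc n := z))))"
    by (rule expec_swap) (auto simp: fin)
  finally show ?thesis .
qed

lemma psum_mean:
  assumes "expec q g = 0"
  shows "expec (iid_pmf n q) (psum g n) = 0"
  by (induction n) (simp_all add: expec_Suc psum_Suc assms)

lemma psum_second_moment:
  assumes g: "expec q g = 0"
  shows "expec (iid_pmf n q) (\<lambda>w. (psum g n w)\<^sup>2) = n * expec q (\<lambda>z. (g z)\<^sup>2)"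
proof (induction n)
  case (Suc n)
  have "expec (iid_pmf (Suc n) q) (\<lambda>w. (psum g (Suc n) w)\<^sup>2)
     = expec (iid_pmf n q) (\<lambda>w. expec q (\<lambda>z. (psum g n w)\<^sup>2 + 2 * psum g n w * g z + (g z)\<^sup>2))"
    by (simp add: expec_Suc psum_Suc power2_sum algebra_simps)
  also have "\<dots> = expec (iid_pmf n q) (\<lambda>w. (psum g n w)\<^sup>2 + expec q (\<lambda>z. (g z)\<^sup>2))"
    by (simp add: g)
  finally show ?case using Suc by (simp add: algebra_simps)
qed simp

text \<open>Each step adds \<open>m4 + 6 * n * m2\<^sup>2\<close>; the third moment drops out
  because \<open>psum\<close> is centred. Rounding \<open>3 n (n - 1)\<close> up to
  \<open>3 n^2\<close> keeps the induction closed.\<close>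

lemma psum_fourth_moment:
  assumes g: "expec q g = 0"
  shows "expec (iid_pmf n q) (\<lambda>w. (psum g n w) ^ 4)
    \<le> n * expec q (\<lambda>z. (g z) ^ 4) + 3 * (real n)\<^sup>2 * (expec q (\<lambda>z. (g z)\<^sup>2))\<^sup>2"
proof (induction n)
  case (Suc n)
  define m2 m3 m4 where "m2 = expec q (\<lambda>z. (g z)\<^sup>2)" and "m3 = expec q (\<lambda>z. (g z)^3)"
    and "m4 = expec q (\<lambda>z. (g z)^4)"
  have *: "(x + y)^4 = x^4 + 4 * x^3 * y + 6 * x\<^sup>2 * y\<^sup>2 + 4 * x * y^3 + y^4" for x y :: real
    by algebra
  have "expec (iid_pmf (Suc n) q) (\<lambda>w. (psum g (Suc n) w)^4)
     = expec (iid_pmf n q) (\<lambda>w. (psum g n w)^4 + 6 * m2 * (psum g n w)\<^sup>2 + 4 * m3 * psum g n w + m4)"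
    by (simp add: expec_Suc psum_Suc * g m2_def m3_def m4_def algebra_simps)
  also have "\<dots> = expec (iid_pmf n q) (\<lambda>w. (psum g n w)^4) + 6 * m2 * (n * m2) + m4"
    using psum_second_moment[OF g, of n] psum_mean[OF g, of n] by (simp add: m2_def)
  also have "\<dots> \<le> n * m4 + 3 * (real n)\<^sup>2 * m2\<^sup>2 + 6 * m2 * (n * m2) + m4"
    using Suc unfolding m2_def m4_def by simp
  also have "\<dots> \<le> Suc n * m4 + 3 * (real (Suc n))\<^sup>2 * m2\<^sup>2"
    by (simp add: power2_eq_square algebra_simps)
  finally show ?case unfolding m2_def m4_def .
qed simp

text \<open>The increments are orthogonal, since by \<open>h1\<close> the newest draw has
  conditional mean 0. With the newest draw fixed, \<open>h2\<close> centres the other argument, so a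
  squared increment has the second moment of a sum of independent centred terms.\<close>

lemma ustat_second_moment:
  assumes h1: "\<And>x. x \<in> set_pmf q \<Longrightarrow> expec q (\<lambda>z. h x z) = 0"
    and h2: "\<And>z. z \<in> set_pmf q \<Longrightarrow> expec q (\<lambda>x. h x z) = 0"
  shows "expec (iid_pmf n q) (\<lambda>w. (ustat h n w)\<^sup>2)
    = real n * (real n - 1) / 2 * expec q (\<lambda>z. expec q (\<lambda>x. (h x z)\<^sup>2))"
proof (induction n)
  case (Suc n)
  \<comment> \<open>\<open>h1\<close> is assumed on the support only, so the earlier draws must be
    known to lie there.\<close>
  have set: "w a \<in> set_pmf q" if "w \<in> set_pmf (iid_pmf n q)" "a \<in> {1..n}" for w a
    using that unfolding iid_pmf_def by (subst (asm) set_Pi_pmf) (auto simp: PiE_dflt_def)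
  have 0: "expec q (\<lambda>z. psum (\<lambda>x. h x z) n w) = 0" if "w \<in> set_pmf (iid_pmf n q)" for w
    unfolding psum_def using set[OF that] h1 by simp
  have "expec (iid_pmf (Suc n) q) (\<lambda>w. (ustat h (Suc n) w)\<^sup>2)
     = expec (iid_pmf n q) (\<lambda>w. (ustat h n w)\<^sup>2
        + 2 * ustat h n w * expec q (\<lambda>z. psum (\<lambda>x. h x z) n w) + expec q (\<lambda>z. (psum (\<lambda>x. h x z) n w)\<^sup>2))"
    by (simp add: expec_Suc ustat_Suc power2_sum algebra_simps)
  also have "\<dots> = expec (iid_pmf n q) (\<lambda>w. (ustat h n w)\<^sup>2 + expec q (\<lambda>z. (psum (\<lambda>x. h x z) n w)\<^sup>2))"
    by (intro expec_cong) (simp add: 0)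
  also have "\<dots> = expec (iid_pmf n q) (\<lambda>w. (ustat h n w)\<^sup>2) +
      expec q (\<lambda>z. expec (iid_pmf n q) (\<lambda>w. (psum (\<lambda>x. h x z) n w)\<^sup>2))"
    by (simp add: expec_swap[of q "iid_pmf n q"] fin)
  also have "expec q (\<lambda>z. expec (iid_pmf n q) (\<lambda>w. (psum (\<lambda>x. h x z) n w)\<^sup>2)) =
     expec q (\<lambda>z. n * expec q (\<lambda>x. (h x z)\<^sup>2))"
    by (intro expec_cong psum_second_moment h2)
  finally show ?case using Suc by (simp add: field_simps)
qed simp

end

section \<open>The central limit theorem under uniform cell probabilities\<close>

text \<open>The reproducing kernel of the mean zero functions on \<open>k\<close> cells with respect
  to the uniform law.\<close>

definition cell_kernel :: "nat \<Rightarrow> nat \<Rightarrow> nat \<Rightarrow> real" where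
  "cell_kernel k x y = real k * of_bool (x = y) - 1"

definition uniform_pmf :: "nat \<Rightarrow> nat pmf" where
  "uniform_pmf k = pmf_of_set {1..k}"

locale uniform_cells =
  fixes k :: nat
  assumes k: "k > 0"
begin

abbreviation "u \<equiv> uniform_pmf k"

sublocale finite_pmf u
  by unfold_locales (use k in \<open>auto simp: uniform_pmf_def\<close>)

lemma set_u: "set_pmf u = {1..k}"
  using k by (simp add: uniform_pmf_def)

lemma expec_u: "expec u (f :: nat \<Rightarrow> real) = sum f {1..k} / k"
  using k unfolding uniform_pmf_def by (subst integral_pmf_of_set) auto

lemma kernel_mean: "x \<in> {1..k} \<Longrightarrow> expec u (\<lambda>z. cell_kernel k x z) = 0"
  using k by (simp add: expec_u cell_kernel_def sum_subtractf flip: sum_distrib_left)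

lemma kernel_sym: "cell_kernel k x y = cell_kernel k y x"
  by (auto simp: cell_kernel_def)

lemma kernel_mean': "x \<in> {1..k} \<Longrightarrow> expec u (\<lambda>z. cell_kernel k z x) = 0"
  using kernel_mean by (simp add: kernel_sym[of _ x])

text \<open>Idempotence of the projection. It is what turns the conditional variance of an increment
  back into the statistic itself, in \<open>increment_variance\<close>.\<close>

lemma kernel_projection:
  assumes "x \<in> {1..k}" "y \<in> {1..k}"
  shows "expec u (\<lambda>z. cell_kernel k x z * cell_kernel k y z) = cell_kernel k x y"
proof -
  have "(\<Sum>z\<in>{1..k}. cell_kernel k x z * cell_kernel k y z) =
     (\<Sum>z\<in>{1..k}. (if x = z then real k * real k * of_bool (x = y) - real k else 0)
        - (if y = z then real k else 0) + 1)"
    by (intro sum.cong refl) (auto simp: cell_kernel_def algebra_simps)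
  also have "\<dots> = real k * real k * of_bool (x = y) - real k"
    using assms by (simp only: sum.distrib sum_subtractf sum.delta' sum.delta finite_atLeastAtMost) simp
  finally show ?thesis using k by (simp add: expec_u cell_kernel_def field_simps)
qed

lemma kernel_second: "x \<in> {1..k} \<Longrightarrow> expec u (\<lambda>z. (cell_kernel k x z)\<^sup>2) = real k - 1"
  using kernel_projection[of x x] by (simp add: power2_eq_square) (simp add: cell_kernel_def)

text \<open>The bound \<open>k\<close> for the absolute value of the kernel takes out two factors;
  the rest is the second moment \<open>k - 1\<close>.\<close>

lemma kernel_fourth:
  assumes "x \<in> {1..k}"
  shows "expec u (\<lambda>z. (cell_kernel k x z) ^ 4) \<le> real k ^ 3"
proof -
  have "(cell_kernel k x z) ^ 4 \<le> real k ^ 2 * (cell_kernel k x z)\<^sup>2" for z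
  proof -
    have "\<bar>cell_kernel k x z\<bar> \<le> real k" using k by (auto simp: cell_kernel_def)
    then have "(cell_kernel k x z)\<^sup>2 \<le> (real k)\<^sup>2" by (metis abs_ge_zero power2_abs power_mono)
    then have "(cell_kernel k x z)\<^sup>2 * (cell_kernel k x z)\<^sup>2 \<le> (real k)\<^sup>2 * (cell_kernel k x z)\<^sup>2"
      by (intro mult_right_mono) auto
    then show ?thesis by (simp add: power2_eq_square power4_eq_xxxx mult_ac)
  qed
  then have "expec u (\<lambda>z. (cell_kernel k x z) ^ 4) \<le> expec u (\<lambda>z. real k ^ 2 * (cell_kernel k x z)\<^sup>2)"
    by (intro expec_mono fin)
  also have "\<dots> = real k ^ 2 * (real k - 1)" using kernel_second[OF assms] by simp
  also have "\<dots> \<le> real k ^ 3" by (simp add: power2_eq_square power3_eq_cube algebra_simps)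
  finally show ?thesis .
qed

lemma iid_support:
  assumes "w \<in> set_pmf (iid_pmf n u)" "a \<in> {1..n}"
  shows "w a \<in> {1..k}"
  using assms unfolding iid_pmf_def by (subst (asm) set_Pi_pmf) (auto simp: PiE_dflt_def set_u)

lemma increment_mean:
  assumes "\<And>a. a \<in> {1..n} \<Longrightarrow> w a \<in> {1..k}"
  shows "expec u (\<lambda>z. psum (\<lambda>x. cell_kernel k x z) n w) = 0"
  using kernel_mean assms by (simp add: psum_def Bochner_Integration.integral_sum)

text \<open>In the expanded square the \<open>n\<close> diagonal terms give \<open>k - 1\<close>
  each, and by \<open>kernel_projection\<close> the off-diagonal pairs reassemble to twice the
  U-statistic.\<close>

lemma increment_variance:
  assumes "\<And>a. a \<in> {1..n} \<Longrightarrow> w a \<in> {1..k}"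
  shows "expec u (\<lambda>z. (psum (\<lambda>x. cell_kernel k x z) n w)\<^sup>2)
    = real n * (real k - 1) + 2 * ustat (cell_kernel k) n w"
  using assms
proof (induction n)
  case (Suc n)
  let ?x = "w (Suc n)"
  have x: "?x \<in> {1..k}" using Suc.prems[of "Suc n"] by simp
  have "expec u (\<lambda>z. (psum (\<lambda>x. cell_kernel k x z) (Suc n) w)\<^sup>2)
    = expec u (\<lambda>z. (psum (\<lambda>x. cell_kernel k x z) n w)\<^sup>2) +
      2 * expec u (\<lambda>z. psum (\<lambda>x. cell_kernel k x z) n w * cell_kernel k ?x z) +
      expec u (\<lambda>z. (cell_kernel k ?x z)\<^sup>2)"
    by (simp add: psum_Suc power2_sum algebra_simps)
  also have "expec u (\<lambda>z. psum (\<lambda>x. cell_kernel k x z) n w * cell_kernel k ?x z)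
     = psum (\<lambda>x. cell_kernel k x ?x) n w"
  proof -
    have "expec u (\<lambda>z. psum (\<lambda>x. cell_kernel k x z) n w * cell_kernel k ?x z)
       = (\<Sum>a\<in>{1..n}. expec u (\<lambda>z. cell_kernel k (w a) z * cell_kernel k ?x z))"
      unfolding psum_def sum_distrib_right by (rule Bochner_Integration.integral_sum) simp
    also have "\<dots> = (\<Sum>a\<in>{1..n}. cell_kernel k (w a) ?x)"
      using Suc.prems x by (intro sum.cong refl kernel_projection) auto
    finally show ?thesis by (simp add: psum_def)
  qed
  finally show ?case using Suc kernel_second[OF x] by (simp add: ustat_Suc algebra_simps)
qed simp

lemma ustat_L1:
  "expec (iid_pmf n u) (\<lambda>w. \<bar>ustat (cell_kernel k) n w\<bar>) \<le> n * sqrt k"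
proof -
  have "expec (iid_pmf n u) (\<lambda>w. (ustat (cell_kernel k) n w)\<^sup>2)
     = real n * (real n - 1) / 2 * expec u (\<lambda>z. expec u (\<lambda>x. (cell_kernel k x z)\<^sup>2))"
    by (rule ustat_second_moment) (use kernel_mean kernel_mean' set_u in auto)
  also have "expec u (\<lambda>z. expec u (\<lambda>x. (cell_kernel k x z)\<^sup>2)) = expec u (\<lambda>z. real k - 1)"
    using kernel_second by (intro expec_cong) (simp add: set_u kernel_sym[of _ x for x])
  also have "real n * (real n - 1) / 2 * \<dots> \<le> (real n)\<^sup>2 * real k"
  proof -
    have "real n * (real n - 1) / 2 \<le> (real n)\<^sup>2" by (simp add: power2_eq_square field_simps)
    then show ?thesis using k by (intro mult_mono) auto
  qed
  finally have "expec (iid_pmf n u) (\<lambda>w. (ustat (cell_kernel k) n w)\<^sup>2) \<le> (real n)\<^sup>2 * real k" .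
  then have "sqrt (expec (iid_pmf n u) (\<lambda>w. (ustat (cell_kernel k) n w)\<^sup>2)) \<le> n * sqrt k"
    by (metis abs_of_nat real_sqrt_abs real_sqrt_le_mono real_sqrt_mult)
  with expec_abs_le[OF fin_iid] show ?thesis by (rule order_trans)
qed

text \<open>Third absolute moments are interpolated between second and fourth ones. The weight
  \<open>e\<close> stays free, because a good choice depends on \<open>n\<close> and
  \<open>k\<close>; it is made in \<open>cf_bound\<close>.\<close>

lemma increment_L3:
  assumes e: "e > 0"
  shows "expec (iid_pmf n u) (\<lambda>w. expec u (\<lambda>z. \<bar>psum (\<lambda>x. cell_kernel k x z) n w\<bar> ^ 3))
    \<le> (e * (real n * real k) + (real n * real k ^ 3 + 3 * (real n)\<^sup>2 * (real k)\<^sup>2) / e) / 2"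
proof -
  \<comment> \<open>Weighted inequality of arithmetic and geometric means for \<open>x^2\<close> and
    \<open>x^4\<close>.\<close>
  have *: "\<bar>x\<bar> ^ 3 \<le> (e * x\<^sup>2 + x ^ 4 / e) / 2" for x :: real
  proof -
    have "0 \<le> (\<bar>x\<bar> * sqrt e - x\<^sup>2 / sqrt e)\<^sup>2" by simp
    also have "\<dots> = e * x\<^sup>2 + x ^ 4 / e - 2 * \<bar>x\<bar> ^ 3"
      using e by (simp add: power2_diff power_mult_distrib power_divide)
        (simp add: power2_eq_square power3_eq_cube power4_eq_xxxx abs_mult)
    finally show ?thesis by simp
  qed
  have "expec (iid_pmf n u) (\<lambda>w. expec u (\<lambda>z. \<bar>psum (\<lambda>x. cell_kernel k x z) n w\<bar> ^ 3))
    = expec u (\<lambda>z. expec (iid_pmf n u) (\<lambda>w. \<bar>psum (\<lambda>x. cell_kernel k x z) n w\<bar> ^ 3))"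
    by (rule expec_swap) (auto simp: fin)
  also have "\<dots> \<le> expec u (\<lambda>z. (e * (real n * real k) +
      (real n * real k ^ 3 + 3 * (real n)\<^sup>2 * (real k)\<^sup>2) / e) / 2)"
  proof (rule expec_mono[OF fin])
    fix z assume "z \<in> set_pmf u"
    then have z: "z \<in> {1..k}" by (simp add: set_u)
    let ?g = "\<lambda>x. cell_kernel k x z"
    have m: "expec u ?g = 0" using kernel_mean'[OF z] .
    have g2: "expec u (\<lambda>x. (?g x)\<^sup>2) = real k - 1" using kernel_second[OF z] by (simp add: kernel_sym[of z])
    have g4: "expec u (\<lambda>x. (?g x)^4) \<le> real k ^ 3" using kernel_fourth[OF z] by (simp add: kernel_sym[of z])
    have "expec (iid_pmf n u) (\<lambda>w. \<bar>psum ?g n w\<bar> ^ 3)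
      \<le> expec (iid_pmf n u) (\<lambda>w. (e * (psum ?g n w)\<^sup>2 + (psum ?g n w) ^ 4 / e) / 2)"
      by (intro expec_mono fin_iid *)
    also have "\<dots> = (e * (real n * (real k - 1)) + expec (iid_pmf n u) (\<lambda>w. (psum ?g n w) ^ 4) / e) / 2"
      using psum_second_moment[OF m, of n] g2 by simp
    also have "\<dots> \<le> (e * (real n * real k) + (real n * real k ^ 3 + 3 * (real n)\<^sup>2 * (real k)\<^sup>2) / e) / 2"
    proof -
      have "(real k - 1)\<^sup>2 \<le> (real k)\<^sup>2" using k by (intro power_mono) auto
      then have "expec (iid_pmf n u) (\<lambda>w. (psum ?g n w) ^ 4) \<le> real n * real k ^ 3 + 3 * (real n)\<^sup>2 * (real k)\<^sup>2"
        using g4 by (intro order_trans[OF psum_fourth_moment[OF m, of n]] add_mono mult_left_mono) (auto simp: g2)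
      then show ?thesis using e by (intro divide_right_mono add_mono mult_left_mono) auto
    qed
    finally show "expec (iid_pmf n u) (\<lambda>w. \<bar>psum ?g n w\<bar> ^ 3) \<le>
      (e * (real n * real k) + (real n * real k ^ 3 + 3 * (real n)\<^sup>2 * (real k)\<^sup>2) / e) / 2" .
  qed
  finally show ?thesis by simp
qed

section \<open>Characteristic functions of the U-statistic\<close>

definition cf :: "real \<Rightarrow> nat \<Rightarrow> complex" where
  "cf v n = expec (iid_pmf n u) (\<lambda>w. iexp (v * ustat (cell_kernel k) n w))"

text \<open>Given the first \<open>n\<close> draws, the factor contributed by the new increment is
  \<open>1 - a - v\<^sup>2 * ustat\<close> up to a third order error. The random term is charged to
  the error through its mean absolute value and \<open>1 - a\<close> is replaced by
  \<open>exp (- a)\<close>, so the past survives only as the previous characteristic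
  function.\<close>

lemma cf_step:
  defines "a \<equiv> \<lambda>v n. v\<^sup>2 * (real n * (real k - 1)) / 2"
  shows "cmod (cf v (Suc n) - exp (- complex_of_real (a v n)) * cf v n)
    \<le> v\<^sup>2 * expec (iid_pmf n u) (\<lambda>w. \<bar>ustat (cell_kernel k) n w\<bar>)
      + \<bar>v\<bar> ^ 3 / 6 * expec (iid_pmf n u) (\<lambda>w. expec u (\<lambda>z. \<bar>psum (\<lambda>x. cell_kernel k x z) n w\<bar> ^ 3))
      + (a v n)\<^sup>2 / 2"
proof -
  have lin: "expec (iid_pmf n u) (\<lambda>w. a * f w + b * g w + c) = a * expec (iid_pmf n u) f + b * expec (iid_pmf n u) g + c"
    for a b c and f g :: "(nat \<Rightarrow> nat) \<Rightarrow> real" by simp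
  have ord: "x \<le> a + b + c" if "x \<le> b + (c + a)" for x a b c :: real
    using that by simp
  let ?U = "ustat (cell_kernel k) n" and ?X = "\<lambda>w z. psum (\<lambda>x. cell_kernel k x z) n w"
  define A where "A = a v n"
  have A: "0 \<le> A" using k by (simp add: A_def a_def)
  have bound: "cmod (iexp (v * ?U w) * (expec u (\<lambda>z. iexp (v * ?X w z)) - exp (- complex_of_real A)))
      \<le> v\<^sup>2 * \<bar>?U w\<bar> + \<bar>v\<bar> ^ 3 / 6 * expec u (\<lambda>z. \<bar>?X w z\<bar> ^ 3) + A\<^sup>2 / 2"
    if w: "w \<in> set_pmf (iid_pmf n u)" for w
  proof -
    have ws: "\<And>a. a \<in> {1..n} \<Longrightarrow> w a \<in> {1..k}" using iid_support[OF w] .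
    have im: "expec u (\<lambda>z. ?X w z) = 0"
      by (rule increment_mean) (rule ws)
    have iv: "expec u (\<lambda>z. (?X w z)\<^sup>2) = real n * (real k - 1) + 2 * ?U w"
      by (rule increment_variance) (rule ws)
    have cube: "cmod (iexp x - (1 + \<i> * complex_of_real x - complex_of_real (x\<^sup>2 / 2))) \<le> \<bar>x\<bar> ^ 3 / 6" for x :: real
      using iexp_approx1[of x 2] by (simp add: eval_nat_numeral power2_eq_square field_simps)
    have "expec u (\<lambda>z. 1 + \<i> * complex_of_real (v * ?X w z) - complex_of_real ((v * ?X w z)\<^sup>2 / 2))
       = complex_of_real (1 - v\<^sup>2 * expec u (\<lambda>z. (?X w z)\<^sup>2) / 2) + \<i> * complex_of_real (v * expec u (?X w))"
      by (simp add: power_mult_distrib flip: of_real_power)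
    also have "\<dots> = complex_of_real (1 - A - v\<^sup>2 * ?U w)"
    proof -
      have "1 - v\<^sup>2 * (real n * (real k - 1) + 2 * ?U w) / 2 = 1 - A - v\<^sup>2 * ?U w"
        unfolding A_def a_def by (simp add: distrib_left add_divide_distrib)
      then show ?thesis by (simp only: im iv mult_zero_right of_real_0 add_0_right)
    qed
    finally have m: "expec u (\<lambda>z. 1 + \<i> * complex_of_real (v * ?X w z) - complex_of_real ((v * ?X w z)\<^sup>2 / 2))
       = complex_of_real (1 - A - v\<^sup>2 * ?U w)" .
    have "cmod (expec u (\<lambda>z. iexp (v * ?X w z)) - complex_of_real (1 - A - v\<^sup>2 * ?U w))
       = cmod (expec u (\<lambda>z. iexp (v * ?X w z) - (1 + \<i> * complex_of_real (v * ?X w z) - complex_of_real ((v * ?X w z)\<^sup>2 / 2))))"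
      unfolding m[symmetric] by (subst Bochner_Integration.integral_diff) auto
    also have "\<dots> \<le> expec u (\<lambda>z. \<bar>v * ?X w z\<bar> ^ 3 / 6)"
      by (rule order_trans[OF integral_norm_bound expec_mono[OF fin]], rule cube)
    also have "\<dots> = \<bar>v\<bar> ^ 3 / 6 * expec u (\<lambda>z. \<bar>?X w z\<bar> ^ 3)"
      by (simp add: abs_mult power_mult_distrib)
    finally have 1: "cmod (expec u (\<lambda>z. iexp (v * ?X w z)) - complex_of_real (1 - A - v\<^sup>2 * ?U w))
      \<le> \<bar>v\<bar> ^ 3 / 6 * expec u (\<lambda>z. \<bar>?X w z\<bar> ^ 3)" .
    have ea: "\<bar>1 - A - exp (- A)\<bar> \<le> A\<^sup>2 / 2"
    proof -
      have "1 - A \<le> exp (- A)" using exp_ge_add_one_self[of "- A"] by simp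
      moreover have "exp (- A) \<le> 1 - A + A\<^sup>2 / 2"
      proof -
        obtain t where t: "\<bar>t\<bar> \<le> \<bar>- A\<bar>" "exp (- A) = (\<Sum>m<3. (- A) ^ m / fact m) + exp t / fact 3 * (- A) ^ 3"
          using Maclaurin_exp_le[of "- A" 3] by blast
        \<comment> \<open>As \<open>A\<close> is nonnegative, the cubic remainder is nonpositive and
          the quadratic Taylor polynomial is an upper bound.\<close>
        have "exp t / fact 3 * (- A) ^ 3 \<le> 0" using A by (simp add: mult_nonneg_nonpos power3_eq_cube)
        then show ?thesis using t(2) by (simp add: eval_nat_numeral power2_eq_square)
      qed
      ultimately show ?thesis by simp
    qed
    have "cmod (complex_of_real (1 - A - v\<^sup>2 * ?U w) - exp (- complex_of_real A))
       = \<bar>(1 - A - exp (- A)) - v\<^sup>2 * ?U w\<bar>"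
    proof -
      have "complex_of_real (1 - A - v\<^sup>2 * ?U w) - exp (- complex_of_real A)
        = complex_of_real ((1 - A - exp (- A)) - v\<^sup>2 * ?U w)"
        by (simp flip: exp_of_real)
      then show ?thesis by (metis norm_of_real)
    qed
    also have "\<dots> \<le> A\<^sup>2 / 2 + v\<^sup>2 * \<bar>?U w\<bar>"
      using ea abs_triangle_ineq4[of "1 - A - exp (- A)" "v\<^sup>2 * ?U w"] by (simp add: abs_mult)
    finally have 2: "cmod (complex_of_real (1 - A - v\<^sup>2 * ?U w) - exp (- complex_of_real A)) \<le> A\<^sup>2 / 2 + v\<^sup>2 * \<bar>?U w\<bar>" .
    have "cmod (iexp (v * ?U w) * (expec u (\<lambda>z. iexp (v * ?X w z)) - exp (- complex_of_real A)))
      = cmod (expec u (\<lambda>z. iexp (v * ?X w z)) - exp (- complex_of_real A))"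
      by (simp add: norm_mult)
    also have "\<dots> \<le> \<bar>v\<bar> ^ 3 / 6 * expec u (\<lambda>z. \<bar>?X w z\<bar> ^ 3) + (A\<^sup>2 / 2 + v\<^sup>2 * \<bar>?U w\<bar>)"
      by (rule norm_diff_triangle_le[OF 1 2])
    finally show ?thesis by (rule ord)
  qed
  have step: "cf v (Suc n) - exp (- complex_of_real A) * cf v n
    = expec (iid_pmf n u) (\<lambda>w. iexp (v * ?U w) * (expec u (\<lambda>z. iexp (v * ?X w z)) - exp (- complex_of_real A)))"
  proof -
    have "cf v (Suc n) = expec (iid_pmf n u) (\<lambda>w. iexp (v * ?U w) * expec u (\<lambda>z. iexp (v * ?X w z)))"
      unfolding cf_def by (simp add: expec_Suc ustat_Suc distrib_left exp_add)
    moreover have "exp (- complex_of_real A) * cf v n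
      = expec (iid_pmf n u) (\<lambda>w. iexp (v * ?U w) * exp (- complex_of_real A))"
      unfolding cf_def by (simp add: mult.commute)
    ultimately show ?thesis
      by (simp only: right_diff_distrib) (subst Bochner_Integration.integral_diff; simp)
  qed
  have "cmod (cf v (Suc n) - exp (- complex_of_real A) * cf v n)
    \<le> expec (iid_pmf n u) (\<lambda>w. v\<^sup>2 * \<bar>?U w\<bar> + \<bar>v\<bar> ^ 3 / 6 * expec u (\<lambda>z. \<bar>?X w z\<bar> ^ 3) + A\<^sup>2 / 2)"
    unfolding step by (rule order_trans[OF integral_norm_bound]) (rule expec_mono[OF fin_iid bound])
  also have "\<dots> = v\<^sup>2 * expec (iid_pmf n u) (\<lambda>w. \<bar>?U w\<bar>)
      + \<bar>v\<bar> ^ 3 / 6 * expec (iid_pmf n u) (\<lambda>w. expec u (\<lambda>z. \<bar>?X w z\<bar> ^ 3)) + A\<^sup>2 / 2"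
    by (rule lin)
  finally show ?thesis unfolding A_def .
qed

text \<open>The factors \<open>exp (- a)\<close> have modulus at most 1, so the errors of the steps
  add up without amplification; their exponents sum to \<open>v^2 (k - 1) m (m - 1) / 4\<close>.
  Each step error is bounded by its value at \<open>n\<close>, hence the plain factor
  \<open>m\<close>.\<close>

lemma cf_approx:
  assumes "e > 0" "n > 0"
  shows "m \<le> n \<Longrightarrow> cmod (cf v m - exp (- complex_of_real (v\<^sup>2 * (real k - 1) * (real m * (real m - 1)) / 4)))
    \<le> real m * (v\<^sup>2 * (n * sqrt k) + \<bar>v\<bar> ^ 3 / 6 *
      ((e * (real n * real k) + (real n * real k ^ 3 + 3 * (real n)\<^sup>2 * (real k)\<^sup>2) / e) / 2)
      + (v\<^sup>2 * (real n * real k) / 2)\<^sup>2 / 2)"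
  (is "_ \<Longrightarrow> ?L m \<le> real m * ?B")
proof (induction m)
  case 0
  show ?case by (simp add: cf_def)
next
  case (Suc m)
  let ?a = "v\<^sup>2 * (real m * (real k - 1)) / 2"
  let ?G = "\<lambda>m. exp (- complex_of_real (v\<^sup>2 * (real k - 1) * (real m * (real m - 1)) / 4))"
  have mn: "real m \<le> real n" using Suc.prems by simp
  have G: "?G (Suc m) = exp (- complex_of_real ?a) * ?G m"
  proof -
    have "V * K * (real (Suc m) * (real (Suc m) - 1)) / 4
      = V * (real m * K) / 2 + V * K * (real m * (real m - 1)) / 4" for V K :: real
      by (simp add: field_simps)
    from this[of "v\<^sup>2" "real k - 1"] show ?thesis by (simp only: exp_add of_real_add minus_add_distrib)
  qed
  have 1: "cmod (cf v (Suc m) - exp (- complex_of_real ?a) * cf v m) \<le> ?B"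
  proof (rule order_trans[OF cf_step], intro add_mono mult_left_mono)
    show "expec (iid_pmf m u) (\<lambda>w. \<bar>ustat (cell_kernel k) m w\<bar>) \<le> n * sqrt k"
      using mn by (intro order_trans[OF ustat_L1] mult_right_mono) auto
    show "expec (iid_pmf m u) (\<lambda>w. expec u (\<lambda>z. \<bar>psum (\<lambda>x. cell_kernel k x z) m w\<bar> ^ 3))
      \<le> (e * (real n * real k) + (real n * real k ^ 3 + 3 * (real n)\<^sup>2 * (real k)\<^sup>2) / e) / 2"
      using mn assms
      by (intro order_trans[OF increment_L3[OF assms(1)]] divide_right_mono add_mono mult_left_mono
          mult_right_mono power_mono) auto
    show "(v\<^sup>2 * (real m * (real k - 1)) / 2)\<^sup>2 / 2 \<le> (v\<^sup>2 * (real n * real k) / 2)\<^sup>2 / 2"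
      using mn k by (intro divide_right_mono power_mono mult_left_mono mult_mono) auto
  qed auto
  have tri: "cmod (a - c * g) \<le> cmod (a - c * b) + cmod (c * (b - g))" for a b c g :: complex
    using norm_triangle_ineq[of "a - c * b" "c * (b - g)"] by (simp add: algebra_simps)
  have "?L (Suc m) \<le> ?B + cmod (exp (- complex_of_real ?a) * (cf v m - ?G m))"
    unfolding G by (rule order_trans[OF tri add_right_mono[OF 1]])
  also have "cmod (exp (- complex_of_real ?a) * (cf v m - ?G m)) \<le> 1 * cmod (cf v m - ?G m)"
    unfolding norm_mult using k by (intro mult_right_mono) auto
  also have "\<dots> \<le> real m * ?B" using Suc by simp
  finally show ?case by (simp add: distrib_right)
qed

text \<open>The weight \<open>eta\<close> balances the two terms in the bound of the third moments.\<close>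

lemma cf_bound:
  assumes n: "n > 0"
  defines "v \<equiv> \<lambda>t. t * sqrt 2 / (real n * sqrt k)"
    and "eta \<equiv> sqrt (real k / (real n)\<^sup>2 + 3 / real n)"
  shows "cmod (cf (v t) n - exp (- complex_of_real (t\<^sup>2 / 2 * ((1 - 1 / real k) * (1 - 1 / real n)))))
    \<le> 2 * t\<^sup>2 / sqrt k + sqrt 2 / 3 * \<bar>t\<bar> ^ 3 * eta + t ^ 4 / (2 * real n)"
proof -
  define s where "s = sqrt k"
  have s: "s > 0" "real k = s\<^sup>2" "sqrt (s\<^sup>2) = s" using k by (auto simp: s_def)
  have N: "real n > 0" using n by simp
  have "0 < real k / (real n)\<^sup>2 + 3 / real n"
    using n k by (intro add_pos_pos divide_pos_pos) auto
  then have eta: "eta > 0" "eta\<^sup>2 = s\<^sup>2 / (real n)\<^sup>2 + 3 / real n"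
    by (simp_all add: eta_def s(2))
  have r2: "sqrt 2 ^ 3 = 2 * sqrt 2" by (simp add: power3_eq_cube)
  have v2: "(v t)\<^sup>2 = 2 * t\<^sup>2 / ((real n)\<^sup>2 * s\<^sup>2)"
    by (simp add: v_def power_divide power_mult_distrib s_def)
  have v3: "\<bar>v t\<bar> ^ 3 = 2 * sqrt 2 * \<bar>t\<bar> ^ 3 / ((real n) ^ 3 * s ^ 3)"
    using s N by (simp add: v_def power_divide power_mult_distrib s_def[symmetric] r2 abs_mult)
  \<comment> \<open>\<open>eta\<close> measures the weight in units of the normalisation
    \<open>n sqrt k\<close>; \<open>cf_approx\<close> receives the unscaled weight.\<close>
  have e: "eta * real n * s > 0" using eta s N by simp
  have "(v t)\<^sup>2 * (real k - 1) * (real n * (real n - 1)) / 4 = t\<^sup>2 / 2 * ((1 - 1 / real k) * (1 - 1 / real n))"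
    unfolding v2 s(2) using s N by (simp add: field_simps power2_eq_square)
  then have "cmod (cf (v t) n - exp (- complex_of_real (t\<^sup>2 / 2 * ((1 - 1 / real k) * (1 - 1 / real n)))))
    \<le> real n * ((v t)\<^sup>2 * (n * s) + \<bar>v t\<bar> ^ 3 / 6 *
      ((eta * real n * s * (real n * s\<^sup>2) + (real n * (s\<^sup>2) ^ 3 + 3 * (real n)\<^sup>2 * (s\<^sup>2)\<^sup>2) / (eta * real n * s)) / 2)
      + ((v t)\<^sup>2 * (real n * s\<^sup>2) / 2)\<^sup>2 / 2)"
    using cf_approx[OF e n order_refl, of "v t"] by (simp only: s(2,3))
  also have "\<dots> = real n * ((v t)\<^sup>2 * (n * s)) + sqrt 2 / 6 * \<bar>t\<bar> ^ 3 * (eta + (s\<^sup>2 / (real n)\<^sup>2 + 3 / real n) / eta)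
      + real n * (((v t)\<^sup>2 * (real n * s\<^sup>2) / 2)\<^sup>2 / 2)"
  proof -
    let ?X = "s\<^sup>2 / (real n)\<^sup>2 + 3 / real n"
    have "(real n * (s\<^sup>2) ^ 3 + 3 * (real n)\<^sup>2 * (s\<^sup>2)\<^sup>2) = (real n)\<^sup>2 * s ^ 3 * ?X * (real n * s)"
      using N by (simp add: field_simps power2_eq_square power3_eq_cube)
    then have "(real n * (s\<^sup>2) ^ 3 + 3 * (real n)\<^sup>2 * (s\<^sup>2)\<^sup>2) / (eta * real n * s) = (real n)\<^sup>2 * s ^ 3 * (?X / eta)"
      using s(1) N eta(1) by simp
    moreover have "eta * real n * s * (real n * s\<^sup>2) = (real n)\<^sup>2 * s ^ 3 * eta"
      by (simp add: power2_eq_square power3_eq_cube)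
    ultimately have "(eta * real n * s * (real n * s\<^sup>2) + (real n * (s\<^sup>2) ^ 3 + 3 * (real n)\<^sup>2 * (s\<^sup>2)\<^sup>2) / (eta * real n * s)) / 2
      = (real n)\<^sup>2 * s ^ 3 * (eta + ?X / eta) / 2"
      by (simp add: distrib_left)
    moreover have "real n * (\<bar>v t\<bar> ^ 3 / 6 * ((real n)\<^sup>2 * s ^ 3 * Z / 2)) = sqrt 2 / 6 * \<bar>t\<bar> ^ 3 * Z" for Z
      unfolding v3 using s(1) N by (simp add: power2_eq_square power3_eq_cube)
    ultimately show ?thesis by (simp only: distrib_left[of "real n"])
  qed
  also have "real n * ((v t)\<^sup>2 * (n * s)) = 2 * t\<^sup>2 / s"
    unfolding v2 using s(1) N by (simp add: field_simps power2_eq_square)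
  also have "real n * (((v t)\<^sup>2 * (real n * s\<^sup>2) / 2)\<^sup>2 / 2) = t ^ 4 / (2 * real n)"
    unfolding v2 using s(1) N by (simp add: field_simps power2_eq_square power4_eq_xxxx)
  also have "(s\<^sup>2 / (real n)\<^sup>2 + 3 / real n) / eta = eta"
    unfolding eta(2)[symmetric] using eta(1) by (simp add: power2_eq_square)
  finally show ?thesis by (simp add: s_def mult_ac)
qed

end

text \<open>Each term of \<open>cf_bound\<close> vanishes for its own reason: the first by
  \<open>klim\<close>, the one with \<open>eta\<close> by \<open>kn\<close> and \<open>nlim\<close>,
  the last by \<open>nlim\<close>. General index sequences are needed because (ii) works with sample
  sizes \<open>m n\<close>.\<close>

theorem ustat_clt:
  fixes n k :: "nat \<Rightarrow> nat"
  assumes npos: "\<And>j. n j > 0" and kpos: "\<And>j. k j > 0"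
    and nlim: "filterlim n at_top sequentially" and klim: "filterlim k at_top sequentially"
    and kn: "(\<lambda>j. real (k j) / (real (n j))\<^sup>2) \<longlonglongrightarrow> 0"
  shows "(\<lambda>j. measure_pmf.prob (iid_pmf (n j) (uniform_pmf (k j)))
      {w. sqrt 2 * ustat (cell_kernel (k j)) (n j) w / (real (n j) * sqrt (k j)) \<le> z})
    \<longlonglongrightarrow> cdf std_normal_distribution z"
proof -
  interpret uniform_cells "k j" for j by unfold_locales (rule kpos)
  define X where "X j w = sqrt 2 * ustat (cell_kernel (k j)) (n j) w / (real (n j) * sqrt (k j))" for j w
  define M where "M j = distr (measure_pmf (iid_pmf (n j) (uniform_pmf (k j)))) borel (X j)" for j
  have M: "real_distribution (M j)" for j
    unfolding M_def by (intro prob_space.real_distribution_distr measure_pmf.prob_space_axioms) simp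
  have n': "filterlim (\<lambda>j. real (n j)) at_top sequentially" and k': "filterlim (\<lambda>j. real (k j)) at_top sequentially"
    using filterlim_compose[OF filterlim_real_sequentially nlim] filterlim_compose[OF filterlim_real_sequentially klim]
    by simp_all
  have inv: "(\<lambda>j. 1 / real (n j)) \<longlonglongrightarrow> 0" "(\<lambda>j. 1 / real (k j)) \<longlonglongrightarrow> 0"
    using n' k' by (auto intro!: tendsto_divide_0[OF tendsto_const] filterlim_at_top_imp_at_infinity)
  have isq: "(\<lambda>j. 1 / sqrt (k j)) \<longlonglongrightarrow> 0"
    using tendsto_real_sqrt[OF inv(2)] by (simp add: real_sqrt_divide)
  have "weak_conv_m M std_normal_distribution"
  proof (rule levy_continuity[OF M real_dist_normal_dist])
    fix t :: real
    let ?G = "\<lambda>j. exp (- complex_of_real (t\<^sup>2 / 2 * ((1 - 1 / real (k j)) * (1 - 1 / real (n j)))))"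
    have ch: "char (M j) t = cf j (t * sqrt 2 / (real (n j) * sqrt (k j))) (n j)" for j
      unfolding char_def M_def cf_def by (subst integral_distr) (auto simp: X_def mult_ac)
    have "(\<lambda>j. (2 * t\<^sup>2) * (1 / sqrt (k j)) + sqrt 2 / 3 * \<bar>t\<bar> ^ 3 * sqrt (real (k j) / (real (n j))\<^sup>2 + 3 * (1 / real (n j)))
        + t ^ 4 / 2 * (1 / real (n j))) \<longlonglongrightarrow>
      (2 * t\<^sup>2) * 0 + sqrt 2 / 3 * \<bar>t\<bar> ^ 3 * sqrt (0 + 3 * 0) + t ^ 4 / 2 * 0"
      by (intro tendsto_add tendsto_mult tendsto_const tendsto_real_sqrt kn isq inv)
    then have B: "(\<lambda>j. 2 * t\<^sup>2 / sqrt (k j) + sqrt 2 / 3 * \<bar>t\<bar> ^ 3 * sqrt (real (k j) / (real (n j))\<^sup>2 + 3 / real (n j))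
        + t ^ 4 / (2 * real (n j))) \<longlonglongrightarrow> 0" by simp
    have "(\<lambda>j. char (M j) t - ?G j) \<longlonglongrightarrow> 0"
      unfolding ch by (rule Lim_null_comparison[OF always_eventually B]) (intro allI cf_bound npos)
    moreover have "?G \<longlonglongrightarrow> exp (- complex_of_real (t\<^sup>2 / 2 * ((1 - 0) * (1 - 0))))"
      by (intro tendsto_exp tendsto_minus tendsto_of_real tendsto_mult tendsto_diff tendsto_const inv)
    ultimately have "(\<lambda>j. (char (M j) t - ?G j) + ?G j) \<longlonglongrightarrow> 0 + exp (- complex_of_real (t\<^sup>2 / 2 * ((1 - 0) * (1 - 0))))"
      by (rule tendsto_add)
    then show "(\<lambda>j. char (M j) t) \<longlonglongrightarrow> char std_normal_distribution t"
      unfolding char_std_normal_distribution by (simp flip: exp_of_real)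
  qed
  \<comment> \<open>The limit law has no atoms, so weak convergence yields convergence of the
    distribution functions at every \<open>z\<close>.\<close>
  moreover have "isCont (cdf std_normal_distribution) z"
  proof -
    interpret N: real_distribution std_normal_distribution by (rule real_dist_normal_dist)
    have "emeasure std_normal_distribution {z} = 0"
      by (subst emeasure_density) (auto intro!: nn_integral_null_set)
    then show ?thesis by (simp add: N.isCont_cdf measure_def)
  qed
  ultimately have "(\<lambda>j. cdf (M j) z) \<longlonglongrightarrow> cdf std_normal_distribution z"
    by (simp add: weak_conv_m_def weak_conv_def)
  moreover have "cdf (M j) z = measure_pmf.prob (iid_pmf (n j) (uniform_pmf (k j))) {w. X j w \<le> z}" for j
    unfolding cdf_def M_def by (subst measure_distr) (auto intro!: arg_cong2[where f = measure])
  ultimately show ?thesis by (simp add: X_def)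
qed

section \<open>Coupling with the uniform law\<close>

lemma expec_square_le:
  fixes f :: "'a \<Rightarrow> real"
  assumes "finite (set_pmf p)"
  shows "(expec p f)\<^sup>2 \<le> expec p (\<lambda>x. (f x)\<^sup>2)"
proof -
  have "\<bar>expec p f\<bar> \<le> sqrt (expec p (\<lambda>x. (f x)\<^sup>2))"
    using expec_abs_le[OF assms, of f] integral_abs_bound[of p f] by linarith
  then show ?thesis by (metis real_sqrt_abs real_sqrt_le_iff)
qed

lemma ustat_linear:
  "ustat (\<lambda>x y. a * h x y + b * g x y) n w = a * ustat h n w + b * ustat g n w"
  by (simp add: ustat_def sum.distrib sum_distrib_left)

text \<open>Each index lies in \<open>n - 1\<close> of the \<open>n (n - 1) / 2\<close>
  pairs.\<close>

lemma ustat_add_separable: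
  "ustat (\<lambda>x y. h x y + (g x + g y) + c) n w
    = ustat h n w + (real n - 1) * psum g n w + c * (real n * (real n - 1) / 2)"
proof (induction n)
  case (Suc n)
  have "psum (\<lambda>x. h x (w (Suc n)) + (g x + g (w (Suc n))) + c) n w =
      psum (\<lambda>x. h x (w (Suc n))) n w + psum g n w + n * g (w (Suc n)) + n * c"
    by (simp add: psum_def sum.distrib)
  then show ?case using Suc by (simp add: ustat_Suc psum_Suc field_simps)
qed simp

text \<open>Hoeffding's decomposition of \<open>h\<close> into \<open>t\<close>, \<open>g\<close> in
  either argument, and \<open>h2\<close>. The part \<open>h2\<close> is centred in both arguments
  and contributes order \<open>n^2\<close>; the linear part contributes order \<open>n^3\<close> but
  involves only the conditional means \<open>h1\<close>, for which a better bound is at hand in the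
  application.\<close>

lemma (in finite_pmf) ustat_variance:
  fixes h :: "'a \<Rightarrow> 'a \<Rightarrow> real"
  assumes sym: "\<And>x y. h x y = h y x"
  defines "h1 \<equiv> \<lambda>z. expec q (\<lambda>x. h x z)"
  defines "t \<equiv> expec q h1"
  shows "expec (iid_pmf n q) (\<lambda>w. (ustat h n w - t * (real n * (real n - 1) / 2))\<^sup>2)
    \<le> 16 * (real n)\<^sup>2 * expec q (\<lambda>z. expec q (\<lambda>x. (h x z)\<^sup>2)) + 2 * real n ^ 3 * expec q (\<lambda>z. (h1 z)\<^sup>2)"
proof -
  define g where "g z = h1 z - t" for z
  define h2 where "h2 x z = h x z - g x - g z - t" for x z
  define H where "H = expec q (\<lambda>z. expec q (\<lambda>x. (h x z)\<^sup>2))"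
  define H1 where "H1 = expec q (\<lambda>z. (h1 z)\<^sup>2)"
  have g0: "expec q g = 0" by (simp add: g_def[abs_def] t_def)
  have d2: "expec q (\<lambda>x. h2 x z) = 0" for z
    using g0 by (simp add: h2_def) (simp add: g_def h1_def)
  have d1: "expec q (\<lambda>z. h2 x z) = 0" for x
    using d2[of x] by (simp add: h2_def sym[of x] algebra_simps)
  have t2: "t\<^sup>2 \<le> H1" unfolding t_def H1_def by (rule expec_square_le[OF fin])
  have H1: "H1 \<le> H" unfolding H_def H1_def h1_def
    by (intro expec_mono fin expec_square_le)
  have eg: "expec q (\<lambda>z. (g z)\<^sup>2) = H1 - t\<^sup>2"
    by (simp add: g_def power2_diff H1_def) (simp add: t_def power2_eq_square)
  have "expec q (\<lambda>z. expec q (\<lambda>x. (h2 x z)\<^sup>2)) \<le> expec q (\<lambda>z. expec q (\<lambda>x. 4 * (h x z)\<^sup>2 + 4 * (g x)\<^sup>2 + 4 * (g z)\<^sup>2 + 4 * t\<^sup>2))"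
  proof (intro expec_mono fin)
    fix x z
    have "(a - b - c - d)\<^sup>2 \<le> 4 * a\<^sup>2 + 4 * b\<^sup>2 + 4 * c\<^sup>2 + 4 * d\<^sup>2" for a b c d :: real
    proof -
      have "0 \<le> (a + b)\<^sup>2 + (a + c)\<^sup>2 + (a + d)\<^sup>2 + (b - c)\<^sup>2 + (b - d)\<^sup>2 + (c - d)\<^sup>2" by simp
      then show ?thesis by (simp add: power2_eq_square algebra_simps)
    qed
    then show "(h2 x z)\<^sup>2 \<le> 4 * (h x z)\<^sup>2 + 4 * (g x)\<^sup>2 + 4 * (g z)\<^sup>2 + 4 * t\<^sup>2" by (simp add: h2_def)
  qed
  also have "\<dots> = 4 * H + 8 * (H1 - t\<^sup>2) + 4 * t\<^sup>2"
    by (simp add: eg H_def)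
  also have "\<dots> \<le> 16 * H"
  proof -
    have "4 * A + 8 * (B - C) + 4 * C \<le> 16 * A" if "B \<le> A" "C \<le> B" "0 \<le> C" for A B C :: real
      using that by (simp add: algebra_simps)
    from this[OF H1 t2 zero_le_power2] show ?thesis .
  qed
  finally have h2: "expec q (\<lambda>z. expec q (\<lambda>x. (h2 x z)\<^sup>2)) \<le> 16 * H" .
  have dec: "ustat h n w - t * (real n * (real n - 1) / 2) = ustat h2 n w + (real n - 1) * psum g n w" for w
    using ustat_add_separable[of h2 g t n w] by (simp add: h2_def)
  have "expec (iid_pmf n q) (\<lambda>w. (ustat h n w - t * (real n * (real n - 1) / 2))\<^sup>2)
    \<le> expec (iid_pmf n q) (\<lambda>w. 2 * (ustat h2 n w)\<^sup>2 + 2 * (real n - 1)\<^sup>2 * (psum g n w)\<^sup>2)"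
  proof (intro expec_mono fin_iid)
    have "(a + b)\<^sup>2 \<le> 2 * a\<^sup>2 + 2 * b\<^sup>2" for a b :: real
      using zero_le_power2[of "a - b"] by (simp add: power2_eq_square algebra_simps)
    from this[of "ustat h2 n w" "(real n - 1) * psum g n w" for w]
    show "(ustat h n w - t * (real n * (real n - 1) / 2))\<^sup>2
      \<le> 2 * (ustat h2 n w)\<^sup>2 + 2 * (real n - 1)\<^sup>2 * (psum g n w)\<^sup>2" for w
      unfolding dec by (simp only: power_mult_distrib mult.assoc)
  qed
  also have "\<dots> = real n * (real n - 1) * expec q (\<lambda>z. expec q (\<lambda>x. (h2 x z)\<^sup>2))
      + 2 * (real n - 1)\<^sup>2 * (real n * (H1 - t\<^sup>2))"
    by (simp add: ustat_second_moment[OF d1 d2] psum_second_moment[OF g0] eg)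
  also have "\<dots> \<le> (real n)\<^sup>2 * (16 * H) + 2 * (real n)\<^sup>2 * (real n * H1)"
  proof (intro add_mono)
    have "0 \<le> expec q (\<lambda>z. expec q (\<lambda>x. (h2 x z)\<^sup>2))" by simp
    moreover have "real n * (real n - 1) \<le> (real n)\<^sup>2" by (simp add: power2_eq_square algebra_simps)
    ultimately show "real n * (real n - 1) * expec q (\<lambda>z. expec q (\<lambda>x. (h2 x z)\<^sup>2)) \<le> (real n)\<^sup>2 * (16 * H)"
      using h2 by (intro mult_mono) auto
    show "2 * (real n - 1)\<^sup>2 * (real n * (H1 - t\<^sup>2)) \<le> 2 * (real n)\<^sup>2 * (real n * H1)"
    proof (cases "n = 0")
      case False
      then have "(real n - 1)\<^sup>2 \<le> (real n)\<^sup>2" by (intro power_mono) auto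
      then show ?thesis using t2 by (intro mult_mono) auto
    qed simp
  qed
  finally show ?thesis unfolding H_def H1_def by (simp add: power2_eq_square power3_eq_cube algebra_simps)
qed

text \<open>Coordinates outside \<open>{1..n}\<close> are reset explicitly, because
  \<open>f undefined\<close> need not be \<open>undefined\<close>.\<close>

lemma iid_pmf_map:
  "iid_pmf n (map_pmf f q) = map_pmf (\<lambda>w a. if a \<in> {1..n} then f (w a) else undefined) (iid_pmf n q)"
proof -
  have "iid_pmf n (map_pmf f q) =
      map_pmf (\<lambda>w x. if x \<in> {1..n} then w x else undefined) (Pi_pmf {1..n} (f undefined) (\<lambda>_. map_pmf f q))"
    unfolding iid_pmf_def by (rule Pi_pmf_default_swap[symmetric]) simp
  also have "Pi_pmf {1..n} (f undefined) (\<lambda>_. map_pmf f q) = map_pmf ((\<circ>) f) (iid_pmf n q)"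
    unfolding iid_pmf_def by (rule Pi_pmf_map) simp_all
  finally show ?thesis by (simp only: pmf.map_comp comp_def)
qed

lemma ustat_restrict [simp]:
  "ustat h n (\<lambda>a. if a \<in> {1..n} then f (w a) else c) = ustat (\<lambda>x y. h (f x) (f y)) n w"
  unfolding ustat_def by (intro sum.cong refl) auto

text \<open>The common mass, the minimum of both weights, sits on the diagonal, and the excesses
  \<open>pos\<close> and \<open>neg\<close> are coupled independently off it. The last clause says
  that the first coordinate, restricted to disagreement, is distributed as the positive part of the
  difference.\<close>

lemma maximal_coupling:
  fixes p u :: "'a pmf"
  assumes fin: "finite S" and p: "set_pmf p \<subseteq> S" and u: "set_pmf u \<subseteq> S"
  obtains q where "set_pmf q \<subseteq> S \<times> S" "map_pmf fst q = p" "map_pmf snd q = u"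
    "\<forall>phi :: 'a \<Rightarrow> real. expec q (\<lambda>(x, y). phi x * of_bool (x \<noteq> y))
      = (\<Sum>x\<in>S. phi x * max 0 (pmf p x - pmf u x))"
proof -
  define pos neg where "pos x = max 0 (pmf p x - pmf u x)" and "neg x = max 0 (pmf u x - pmf p x)" for x
  define m where "m x = min (pmf p x) (pmf u x)" for x
  define tau where "tau = sum pos S"
  have sp: "sum (pmf p) S = 1" and su: "sum (pmf u) S = 1"
    using sum_pmf_eq_1[OF fin p] sum_pmf_eq_1[OF fin u] by auto
  have pm: "pmf p x = m x + pos x" "pmf u x = m x + neg x" for x
    by (auto simp: m_def pos_def neg_def)
  have nn: "pos x \<ge> 0" "neg x \<ge> 0" "m x \<ge> 0" "pos x * neg x = 0" for x
    by (auto simp: m_def pos_def neg_def max_def)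
  have tau': "tau = sum neg S"
    using sp su unfolding tau_def by (simp add: pm sum.distrib)
  have t0: "tau = 0 \<Longrightarrow> x \<in> S \<Longrightarrow> pos x = 0" "tau = 0 \<Longrightarrow> x \<in> S \<Longrightarrow> neg x = 0" for x
    using nn fin tau' by (auto simp: tau_def sum_nonneg_eq_0_iff)
  \<comment> \<open>For \<open>tau = 0\<close> the quotients take the default value 0, which is
    right because \<open>pos\<close> and \<open>neg\<close> then vanish on \<open>S\<close>.\<close>
  have post: "pos x * tau / tau = pos x" "tau * neg x / tau = neg x" if "x \<in> S" for x
    using t0 that by (cases "tau = 0"; simp)+
  define f where "f = (\<lambda>(x, y). if x \<in> S \<and> y \<in> S then (if x = y then m x else 0) + pos x * neg y / tau else 0)"
  have tau0: "tau \<ge> 0" using nn by (auto simp: tau_def intro: sum_nonneg)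
  have f0: "f z \<ge> 0" for z using nn tau0 by (auto simp: f_def split: prod.splits)
  have row: "(\<Sum>y\<in>S. f (x, y)) = pmf p x" if "x \<in> S" for x
    using that fin post[OF that] by (simp add: f_def sum.distrib pm tau' flip: sum_distrib_left sum_divide_distrib)
  have col: "(\<Sum>x\<in>S. f (x, y)) = pmf u y" if "y \<in> S" for y
    using that fin post[OF that] by (simp add: f_def sum.distrib pm tau_def flip: sum_distrib_right sum_divide_distrib)
  have tot: "(\<Sum>z\<in>S \<times> S. f z) = 1"
    using row sp by (simp add: sum.cartesian_product')
  define q where "q = embed_pmf f"
  have "(\<integral>\<^sup>+ z. ennreal (f z) \<partial>count_space UNIV) = (\<Sum>z\<in>S \<times> S. ennreal (f z))"
    using fin by (intro nn_integral_count_space'[where A = "S \<times> S"]) (auto simp: f_def split: if_splits)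
  also have "\<dots> = 1" using tot f0 by (simp add: sum_ennreal)
  finally have q: "pmf q z = f z" for z
    unfolding q_def using f0 by (intro pmf_embed_pmf) auto
  have set_q: "set_pmf q \<subseteq> S \<times> S" by (auto simp: set_pmf_eq q f_def split: if_splits)
  have ex: "expec q F = (\<Sum>x\<in>S. \<Sum>y\<in>S. F (x, y) * f (x, y))" for F :: "'a \<times> 'a \<Rightarrow> real"
    using fin set_q by (subst integral_measure_pmf_real[of "S \<times> S"]) (auto simp: q sum.cartesian_product')
  have "map_pmf fst q = p"
  proof (rule pmf_eqI)
    fix i
    have "pmf (map_pmf fst q) i = expec q (indicator (fst -` {i}))" by (simp add: pmf_map)
    also have "\<dots> = (\<Sum>x\<in>S. if x = i then (\<Sum>y\<in>S. f (x, y)) else 0)"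
      unfolding ex by (intro sum.cong refl) (auto simp: indicator_def)
    also have "\<dots> = pmf p i"
      using fin row[of i] p by (auto simp: pmf_eq_0_set_pmf)
    finally show "pmf (map_pmf fst q) i = pmf p i" .
  qed
  moreover have "map_pmf snd q = u"
  proof (rule pmf_eqI)
    fix i
    have "pmf (map_pmf snd q) i = expec q (indicator (snd -` {i}))" by (simp add: pmf_map)
    also have "\<dots> = (\<Sum>y\<in>S. if y = i then (\<Sum>x\<in>S. f (x, y)) else 0)"
      unfolding ex by (subst sum.swap) (intro sum.cong refl, auto simp: indicator_def)
    also have "\<dots> = pmf u i"
      using fin col[of i] u by (auto simp: pmf_eq_0_set_pmf)
    finally show "pmf (map_pmf snd q) i = pmf u i" .
  qed
  moreover have "expec q (\<lambda>(x, y). phi x * of_bool (x \<noteq> y)) = (\<Sum>x\<in>S. phi x * max 0 (pmf p x - pmf u x))"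
    for phi :: "'a \<Rightarrow> real"
    unfolding ex
  proof (intro sum.cong refl)
    fix x assume x: "x \<in> S"
    \<comment> \<open>At \<open>y = x\<close> the left side vanishes through \<open>of_bool\<close>
      and the right side through \<open>pos x * neg x = 0\<close>.\<close>
    have "(\<Sum>y\<in>S. (case (x, y) of (x, y) \<Rightarrow> phi x * of_bool (x \<noteq> y)) * f (x, y)) = (\<Sum>y\<in>S. phi x * (pos x * neg y / tau))"
      using x nn(4)[of x] by (intro sum.cong refl) (auto simp: f_def)
    also have "\<dots> = phi x * (pos x * tau / tau)"
      by (simp only: tau' sum_distrib_left sum_divide_distrib)
    finally show "(\<Sum>y\<in>S. (case (x, y) of (x, y) \<Rightarrow> phi x * of_bool (x \<noteq> y)) * f (x, y)) = phi x * max 0 (pmf p x - pmf u x)"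
      using post[OF x] by (simp add: pos_def)
  qed
  ultimately show ?thesis using that set_q by blast
qed

text \<open>Scaled to limiting variance 1 under uniform cells.\<close>

definition nstat :: "nat \<Rightarrow> nat \<Rightarrow> (nat \<Rightarrow> nat) \<Rightarrow> real" where
  "nstat k n w = sqrt 2 * ustat (cell_kernel k) n w / (real n * sqrt k)"

definition sq_dev :: "nat \<Rightarrow> nat pmf \<Rightarrow> real" where
  "sq_dev k p = (\<Sum>l\<in>{1..k}. (pmf p l - 1 / k)\<^sup>2)"

text \<open>For \<open>p\<close> supported on the cells, the mean of \<open>nstat\<close> is this
  number times \<open>(1 - 1 / n) / sqrt 2\<close>.\<close>

definition noncentrality :: "nat \<Rightarrow> nat \<Rightarrow> nat pmf \<Rightarrow> real" where
  "noncentrality k n p = real n * sqrt k * sq_dev k p"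

text \<open>The first two terms come from the full kernel in \<open>ustat_variance\<close>, the last
  two from its linear part. When \<open>sqrt k / n\<close> and \<open>1 / sqrt k\<close> tend to 0,
  all four vanish for bounded \<open>x\<close>, and they are small relative to
  \<open>x\<^sup>2\<close> uniformly for \<open>x\<close> away from 0.\<close>

definition var_bound :: "nat \<Rightarrow> nat \<Rightarrow> real \<Rightarrow> real" where
  "var_bound k n x = 128 * sqrt (x * (sqrt k / n)) + 64 * (x * (sqrt k / n)) + 4 * (x / sqrt k)
     + 4 * (x * sqrt (x * (sqrt k / n)))"

lemma sq_dev_nonneg: "sq_dev k p \<ge> 0"
  by (simp add: sq_dev_def sum_nonneg)

text \<open>With pairs drawn from the maximal coupling, the difference of the two statistics is a
  multiple of one U-statistic, whose kernel \<open>h\<close> is the difference of the coincidence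
  indicators. Its conditional means are given by \<open>d\<close>, its mean is \<open>D\<close>, and
  it vanishes unless one of the two pairs disagrees; this is the input for
  \<open>ustat_variance\<close>.\<close>

theorem coupled_statistics:
  assumes n: "n > 0" and k: "k > 0" and p: "set_pmf p \<subseteq> {1..k}"
  obtains Q :: "(nat \<Rightarrow> nat \<times> nat) pmf" and X Y where
    "finite (set_pmf Q)" "iid_pmf n p = map_pmf X Q" "iid_pmf n (uniform_pmf k) = map_pmf Y Q"
    "expec Q (\<lambda>w. (nstat k n (X w) - nstat k n (Y w) - (1 - 1 / n) * noncentrality k n p / sqrt 2)\<^sup>2)
      \<le> var_bound k n (noncentrality k n p)"
proof -
  interpret U: uniform_cells k by unfold_locales (rule k)
  let ?u = "uniform_pmf k"
  define S where "S = {1..k}"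
  have S: "finite S" "set_pmf ?u \<subseteq> S" "set_pmf p \<subseteq> S" "card S = k"
    using p U.set_u by (auto simp: S_def)
  have pu: "pmf ?u x = 1 / k" if "x \<in> S" for x
    using that k by (simp add: uniform_pmf_def S_def)
  define d where "d x = pmf p x - 1 / k" for x
  define D where "D = (\<Sum>x\<in>S. (d x)\<^sup>2)"
  have sp: "sum (pmf p) S = 1" using S by (intro sum_pmf_eq_1) auto
  have sd: "sum d S = 0" using sp S k by (simp add: d_def sum_subtractf)
  obtain q where q: "set_pmf q \<subseteq> S \<times> S" "map_pmf fst q = p" "map_pmf snd q = ?u"
    and qd: "\<forall>phi :: nat \<Rightarrow> real. expec q (\<lambda>(x, y). phi x * of_bool (x \<noteq> y)) = (\<Sum>x\<in>S. phi x * max 0 (pmf p x - pmf ?u x))"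
    using maximal_coupling[OF S(1,3,2)] by blast
  interpret q: finite_pmf q
    by unfold_locales (use q(1) S(1) finite_subset in blast)
  define h where "h = (\<lambda>z z' :: nat \<times> nat. of_bool (fst z = fst z') - of_bool (snd z = snd z') :: real)"
  have efst: "expec q (\<lambda>z. F (fst z)) = expec p F" for F :: "nat \<Rightarrow> real"
    by (simp flip: q(2))
  have esnd: "expec q (\<lambda>z. F (snd z)) = expec ?u F" for F :: "nat \<Rightarrow> real"
    by (simp flip: q(3))
  have ep: "expec p F = (\<Sum>x\<in>S. F x * pmf p x)" for F :: "nat \<Rightarrow> real"
    using S by (intro integral_measure_pmf_real) auto
  have eqp: "expec q (\<lambda>z'. of_bool (fst z' = x)) = pmf p x" if "x \<in> S" for x
  proof -
    have "expec q (\<lambda>z'. of_bool (fst z' = x)) = (\<Sum>y\<in>S. of_bool (y = x) * pmf p y)"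
      by (simp only: efst[of "\<lambda>y. of_bool (y = x)"] ep)
    also have "\<dots> = (\<Sum>y\<in>S. if y = x then pmf p y else 0)" by (intro sum.cong) auto
    finally show ?thesis using that S by simp
  qed
  have equ: "expec q (\<lambda>z'. of_bool (snd z' = x)) = 1 / k" if "x \<in> S" for x
  proof -
    have "expec q (\<lambda>z'. of_bool (snd z' = x)) = (\<Sum>y\<in>S. if y = x then 1 else 0) / k"
      unfolding esnd[of "\<lambda>y. of_bool (y = x)"] by (simp only: U.expec_u S_def of_bool_def)
    then show ?thesis using that S by simp
  qed
  have h1: "expec q (\<lambda>z'. h z' z) = d (fst z)" if "z \<in> set_pmf q" for z
    using q(1) that eqp[of "fst z"] equ[of "snd z"] unfolding h_def d_def
    by (subst Bochner_Integration.integral_diff) auto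
  have mean: "expec q (\<lambda>z. expec q (\<lambda>z'. h z' z)) = D"
  proof -
    have "expec q (\<lambda>z. expec q (\<lambda>z'. h z' z)) = expec q (\<lambda>z. d (fst z))"
      by (intro expec_cong h1)
    also have "\<dots> = (\<Sum>x\<in>S. d x * pmf p x)" by (simp only: efst ep)
    also have "\<dots> = (\<Sum>x\<in>S. (d x)\<^sup>2 + d x / k)"
      by (intro sum.cong refl) (simp add: d_def power2_eq_square field_simps)
    also have "\<dots> = D" using sd by (simp add: sum.distrib D_def flip: sum_divide_distrib)
    finally show ?thesis .
  qed
  \<comment> \<open>The only pointwise control of \<open>d\<close>, since the density may be
    unbounded.\<close>
  have dle: "\<bar>d x\<bar> \<le> sqrt D" if "x \<in> S" for x
    using that S by (intro real_le_rsqrt) (auto simp: D_def intro: member_le_sum)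
  have first: "expec q (\<lambda>z. (expec q (\<lambda>z'. h z' z))\<^sup>2) \<le> D / k + D * sqrt D"
  proof -
    have "expec q (\<lambda>z. (expec q (\<lambda>z'. h z' z))\<^sup>2) = expec q (\<lambda>z. (d (fst z))\<^sup>2)"
      by (intro expec_cong) (simp add: h1)
    also have "\<dots> = (\<Sum>x\<in>S. (d x)\<^sup>2 * pmf p x)" by (simp only: efst[of "\<lambda>x. (d x)\<^sup>2"] ep)
    also have "\<dots> \<le> (\<Sum>x\<in>S. (d x)\<^sup>2 / k + (d x)\<^sup>2 * sqrt D)"
    proof (intro sum_mono)
      fix x assume "x \<in> S"
      then have "pmf p x \<le> 1 / k + sqrt D" using dle[of x] by (simp add: d_def abs_le_iff)
      then have "(d x)\<^sup>2 * pmf p x \<le> (d x)\<^sup>2 * (1 / k + sqrt D)" by (intro mult_left_mono) auto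
      then show "(d x)\<^sup>2 * pmf p x \<le> (d x)\<^sup>2 / k + (d x)\<^sup>2 * sqrt D" by (simp add: distrib_left)
    qed
    also have "\<dots> = D / k + D * sqrt D"
      by (simp add: sum.distrib D_def sum_distrib_right sum_divide_distrib)
    finally show ?thesis .
  qed
  \<comment> \<open>Cauchy-Schwarz: the probability that a pair disagrees is at most of order
    \<open>sqrt (k D)\<close>.\<close>
  have L1: "(\<Sum>x\<in>S. \<bar>d x\<bar>) \<le> sqrt (real k * D)"
    using L2_set_mult_ineq[of d "\<lambda>_. 1" S] S(4)
    by (simp add: L2_set_def D_def real_sqrt_mult mult.commute)
  have second: "expec q (\<lambda>z. expec q (\<lambda>z'. (h z' z)\<^sup>2)) \<le> 4 * sqrt (real k * D) / k + 2 * D"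
  proof -
    define e where "e z = (of_bool (fst z \<noteq> snd z) :: real)" for z :: "nat \<times> nat"
    define c1 c2 where "c1 z' z = (of_bool (fst z' = fst z) :: real)"
      and "c2 z' z = (of_bool (snd z' = snd z) :: real)" for z' z :: "nat \<times> nat"
    define G where "G z' z = c1 z' z * e z + c2 z' z * e z" for z' z
    \<comment> \<open>\<open>h\<close> is nonzero only if one of its two pairs has unequal
      components; every coincidence is charged to such a pair.\<close>
    have "(h z' z)\<^sup>2 \<le> G z' z + G z z'" for z z'
      by (cases z; cases z') (auto simp: h_def G_def c1_def c2_def e_def of_bool_def)
    then have "expec q (\<lambda>z. expec q (\<lambda>z'. (h z' z)\<^sup>2)) \<le> expec q (\<lambda>z. expec q (\<lambda>z'. G z' z + G z z'))"
      by (intro expec_mono q.fin)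
    also have "\<dots> = expec q (\<lambda>z. expec q (\<lambda>z'. G z' z)) + expec q (\<lambda>z. expec q (\<lambda>z'. G z z'))"
      by simp
    also have "expec q (\<lambda>z. expec q (\<lambda>z'. G z z')) = expec q (\<lambda>z. expec q (\<lambda>z'. G z' z))"
      by (rule expec_swap[OF q.fin q.fin])
    also have "expec q (\<lambda>z. expec q (\<lambda>z'. G z' z)) = expec q (\<lambda>z. (pmf p (fst z) + 1 / k) * e z)"
    proof (intro expec_cong)
      fix z assume "z \<in> set_pmf q"
      then have "fst z \<in> S" "snd z \<in> S" using q(1) by auto
      then have "expec q (\<lambda>z'. c1 z' z) = pmf p (fst z)" "expec q (\<lambda>z'. c2 z' z) = 1 / k"
        using eqp[of "fst z"] equ[of "snd z"] by (simp_all add: c1_def c2_def)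
      then show "expec q (\<lambda>z'. G z' z) = (pmf p (fst z) + 1 / k) * e z"
        by (simp add: G_def distrib_right)
    qed
    \<comment> \<open>Uniformity of the second marginal made the weight a function of the first
      coordinate alone, so the disagreement clause of the coupling applies.\<close>
    also have "\<dots> = (\<Sum>x\<in>S. (pmf p x + 1 / k) * max 0 (pmf p x - pmf ?u x))"
      using spec[OF qd, of "\<lambda>x. pmf p x + 1 / k"] by (simp add: e_def case_prod_unfold)
    also have "\<dots> \<le> (\<Sum>x\<in>S. 2 / k * \<bar>d x\<bar> + (d x)\<^sup>2)"
    proof (intro sum_mono)
      fix x assume "x \<in> S"
      have "(pmf p x + 1 / k) * max 0 (pmf p x - pmf ?u x) \<le> (2 / k + \<bar>d x\<bar>) * \<bar>d x\<bar>"
        using pu[OF \<open>x \<in> S\<close>] by (intro mult_mono) (auto simp: d_def)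
      then show "(pmf p x + 1 / k) * max 0 (pmf p x - pmf ?u x) \<le> 2 / k * \<bar>d x\<bar> + (d x)\<^sup>2"
        by (simp add: distrib_right power2_eq_square flip: abs_mult)
    qed
    also have "\<dots> = 2 / k * (\<Sum>x\<in>S. \<bar>d x\<bar>) + D"
      by (simp only: sum.distrib D_def sum_distrib_left)
    also have "\<dots> \<le> 2 / k * sqrt (real k * D) + D"
      using L1 by (intro add_mono mult_left_mono) auto
    finally show ?thesis by simp
  qed
  define c where "c = sqrt 2 * sqrt k / n"
  define X where "X w = (\<lambda>a. if a \<in> {1..n} then fst (w a) else undefined)" for w :: "nat \<Rightarrow> nat \<times> nat"
  define Y where "Y w = (\<lambda>a. if a \<in> {1..n} then snd (w a) else undefined)" for w :: "nat \<Rightarrow> nat \<times> nat"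
  have diff: "nstat k n (X w) - nstat k n (Y w) = c * ustat h n w" for w
  proof -
    have "ustat (cell_kernel k) n (X w) - ustat (cell_kernel k) n (Y w)
      = real k * ustat h n w"
      unfolding X_def Y_def ustat_restrict
      using ustat_linear[of "1" "\<lambda>x y. cell_kernel k (fst x) (fst y)" "-1" "\<lambda>x y. cell_kernel k (snd x) (snd y)" n w]
        ustat_linear[of "real k" h 0 h n w]
      by (simp add: cell_kernel_def h_def right_diff_distrib)
    then have "nstat k n (X w) - nstat k n (Y w) = sqrt 2 * (real k * ustat h n w) / (n * sqrt k)"
      unfolding nstat_def by (simp only: diff_divide_distrib[symmetric] right_diff_distrib[symmetric])
    also have "\<dots> = c * ustat h n w"
    proof -
      have "sqrt 2 * (s * s * u) / (n * s) = sqrt 2 * s / n * u" if "s > 0" for s u :: real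
        using that by simp
      from this[of "sqrt k"] show ?thesis using k by (simp add: c_def)
    qed
    finally show ?thesis .
  qed
  have sD: "sq_dev k p = D" by (simp add: sq_dev_def D_def d_def S_def)
  have shift: "(1 - 1 / n) * noncentrality k n p / sqrt 2 = c * (D * (real n * (real n - 1) / 2))"
  proof -
    have "a / sqrt 2 = sqrt 2 * a / 2" for a by (simp add: field_simps)
    then show ?thesis using n by (simp add: noncentrality_def sD c_def field_simps)
  qed
  define r where "r = sqrt k / n"
  have x: "noncentrality k n p * r = real k * D" "noncentrality k n p / sqrt k = n * D"
    "noncentrality k n p * sqrt (real k * D) = real n * real k * (D * sqrt D)"
    using n k by (simp_all add: noncentrality_def sD r_def real_sqrt_mult field_simps)
  have c2: "c\<^sup>2 = 2 * real k / (real n)\<^sup>2" by (simp add: c_def power_divide power_mult_distrib)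
  have "expec (iid_pmf n q) (\<lambda>w. (nstat k n (X w) - nstat k n (Y w) - (1 - 1 / n) * noncentrality k n p / sqrt 2)\<^sup>2)
    = c\<^sup>2 * expec (iid_pmf n q) (\<lambda>w. (ustat h n w - D * (real n * (real n - 1) / 2))\<^sup>2)"
    unfolding diff shift by (simp only: right_diff_distrib[symmetric] power_mult_distrib) simp
  also have "\<dots> \<le> c\<^sup>2 * (16 * (real n)\<^sup>2 * (4 * sqrt (real k * D) / k + 2 * D) + 2 * real n ^ 3 * (D / k + D * sqrt D))"
  proof (rule mult_left_mono)
    have sym: "h x y = h y x" for x y by (auto simp: h_def of_bool_def)
    show "expec (iid_pmf n q) (\<lambda>w. (ustat h n w - D * (real n * (real n - 1) / 2))\<^sup>2)
      \<le> 16 * (real n)\<^sup>2 * (4 * sqrt (real k * D) / k + 2 * D) + 2 * real n ^ 3 * (D / k + D * sqrt D)"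
      by (rule order_trans[OF q.ustat_variance[of h n, OF sym, unfolded mean]], intro add_mono mult_left_mono first second) auto
  qed simp
  also have "\<dots> = 128 * sqrt (real k * D) + 64 * (real k * D) + 4 * (n * D) + 4 * (real n * real k * (D * sqrt D))"
    unfolding c2 using n k by (simp add: field_simps power2_eq_square power3_eq_cube)
  also have "\<dots> = var_bound k n (noncentrality k n p)"
    by (simp only: var_bound_def r_def[symmetric] x)
  finally show ?thesis
    using that[of "iid_pmf n q" X Y] q(2,3) iid_pmf_map[of n fst q] iid_pmf_map[of n snd q]
    by (simp add: X_def[abs_def] Y_def[abs_def] del: atLeastAtMost_iff)
qed

section \<open>Limits of rejection probabilities\<close>

definition gauss_tail :: "real \<Rightarrow> real" where
  "gauss_tail z = 1 - cdf std_normal_distribution z"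

lemma isCont_std_normal_cdf: "isCont (cdf std_normal_distribution) z"
proof -
  interpret N: real_distribution std_normal_distribution by (rule real_dist_normal_dist)
  have "emeasure std_normal_distribution {z} = 0"
    by (subst emeasure_density) (auto intro!: nn_integral_null_set)
  then show ?thesis by (simp add: N.isCont_cdf measure_def)
qed

lemma isCont_gauss_tail: "isCont gauss_tail z"
  unfolding gauss_tail_def by (intro continuous_intros isCont_std_normal_cdf)

text \<open>Strictness is the source of the positive gain of the power over the level.\<close>

lemma gauss_tail_strict:
  assumes "a < b"
  shows "gauss_tail b < gauss_tail a"
proof -
  interpret N: real_distribution std_normal_distribution by (rule real_dist_normal_dist)
  have "emeasure std_normal_distribution {a<..b} \<noteq> 0"
  proof
    assume "emeasure std_normal_distribution {a<..b} = 0"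
    then have "{a<..b} \<in> null_sets std_normal_distribution" by auto
    then have "AE x in lborel. x \<in> {a<..b} \<longrightarrow> ennreal (std_normal_density x) = 0"
      by (subst (asm) null_sets_density_iff) auto
    then have "AE x in lborel. x \<notin> {a<..b}"
    proof (rule AE_mp, intro AE_I2 impI notI)
      fix x assume x: "x \<in> {a<..b} \<longrightarrow> ennreal (std_normal_density x) = 0" "x \<in> {a<..b}"
      then show False using normal_density_pos[of 1 0 x] by (auto simp: ennreal_eq_0_iff)
    qed
    then have "{a<..b} \<in> null_sets lborel" using AE_iff_null_sets[of "{a<..b}" lborel] by simp
    then show False using assms by (simp add: null_sets_def)
  qed
  then have "0 < measure std_normal_distribution {a<..b}"
    by (simp add: N.emeasure_eq_measure zero_less_measure_iff)
  then show ?thesis using N.cdf_diff_eq[OF assms] by (simp add: gauss_tail_def)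
qed

lemma gauss_tail_onto:
  assumes "0 < a" "a < 1"
  obtains z where "gauss_tail z = a"
proof -
  interpret N: real_distribution std_normal_distribution by (rule real_dist_normal_dist)
  let ?F = "cdf std_normal_distribution"
  have "eventually (\<lambda>z. 1 - a < ?F z) at_top"
    using order_tendstoD(1)[OF N.cdf_lim_at_top_prob, of "1 - a"] assms by simp
  then obtain Z where Z: "\<And>z. z \<ge> Z \<Longrightarrow> 1 - a < ?F z" by (auto simp: eventually_at_top_linorder)
  have "eventually (\<lambda>z. ?F z < 1 - a) at_bot"
    using order_tendstoD(2)[OF N.cdf_lim_at_bot, of "1 - a"] assms by simp
  then obtain Y where Y: "\<And>z. z \<le> Y \<Longrightarrow> ?F z < 1 - a" by (auto simp: eventually_at_bot_linorder)
  have "\<exists>z\<ge>min Y Z. z \<le> max Y Z \<and> ?F z = 1 - a"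
    using Z[of "max Y Z"] Y[of "min Y Z"] isCont_std_normal_cdf
    by (intro IVT) auto
  then obtain z where "?F z = 1 - a" by blast
  then show ?thesis using that[of z] by (simp add: gauss_tail_def)
qed

section \<open>Rejection probabilities at a fixed sample size\<close>

definition rej_prob :: "nat \<Rightarrow> nat \<Rightarrow> nat pmf \<Rightarrow> real \<Rightarrow> real" where
  "rej_prob n k p t = measure_pmf.prob (iid_pmf n p) {w. t < nstat k n w}"

lemma rej_prob_antimono: "s \<le> t \<Longrightarrow> rej_prob n k p t \<le> rej_prob n k p s"
  unfolding rej_prob_def by (intro measure_pmf.finite_measure_mono) auto

lemma pmf_Chebyshev:
  fixes Z :: "'a \<Rightarrow> real"
  assumes fin: "finite (set_pmf Q)" and e: "e > 0" and A: "\<And>w. w \<in> A \<Longrightarrow> e \<le> \<bar>Z w\<bar>"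
  shows "measure_pmf.prob Q A \<le> expec Q (\<lambda>w. (Z w)\<^sup>2) / e\<^sup>2"
proof -
  have "measure_pmf.prob Q A = expec Q (indicator A)" by simp
  also have "\<dots> \<le> expec Q (\<lambda>w. (Z w)\<^sup>2 / e\<^sup>2)"
  proof (rule expec_mono[OF fin])
    fix w
    show "indicator A w \<le> (Z w)\<^sup>2 / e\<^sup>2"
    proof (cases "w \<in> A")
      case True
      then have "e\<^sup>2 \<le> (Z w)\<^sup>2" using A[OF True] e by (metis abs_le_square_iff abs_of_pos)
      then show ?thesis using True e by simp
    qed simp
  qed
  finally show ?thesis by simp
qed

text \<open>Here the shift counts as error: the second moment of the difference, shift included,
  enters Chebyshev's inequality, and the threshold moves by \<open>e\<close>.\<close>

lemma rej_prob_upper: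
  assumes n: "n > 0" and k: "k > 0" and p: "set_pmf p \<subseteq> {1..k}" and e: "e > 0"
  defines "x \<equiv> noncentrality k n p"
  shows "rej_prob n k p t \<le> rej_prob n k (uniform_pmf k) (t - e) + (2 * var_bound k n x + x\<^sup>2) / e\<^sup>2"
proof -
  obtain Q :: "(nat \<Rightarrow> nat \<times> nat) pmf" and X Y where fin: "finite (set_pmf Q)" and X: "iid_pmf n p = map_pmf X Q"
    and Y: "iid_pmf n (uniform_pmf k) = map_pmf Y Q"
    and V: "expec Q (\<lambda>w. (nstat k n (X w) - nstat k n (Y w) - (1 - 1 / n) * x / sqrt 2)\<^sup>2) \<le> var_bound k n x"
    unfolding x_def by (rule coupled_statistics[OF n k p])
  define m where "m = (1 - 1 / n) * x / sqrt 2"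
  define Z where "Z w = nstat k n (X w) - nstat k n (Y w)" for w
  have "m\<^sup>2 = (1 - 1 / n)\<^sup>2 * x\<^sup>2 / 2" by (simp add: m_def power_mult_distrib power_divide)
  also have "\<dots> \<le> 1 * x\<^sup>2 / 2"
    using n by (intro divide_right_mono mult_right_mono power_le_one) auto
  finally have m: "m\<^sup>2 \<le> x\<^sup>2 / 2" by simp
  have "expec Q (\<lambda>w. (Z w)\<^sup>2) \<le> expec Q (\<lambda>w. 2 * (Z w - m)\<^sup>2 + 2 * m\<^sup>2)"
  proof (intro expec_mono fin)
    have "a\<^sup>2 \<le> 2 * (a - b)\<^sup>2 + 2 * b\<^sup>2" for a b :: real
      using zero_le_power2[of "a - 2 * b"] by (simp add: power2_eq_square algebra_simps)
    then show "(Z w)\<^sup>2 \<le> 2 * (Z w - m)\<^sup>2 + 2 * m\<^sup>2" for w .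
  qed
  also have "\<dots> = 2 * expec Q (\<lambda>w. (Z w - m)\<^sup>2) + 2 * m\<^sup>2"
    by (simp add: integrable_measure_pmf_finite[OF fin])
  also have "\<dots> \<le> 2 * var_bound k n x + x\<^sup>2" using V m by (simp add: Z_def m_def)
  finally have Z: "expec Q (\<lambda>w. (Z w)\<^sup>2) \<le> 2 * var_bound k n x + x\<^sup>2" .
  have "rej_prob n k p t = measure_pmf.prob Q {w. t < nstat k n (X w)}"
    unfolding rej_prob_def X by (simp add: vimage_def)
  also have "\<dots> \<le> measure_pmf.prob Q ({w. t - e < nstat k n (Y w)} \<union> {w. e \<le> \<bar>Z w\<bar>})"
    by (intro measure_pmf.finite_measure_mono) (auto simp: Z_def)
  also have "\<dots> \<le> measure_pmf.prob Q {w. t - e < nstat k n (Y w)} + measure_pmf.prob Q {w. e \<le> \<bar>Z w\<bar>}"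
    by (rule measure_Un_le) auto
  also have "measure_pmf.prob Q {w. t - e < nstat k n (Y w)} = rej_prob n k (uniform_pmf k) (t - e)"
    unfolding rej_prob_def Y by (simp add: vimage_def)
  also have "measure_pmf.prob Q {w. e \<le> \<bar>Z w\<bar>} \<le> expec Q (\<lambda>w. (Z w)\<^sup>2) / e\<^sup>2"
    by (rule pmf_Chebyshev[OF fin e]) simp
  also have "\<dots> \<le> (2 * var_bound k n x + x\<^sup>2) / e\<^sup>2"
    using Z by (intro divide_right_mono) auto
  finally show ?thesis by simp
qed

text \<open>For \<open>n \<ge> 2\<close> the shift is at least \<open>x / 4\<close>. Half of it
  lowers the threshold and the other half is the deviation permitted in Chebyshev's inequality,
  whence \<open>x / 8\<close> and the constant 64.\<close>

lemma rej_prob_lower: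
  assumes n: "n \<ge> 2" and k: "k > 0" and p: "set_pmf p \<subseteq> {1..k}"
  defines "x \<equiv> noncentrality k n p"
  assumes x: "x > 0"
  shows "rej_prob n k (uniform_pmf k) (t - x / 8) - 64 * var_bound k n x / x\<^sup>2 \<le> rej_prob n k p t"
proof -
  have n0: "n > 0" using n by simp
  obtain Q :: "(nat \<Rightarrow> nat \<times> nat) pmf" and X Y where fin: "finite (set_pmf Q)" and X: "iid_pmf n p = map_pmf X Q"
    and Y: "iid_pmf n (uniform_pmf k) = map_pmf Y Q"
    and V: "expec Q (\<lambda>w. (nstat k n (X w) - nstat k n (Y w) - (1 - 1 / n) * x / sqrt 2)\<^sup>2) \<le> var_bound k n x"
    unfolding x_def by (rule coupled_statistics[OF n0 k p])
  define m where "m = (1 - 1 / n) * x / sqrt 2"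
  define Z where "Z w = nstat k n (X w) - nstat k n (Y w) - m" for w
  have "1 / real n \<le> 1 / 2" using n by (simp add: field_simps)
  then have "1 / 2 * x / 2 \<le> (1 - 1 / n) * x / sqrt 2"
    using x sqrt2_less_2 by (intro frac_le mult_right_mono mult_nonneg_nonneg) auto
  then have m: "x / 4 \<le> m" by (simp add: m_def)
  have "rej_prob n k (uniform_pmf k) (t - x / 8) = measure_pmf.prob Q {w. t - x / 8 < nstat k n (Y w)}"
    unfolding rej_prob_def Y by (simp add: vimage_def)
  also have "\<dots> \<le> measure_pmf.prob Q ({w. t < nstat k n (X w)} \<union> {w. x / 8 \<le> \<bar>Z w\<bar>})"
  proof (intro measure_pmf.finite_measure_mono subsetI)
    fix w assume w: "w \<in> {w. t - x / 8 < nstat k n (Y w)}"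
    show "w \<in> {w. t < nstat k n (X w)} \<union> {w. x / 8 \<le> \<bar>Z w\<bar>}"
    proof (cases "x / 8 \<le> \<bar>Z w\<bar>")
      case False
      then have "- (x / 8) < Z w" by (simp add: abs_le_iff not_le abs_less_iff)
      then show ?thesis using w m by (simp add: Z_def)
    qed simp
  qed simp
  also have "\<dots> \<le> measure_pmf.prob Q {w. t < nstat k n (X w)} + measure_pmf.prob Q {w. x / 8 \<le> \<bar>Z w\<bar>}"
    by (rule measure_Un_le) auto
  also have "measure_pmf.prob Q {w. t < nstat k n (X w)} = rej_prob n k p t"
    unfolding rej_prob_def X by (simp add: vimage_def)
  also have "measure_pmf.prob Q {w. x / 8 \<le> \<bar>Z w\<bar>} \<le> expec Q (\<lambda>w. (Z w)\<^sup>2) / (x / 8)\<^sup>2"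
    using x by (intro pmf_Chebyshev[OF fin]) auto
  also have "\<dots> \<le> var_bound k n x / (x / 8)\<^sup>2"
    using V by (intro divide_right_mono) (auto simp: Z_def m_def)
  also have "\<dots> = 64 * var_bound k n x / x\<^sup>2" by (simp add: power_divide)
  finally show ?thesis by simp
qed

section \<open>Limits along index sequences\<close>

locale asymptotics =
  fixes n k :: "nat \<Rightarrow> nat"
  assumes npos: "\<And>j. n j > 0" and kpos: "\<And>j. k j > 0"
    and nlim: "filterlim n at_top sequentially" and klim: "filterlim k at_top sequentially"
    and kn: "(\<lambda>j. real (k j) / (real (n j))\<^sup>2) \<longlonglongrightarrow> 0"
begin

lemma rej_null: "(\<lambda>j. rej_prob (n j) (k j) (uniform_pmf (k j)) z) \<longlonglongrightarrow> gauss_tail z"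
proof -
  have "rej_prob (n j) (k j) (uniform_pmf (k j)) z
    = 1 - measure_pmf.prob (iid_pmf (n j) (uniform_pmf (k j)))
      {w. sqrt 2 * ustat (cell_kernel (k j)) (n j) w / (real (n j) * sqrt (k j)) \<le> z}" for j
  proof -
    have "{w. z < nstat (k j) (n j) w} = UNIV -
      {w. sqrt 2 * ustat (cell_kernel (k j)) (n j) w / (real (n j) * sqrt (k j)) \<le> z}"
      by (auto simp: nstat_def)
    then show ?thesis unfolding rej_prob_def
      using measure_pmf.prob_compl[of _ "iid_pmf (n j) (uniform_pmf (k j))"] by simp
  qed
  then show ?thesis unfolding gauss_tail_def
    using tendsto_diff[OF tendsto_const ustat_clt[OF npos kpos nlim klim kn], of 1 z] by simp
qed

lemma rho_lim: "(\<lambda>j. sqrt (k j) / real (n j)) \<longlonglongrightarrow> 0"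
  using tendsto_real_sqrt[OF kn] by (simp add: real_sqrt_divide)

lemma isqrt_lim: "(\<lambda>j. 1 / sqrt (k j)) \<longlonglongrightarrow> 0"
proof -
  have "(\<lambda>j. 1 / real (k j)) \<longlonglongrightarrow> 0"
    using filterlim_compose[OF filterlim_real_sequentially klim]
    by (intro tendsto_divide_0[OF tendsto_const] filterlim_at_top_imp_at_infinity) simp
  from tendsto_real_sqrt[OF this] show ?thesis by (simp add: real_sqrt_divide)
qed

text \<open>The thresholds \<open>t j\<close> need not converge. A fixed \<open>z\<close> whose tail
  is slightly above \<open>a\<close> lies below all late \<open>t j\<close>, since null rejection
  probabilities decrease in the threshold; the comparison is then made at \<open>z\<close>.\<close>

lemma rej_upper_limit:
  assumes p: "\<And>j. set_pmf (p j) \<subseteq> {1..k j}"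
    and x: "(\<lambda>j. noncentrality (k j) (n j) (p j)) \<longlonglongrightarrow> 0"
    and a: "0 < a" "a < 1" and lim: "(\<lambda>j. rej_prob (n j) (k j) (uniform_pmf (k j)) (t j)) \<longlonglongrightarrow> a"
    and e: "e > 0"
  shows "eventually (\<lambda>j. rej_prob (n j) (k j) (p j) (t j) < a + e) sequentially"
proof -
  \<comment> \<open>Above \<open>a\<close> by at most \<open>e / 2\<close>, and below 1 so that it
    is the tail of some \<open>z\<close>.\<close>
  define b where "b = min ((1 + a) / 2) (a + e / 2)"
  have b: "a < b" "b < 1" "0 < b" "b \<le> a + e / 2" using a e by (auto simp: b_def min_def field_simps)
  obtain z where z: "gauss_tail z = b" using gauss_tail_onto[OF b(3,2)] .
  have "\<exists>d>0. \<forall>y. \<bar>y - z\<bar> < d \<longrightarrow> \<bar>gauss_tail y - gauss_tail z\<bar> < e / 2"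
    using isCont_gauss_tail[of z] e unfolding continuous_at_eps_delta dist_real_def by (meson half_gt_zero)
  then obtain d where d: "d > 0" "\<And>y. \<bar>y - z\<bar> < d \<Longrightarrow> \<bar>gauss_tail y - gauss_tail z\<bar> < e / 2" by blast
  have tail: "gauss_tail (z - d / 2) < a + e"
  proof -
    have "\<bar>gauss_tail (z - d / 2) - gauss_tail z\<bar> < e / 2" using d(1) by (intro d(2)) simp
    then have "gauss_tail (z - d / 2) - gauss_tail z < e / 2" by (rule abs_less_iff[THEN iffD1, THEN conjunct1])
    then show ?thesis using z b(4) by simp
  qed
  define x' where "x' j = noncentrality (k j) (n j) (p j)" for j
  note x = x[folded x'_def]
  have "(\<lambda>j. rej_prob (n j) (k j) (uniform_pmf (k j)) (z - d / 2) + (2 * var_bound (k j) (n j) (x' j) + (x' j)\<^sup>2) / (d / 2)\<^sup>2)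
    \<longlonglongrightarrow> gauss_tail (z - d / 2) + (2 * (128 * sqrt (0 * 0) + 64 * (0 * 0) + 4 * (0 * 0) + 4 * (0 * sqrt (0 * 0))) + 0\<^sup>2) / (d / 2)\<^sup>2"
    unfolding var_bound_def divide_inverse[of "x' _"] inverse_eq_divide[of "sqrt (real (k _))"] using d(1)
    by (intro tendsto_add tendsto_divide tendsto_mult tendsto_power tendsto_real_sqrt tendsto_const rej_null x rho_lim isqrt_lim) auto
  then have L: "(\<lambda>j. rej_prob (n j) (k j) (uniform_pmf (k j)) (z - d / 2) + (2 * var_bound (k j) (n j) (x' j) + (x' j)\<^sup>2) / (d / 2)\<^sup>2)
    \<longlonglongrightarrow> gauss_tail (z - d / 2)" by simp
  have "eventually (\<lambda>j. rej_prob (n j) (k j) (uniform_pmf (k j)) (z - d / 2) + (2 * var_bound (k j) (n j) (x' j) + (x' j)\<^sup>2) / (d / 2)\<^sup>2 < a + e) sequentially"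
    by (rule order_tendstoD(2)[OF L tail])
  moreover have "eventually (\<lambda>j. rej_prob (n j) (k j) (uniform_pmf (k j)) (t j) < (a + b) / 2) sequentially"
    by (rule order_tendstoD(2)[OF lim]) (use b in auto)
  moreover have "eventually (\<lambda>j. (a + b) / 2 < rej_prob (n j) (k j) (uniform_pmf (k j)) z) sequentially"
    by (rule order_tendstoD(1)[OF rej_null]) (use b z in auto)
  ultimately show ?thesis
  proof eventually_elim
    case (elim j)
    have "z \<le> t j"
      using elim(2,3) rej_prob_antimono[of "t j" z "n j" "k j" "uniform_pmf (k j)"] by linarith
    then have "rej_prob (n j) (k j) (p j) (t j) \<le> rej_prob (n j) (k j) (p j) z" by (rule rej_prob_antimono)
    also have "\<dots> \<le> rej_prob (n j) (k j) (uniform_pmf (k j)) (z - d / 2) + (2 * var_bound (k j) (n j) (x' j) + (x' j)\<^sup>2) / (d / 2)\<^sup>2"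
      unfolding x'_def using d(1) by (intro rej_prob_upper npos kpos p) auto
    finally show ?case using elim(1) by linarith
  qed
qed

text \<open>The bound is uniform over all laws with noncentrality at least \<open>d\<close>, as the
  supremum over alternatives requires. \<open>eta\<close> is a third of the limiting gain when the
  threshold drops by \<open>d / 8\<close>: one third pays for the convergence under uniform cells,
  one for the error \<open>B\<close>.\<close>

lemma rej_lower_limit:
  assumes d: "d > 0"
  obtains eta where "eta > 0" "eventually (\<lambda>j. \<forall>p. set_pmf p \<subseteq> {1..k j} \<longrightarrow> d \<le> noncentrality (k j) (n j) p \<longrightarrow>
      gauss_tail z + eta \<le> rej_prob (n j) (k j) p z) sequentially"
proof
  define eta where "eta = (gauss_tail (z - d / 8) - gauss_tail z) / 3"
  show eta: "eta > 0" using gauss_tail_strict[of "z - d / 8" z] d by (simp add: eta_def)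
  define r where "r j = sqrt (k j) / real (n j)" for j
  define B where "B j = 64 * (128 * (sqrt (r j / d) / d) + 64 * (r j / d) + 4 * (1 / sqrt (k j) / d) + 4 * sqrt (r j / d))" for j
  have rlim: "r \<longlonglongrightarrow> 0" using rho_lim by (simp add: r_def[abs_def])
  have "B \<longlonglongrightarrow> 64 * (128 * (sqrt (0 / d) / d) + 64 * (0 / d) + 4 * (0 / d) + 4 * sqrt (0 / d))"
    unfolding B_def[abs_def] using d
    by (intro tendsto_add tendsto_divide tendsto_mult tendsto_real_sqrt tendsto_const rlim isqrt_lim) auto
  then have B: "B \<longlonglongrightarrow> 0" by simp
  \<comment> \<open>Relative to \<open>x\<^sup>2\<close> every term of \<open>var_bound\<close>
    decreases in \<open>x\<close>, so \<open>x = d\<close> is the worst case.\<close>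
  have Bx: "64 * var_bound (k j) (n j) x / x\<^sup>2 \<le> B j" if x: "d \<le> x" for x j
  proof -
    have x0: "x > 0" and r0: "r j \<ge> 0" using x d by (auto simp: r_def)
    have s: "sqrt (x * r j) = x * sqrt (r j / x)"
      using x0 by (simp add: real_sqrt_mult real_sqrt_divide field_simps)
    have "64 * var_bound (k j) (n j) x / x\<^sup>2
      = 64 * (128 * (sqrt (r j / x) / x) + 64 * (r j / x) + 4 * (1 / sqrt (k j) / x) + 4 * sqrt (r j / x))"
      unfolding var_bound_def r_def[symmetric] s using x0 by (simp add: field_simps power2_eq_square)
    also have "\<dots> \<le> B j"
      unfolding B_def using x x0 d r0 kpos[of j]
      by (intro mult_left_mono add_mono frac_le real_sqrt_le_mono) auto
    finally show ?thesis .
  qed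
  have "eventually (\<lambda>j. B j < eta) sequentially" by (rule order_tendstoD(2)[OF B eta])
  moreover have "eventually (\<lambda>j. gauss_tail z + 2 * eta < rej_prob (n j) (k j) (uniform_pmf (k j)) (z - d / 8)) sequentially"
    by (rule order_tendstoD(1)[OF rej_null]) (use eta in \<open>simp add: eta_def field_simps\<close>)
  moreover have "eventually (\<lambda>j. 2 \<le> n j) sequentially"
    using nlim by (simp add: filterlim_at_top)
  ultimately show "eventually (\<lambda>j. \<forall>p. set_pmf p \<subseteq> {1..k j} \<longrightarrow> d \<le> noncentrality (k j) (n j) p \<longrightarrow>
      gauss_tail z + eta \<le> rej_prob (n j) (k j) p z) sequentially"
  proof eventually_elim
    case (elim j)
    show ?case
    proof (intro allI impI)
      fix p assume p: "set_pmf p \<subseteq> {1..k j}" and x: "d \<le> noncentrality (k j) (n j) p"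
      let ?x = "noncentrality (k j) (n j) p"
      have "rej_prob (n j) (k j) (uniform_pmf (k j)) (z - d / 8) \<le> rej_prob (n j) (k j) (uniform_pmf (k j)) (z - ?x / 8)"
        using x by (intro rej_prob_antimono) auto
      moreover have "rej_prob (n j) (k j) (uniform_pmf (k j)) (z - ?x / 8) - 64 * var_bound (k j) (n j) ?x / ?x\<^sup>2 \<le> rej_prob (n j) (k j) p z"
        using x d by (intro rej_prob_lower elim kpos p) auto
      moreover have "64 * var_bound (k j) (n j) ?x / ?x\<^sup>2 \<le> B j" by (rule Bx[OF x])
      ultimately show "gauss_tail z + eta \<le> rej_prob (n j) (k j) p z" using elim by linarith
    qed
  qed
qed

end

section \<open>From the sample to the cells\<close>

text \<open>The ceiling fits cells that are open on the left and closed on the right, as differences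
  of \<open>empirical_cdf\<close> count them.\<close>

definition cell :: "nat \<Rightarrow> real \<Rightarrow> nat" where
  "cell k x = nat \<lceil>real k * x\<rceil>"

definition cell_set :: "nat \<Rightarrow> nat \<Rightarrow> real set" where
  "cell_set k l = {(real l - 1) / real k<..real l / real k}"

lemma mem_cell_set:
  assumes "k > 0" "l \<ge> 1"
  shows "x \<in> cell_set k l \<longleftrightarrow> cell k x = l"
proof -
  have "cell k x = l \<longleftrightarrow> \<lceil>real k * x\<rceil> = int l" using assms by (auto simp: cell_def)
  also have "\<dots> \<longleftrightarrow> real l - 1 < real k * x \<and> real k * x \<le> real l"
    by (simp add: ceiling_eq_iff)
  finally show ?thesis using assms by (auto simp: cell_set_def field_simps)
qed

lemma cell_range:
  assumes "k > 0" "0 < x" "x < 1"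
  shows "cell k x \<in> {1..k}"
proof -
  have "0 < real k * x" "real k * x \<le> real k" using assms by auto
  then show ?thesis by (simp add: cell_def Suc_le_eq ceiling_le_iff)
qed

section \<open>The statistic in terms of cell coincidences\<close>

lemma double_sum_ustat:
  assumes "\<And>x y. h x y = h y x"
  shows "(\<Sum>b\<in>{1..n}. \<Sum>a\<in>{1..n}. h (w a) (w b)) = (\<Sum>b\<in>{1..n}. h (w b) (w b)) + 2 * ustat h n w"
proof (induction n)
  case (Suc n)
  have "(\<Sum>b\<in>{1..n}. h (w (Suc n)) (w b)) = psum (\<lambda>x. h x (w (Suc n))) n w"
    unfolding psum_def by (intro sum.cong refl assms)
  then show ?case using Suc by (simp add: sum.distrib ustat_Suc psum_def)
qed simp

text \<open>A sum of squared counts is the number of ordered pairs, diagonal included, that share a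
  cell.\<close>

lemma sum_card_squares:
  fixes w :: "nat \<Rightarrow> nat"
  assumes w: "\<And>j. j \<in> {1..n} \<Longrightarrow> w j \<in> {1..k}"
  shows "(\<Sum>i\<in>{1..k}. (real (card {j \<in> {1..n}. w j = i}))\<^sup>2) = n + 2 * ustat (\<lambda>x y. of_bool (x = y)) n w"
    and "(\<Sum>i\<in>{1..k}. real (card {j \<in> {1..n}. w j = i})) = n"
proof -
  have c: "real (card {j \<in> {1..n}. w j = i}) = (\<Sum>j\<in>{1..n}. of_bool (w j = i))" for i
    by (simp add: of_bool_def sum.If_cases Int_def)
  have one: "(\<Sum>i\<in>{1..k}. of_bool (w j = i) * F i) = (F (w j) :: real)" if "j \<in> {1..n}" for j F
  proof -
    have "(\<Sum>i\<in>{1..k}. of_bool (w j = i) * F i) = (\<Sum>i\<in>{1..k}. if i = w j then F i else 0)"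
      by (intro sum.cong) auto
    also have "\<dots> = F (w j)" using w[OF that] by (subst sum.delta) auto
    finally show ?thesis .
  qed
  have "(\<Sum>i\<in>{1..k}. real (card {j \<in> {1..n}. w j = i})) = (\<Sum>j\<in>{1..n}. \<Sum>i\<in>{1..k}. of_bool (w j = i) * 1)"
    unfolding c by (subst sum.swap) simp
  also have "\<dots> = (\<Sum>j\<in>{1..n}. 1)" by (intro sum.cong refl one)
  finally show "(\<Sum>i\<in>{1..k}. real (card {j \<in> {1..n}. w j = i})) = n" by simp
  have "(\<Sum>i\<in>{1..k}. (real (card {j \<in> {1..n}. w j = i}))\<^sup>2)
     = (\<Sum>i\<in>{1..k}. \<Sum>b\<in>{1..n}. of_bool (w b = i) * (\<Sum>a\<in>{1..n}. of_bool (w a = i)))"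
    unfolding c power2_eq_square sum_distrib_right ..
  also have "\<dots> = (\<Sum>b\<in>{1..n}. \<Sum>i\<in>{1..k}. of_bool (w b = i) * (\<Sum>a\<in>{1..n}. of_bool (w a = i)))"
    by (rule sum.swap)
  also have "\<dots> = (\<Sum>b\<in>{1..n}. \<Sum>a\<in>{1..n}. of_bool (w a = w b))"
    by (intro sum.cong refl one)
  also have "\<dots> = n + 2 * ustat (\<lambda>x y. of_bool (x = y)) n w"
    by (subst double_sum_ustat) auto
  finally show "(\<Sum>i\<in>{1..k}. (real (card {j \<in> {1..n}. w j = i}))\<^sup>2) = n + 2 * ustat (\<lambda>x y. of_bool (x = y)) n w" .
qed

lemma cell_frequency_eq:
  assumes k: "k > 0" and i: "i \<ge> 1"
  shows "cell_frequency n k X i = real (card {j \<in> {1..n}. cell k (X j) = i}) / n"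
proof -
  let ?A = "{j \<in> {1..n}. X j \<le> real i / real k}" and ?B = "{j \<in> {1..n}. X j \<le> (real i - 1) / real k}"
  have "(real i - 1) / real k \<le> real i / real k" by (intro divide_right_mono) auto
  then have "?B \<subseteq> ?A" by auto
  then have "real (card ?A) - real (card ?B) = real (card (?A - ?B))"
    by (subst card_Diff_subset) (auto intro!: of_nat_diff[symmetric] card_mono)
  also have "?A - ?B = {j \<in> {1..n}. X j \<in> cell_set k i}" by (auto simp: cell_set_def)
  also have "\<dots> = {j \<in> {1..n}. cell k (X j) = i}" using mem_cell_set[OF k i] by simp
  finally show ?thesis by (simp add: cell_frequency_def empirical_cdf_def flip: diff_divide_distrib)
qed

text \<open>After expanding the squares, the linear and constant terms are deterministic because the
  counts add up to \<open>n\<close>, and the quadratic ones count coincidences. Subtracting 1 for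
  every pair turns these into \<open>cell_kernel\<close>.\<close>

lemma chi2_stat_eq_nstat:
  assumes n: "n > 0" and k: "k > 0" and w: "\<And>j. j \<in> {1..n} \<Longrightarrow> w j = cell k (X j)"
    and r: "\<And>j. j \<in> {1..n} \<Longrightarrow> w j \<in> {1..k}"
  shows "chi2_stat n k X = real k - 1 + sqrt 2 * sqrt k * nstat k n w"
proof -
  define c where "c i = real (card {j \<in> {1..n}. w j = i})" for i
  have fr: "cell_frequency n k X i = c i / n" if "i \<in> {1..k}" for i
  proof -
    have "{j \<in> {1..n}. cell k (X j) = i} = {j \<in> {1..n}. w j = i}" using w by auto
    then show ?thesis using cell_frequency_eq[OF k, of i n X] that by (simp add: c_def)
  qed
  define C where "C = ustat (\<lambda>x y. of_bool (x = y)) n w"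
  have "(\<Sum>i=1..k. (cell_frequency n k X i - 1 / real k)\<^sup>2) = (\<Sum>i=1..k. (c i / n - 1 / k)\<^sup>2)"
    by (intro sum.cong refl) (simp add: fr)
  also have "\<dots> = (\<Sum>i=1..k. (c i)\<^sup>2 / (real n)\<^sup>2 - 2 / (real n * real k) * c i + 1 / (real k)\<^sup>2)"
    by (intro sum.cong refl) (simp add: power2_diff power_divide)
  also have "\<dots> = (real n + 2 * C) / (real n)\<^sup>2 - 2 / (real n * real k) * n + k * (1 / (real k)\<^sup>2)"
    using sum_card_squares[of n w k, OF r] unfolding c_def C_def
    by (simp add: sum.distrib sum_subtractf flip: sum_divide_distrib sum_distrib_left)
  finally have "chi2_stat n k X = real k * real n * ((real n + 2 * C) / (real n)\<^sup>2 - 2 / (real n * real k) * n + k * (1 / (real k)\<^sup>2))"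
    by (simp add: chi2_stat_def)
  also have "\<dots> = real k - 1 + 2 / n * (real k * C - real n * (real n - 1) / 2)"
    using n k by (simp add: field_simps power2_eq_square)
  also have "real k * C - real n * (real n - 1) / 2 = ustat (cell_kernel k) n w"
    using ustat_add_separable[of "\<lambda>x y. real k * of_bool (x = y) + 0 * of_bool (x = y)" "\<lambda>_. 0" "-1" n w]
      ustat_linear[of "real k" "\<lambda>x y. of_bool (x = y)" 0 "\<lambda>x y. of_bool (x = y)" n w]
    by (simp add: cell_kernel_def[abs_def] C_def psum_def)
  also have "2 / n * \<dots> = sqrt 2 * sqrt k * nstat k n w"
    using k n by (simp add: nstat_def)
  finally show ?thesis .
qed

section \<open>Cell probabilities of a density and the law of the statistic\<close>

locale density_model =
  fixes g :: "real \<Rightarrow> real"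
  assumes meas [measurable]: "g \<in> borel_measurable borel" and dens: "perturbs_to_density g"
begin

lemma space_obs [simp]: "space (obs_law g) = UNIV" and sets_obs [simp, measurable_cong]: "sets (obs_law g) = sets borel"
  by (simp_all add: obs_law_def)

text \<open>A non-integrable function has integral 0 by default, which contradicts the value 1 in
  \<open>perturbs_to_density\<close>.\<close>

lemma integrable_1g: "set_integrable lborel {0<..<1} (\<lambda>x. 1 + g x)"
proof (rule ccontr)
  assume "\<not> ?thesis"
  then have "(LINT x:{0<..<1}|lborel. 1 + g x) = 0"
    unfolding set_integrable_def set_lebesgue_integral_def by (rule not_integrable_integral_eq)
  with dens show False by (simp add: perturbs_to_density_def)
qed

lemma set_integrable_g: "set_integrable lborel {0<..<1} g"
proof -
  have "set_integrable lborel {0<..<1} (\<lambda>x. (1 + g x) - 1)"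
    by (intro set_integral_diff integrable_1g) (auto simp: set_integrable_def)
  then show ?thesis by simp
qed

lemma LINT_nonneg:
  assumes A: "A \<subseteq> {0<..<1}"
  shows "0 \<le> (LINT x:A|lborel. 1 + g x)"
  unfolding set_lebesgue_integral_def
proof (rule integral_nonneg_AE)
  have "AE x in lborel. x \<in> {0<..<1} \<longrightarrow> 0 \<le> 1 + g x" using dens by (simp add: perturbs_to_density_def)
  then show "AE x in lborel. 0 \<le> indicat_real A x *\<^sub>R (1 + g x)"
    by eventually_elim (use A in \<open>auto simp: indicator_def\<close>)
qed

lemma emeasure_obs:
  assumes [measurable]: "A \<in> sets borel" and A: "A \<subseteq> {0<..<1}"
  shows "emeasure (obs_law g) A = ennreal (LINT x:A|lborel. 1 + g x)"
proof -
  have int: "set_integrable lborel A (\<lambda>x. 1 + g x)"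
    by (rule set_integrable_subset[OF integrable_1g]) (use A in auto)
  have "emeasure (obs_law g) A = (\<integral>\<^sup>+x. ennreal (1 + g x) * indicator {0<..<1} x * indicator A x \<partial>lborel)"
    unfolding obs_law_def by (rule emeasure_density) auto
  also have "\<dots> = (\<integral>\<^sup>+x. ennreal (indicator A x *\<^sub>R (1 + g x)) \<partial>lborel)"
    using A by (intro nn_integral_cong) (auto simp: indicator_def)
  also have "\<dots> = ennreal (LINT x:A|lborel. 1 + g x)"
    unfolding set_lebesgue_integral_def
  proof (rule nn_integral_eq_integral)
    show "integrable lborel (\<lambda>x. indicat_real A x *\<^sub>R (1 + g x))" using int by (simp add: set_integrable_def)
    have "AE x in lborel. x \<in> {0<..<1} \<longrightarrow> 0 \<le> 1 + g x" using dens by (simp add: perturbs_to_density_def)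
    then show "AE x in lborel. 0 \<le> indicat_real A x *\<^sub>R (1 + g x)"
      by eventually_elim (use A in \<open>auto simp: indicator_def\<close>)
  qed
  finally show ?thesis .
qed

lemma emeasure_obs_0:
  assumes [measurable]: "A \<in> sets borel" and A: "A \<inter> {0<..<1} = {}"
  shows "emeasure (obs_law g) A = 0"
proof -
  have "emeasure (obs_law g) A = (\<integral>\<^sup>+x. ennreal (1 + g x) * indicator {0<..<1} x * indicator A x \<partial>lborel)"
    unfolding obs_law_def by (rule emeasure_density) auto
  also have "\<dots> = (\<integral>\<^sup>+x. 0 \<partial>(lborel :: real measure))"
    using A by (intro nn_integral_cong) (auto simp: indicator_def)
  finally show ?thesis by simp
qed

lemma AE_obs: "AE x in obs_law g. 0 < x \<and> x < 1"
proof (rule AE_I')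
  show "- {0<..<1} \<in> null_sets (obs_law g)" using emeasure_obs_0[of "- {0<..<1}"] by auto
qed auto

sublocale obs: prob_space "obs_law g"
proof
  have "emeasure (obs_law g) UNIV = emeasure (obs_law g) {0<..<1}"
    using AE_obs by (intro emeasure_eq_AE) auto
  also have "\<dots> = 1" using dens by (simp add: emeasure_obs perturbs_to_density_def)
  finally show "emeasure (obs_law g) (space (obs_law g)) = 1" by simp
qed

definition cell_prob :: "nat \<Rightarrow> nat \<Rightarrow> real" where
  "cell_prob k l = measure (obs_law g) (cell_set k l)"

lemma cell_prob_eq:
  assumes k: "k > 0" and l: "l \<in> {1..k}"
  shows "cell_prob k l - 1 / k = (LINT x:{(real l - 1) / k<..<real l / k}|lborel. g x)"
proof -
  let ?I = "{(real l - 1) / k<..<real l / k}"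
  have I: "?I \<subseteq> {0<..<1}"
  proof
    fix x assume "x \<in> ?I"
    moreover have "0 \<le> (real l - 1) / k" "real l / k \<le> 1" using l k by (auto simp: field_simps)
    ultimately show "x \<in> {0<..<1}" by auto
  qed
  have pt: "emeasure (obs_law g) {real l / k} = 0"
    unfolding obs_law_def by (subst emeasure_density) (auto intro!: nn_integral_null_set)
  have "cell_set k l = ?I \<union> {real l / k}" using k by (auto simp: cell_set_def divide_strict_right_mono)
  then have "emeasure (obs_law g) (cell_set k l) = emeasure (obs_law g) (?I \<union> {real l / k})" by simp
  also have "\<dots> = emeasure (obs_law g) ?I"
    by (rule emeasure_Un_null_set) (auto simp: null_sets_def pt)
  also have "\<dots> = ennreal (LINT x:?I|lborel. 1 + g x)" by (rule emeasure_obs) (use I in auto)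
  finally have "cell_prob k l = (LINT x:?I|lborel. 1 + g x)"
    unfolding cell_prob_def by (simp add: obs.emeasure_eq_measure LINT_nonneg[OF I])
  also have "(LINT x:?I|lborel. 1 + g x) = (LINT x:?I|lborel. 1) + (LINT x:?I|lborel. g x)"
    using I by (intro set_integral_add(2) set_integrable_subset[OF set_integrable_g]
        set_integrable_subset[of lborel "{0<..<1}" "\<lambda>_. 1" ?I]) (auto simp: set_integrable_def)
  also have "(LINT x:?I|lborel. 1) = 1 / k"
    using k by (simp add: set_lebesgue_integral_def measure_def field_simps)
  finally show ?thesis by simp
qed

lemma cell_prob_sum:
  assumes k: "k > 0"
  shows "(\<Sum>l\<in>{1..k}. cell_prob k l) = 1"
proof -
  have "(\<Sum>l\<in>{1..k}. cell_prob k l) = measure (obs_law g) (\<Union>l\<in>{1..k}. cell_set k l)"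
    unfolding cell_prob_def
  proof (intro obs.finite_measure_finite_Union[symmetric])
    show "disjoint_family_on (cell_set k) {1..k}"
      using mem_cell_set[OF k] by (fastforce simp: disjoint_family_on_def)
  qed (auto simp: cell_set_def)
  also have "\<dots> = measure (obs_law g) UNIV"
  proof (rule measure_eq_AE)
    show "AE x in obs_law g. x \<in> (\<Union>l\<in>{1..k}. cell_set k l) \<longleftrightarrow> x \<in> UNIV"
      using AE_obs
    proof eventually_elim
      case (elim x)
      then show ?case using cell_range[OF k, of x] mem_cell_set[OF k, of "cell k x" x] by auto
    qed
  qed (auto simp: cell_set_def)
  also have "\<dots> = 1" using obs.prob_space by simp
  finally show ?thesis .
qed

definition cell_pmf :: "nat \<Rightarrow> nat pmf" where
  "cell_pmf k = embed_pmf (\<lambda>l. if l \<in> {1..k} then cell_prob k l else 0)"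

lemma pmf_cell_pmf:
  assumes k: "k > 0"
  shows "pmf (cell_pmf k) l = (if l \<in> {1..k} then cell_prob k l else 0)"
  unfolding cell_pmf_def
proof (rule pmf_embed_pmf)
  have "(\<integral>\<^sup>+x. ennreal (if x \<in> {1..k} then cell_prob k x else 0) \<partial>count_space UNIV)
    = (\<Sum>x\<in>{1..k}. ennreal (if x \<in> {1..k} then cell_prob k x else 0))"
    by (intro nn_integral_count_space'[where A = "{1..k}"]) auto
  also have "\<dots> = ennreal (\<Sum>x\<in>{1..k}. cell_prob k x)"
    by (subst sum_ennreal) (auto simp: cell_prob_def intro!: sum.cong)
  finally show "(\<integral>\<^sup>+x. ennreal (if x \<in> {1..k} then cell_prob k x else 0) \<partial>count_space UNIV) = 1"
    using cell_prob_sum[OF k] by simp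
qed (auto simp: cell_prob_def)

lemma set_cell_pmf: "k > 0 \<Longrightarrow> set_pmf (cell_pmf k) \<subseteq> {1..k}"
  by (auto simp: set_pmf_eq pmf_cell_pmf split: if_splits)

lemma sq_dev_cell_pmf:
  assumes k: "k > 0"
  shows "sq_dev k (cell_pmf k) = (\<Sum>l\<in>{1..k}. (LINT x:{(real l - 1) / k<..<real l / k}|lborel. g x)\<^sup>2)"
  unfolding sq_dev_def using k
  by (intro sum.cong refl) (simp add: pmf_cell_pmf cell_prob_eq del: atLeastAtMost_iff)

lemma sets_sample: "sets (sample_law n g) = sets (\<Pi>\<^sub>M j\<in>{1..n}. (borel :: real measure))"
  unfolding sample_law_def by (intro sets_PiM_cong) auto

lemma chi2_measurable: "(\<lambda>X. chi2_stat n k X) \<in> borel_measurable (sample_law n g)"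
proof -
  have "(\<lambda>X. empirical_cdf n X x) \<in> borel_measurable (sample_law n g)" for x
  proof -
    have "real (card {j \<in> {1..n}. X j \<le> x}) = (\<Sum>j\<in>{1..n}. indicator {..x} (X j))" for X :: "nat \<Rightarrow> real"
      by (simp add: indicator_def of_bool_def sum.If_cases Int_def)
    moreover have "(\<lambda>X. \<Sum>j\<in>{1..n}. indicator {..x} (X j) :: real) \<in> borel_measurable (sample_law n g)"
      unfolding measurable_cong_sets[OF sets_sample refl] by measurable
    ultimately show ?thesis unfolding empirical_cdf_def by simp
  qed
  note [measurable] = this
  show ?thesis unfolding chi2_stat_def cell_frequency_def by measurable
qed

text \<open>Almost every sample lies in exactly one product of cells, and there the statistic
  depends only on the vector of cell numbers. Up to a null set the rejection event is therefore a
  finite disjoint union of boxes, each with a product of cell probabilities as its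
  probability.\<close>

lemma law_link:
  assumes n: "n > 0" and k: "k > 0"
  shows "measure (sample_law n g) {X \<in> space (sample_law n g). t < chi2_stat n k X}
    = rej_prob n k (cell_pmf k) ((t - (real k - 1)) / (sqrt 2 * sqrt k))"
proof -
  let ?t = "(t - (real k - 1)) / (sqrt 2 * sqrt k)"
  let ?M = "sample_law n g"
  \<comment> \<open>Being \<open>undefined\<close> off \<open>{1..n}\<close>, a cell vector is
    determined by its values on the indices of the observations.\<close>
  define D where "D = PiE_dflt {1..n} undefined (\<lambda>_. {1..k})"
  define B where "B = {w \<in> D. ?t < nstat k n w}"
  define R where "R w = PiE {1..n} (\<lambda>a. cell_set k (w a))" for w
  have finD: "finite D" unfolding D_def by auto
  have finB: "finite B" using finD by (simp add: B_def)
  interpret PM: finite_product_prob_space "\<lambda>_. obs_law g" "{1..n}"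
    by unfold_locales auto
  have sR: "R w \<in> sets ?M" for w
    unfolding R_def sample_law_def by (intro sets_PiM_I_finite) (auto simp: cell_set_def)
  have "measure ?M {X \<in> space ?M. t < chi2_stat n k X} = measure ?M (\<Union>w\<in>B. R w)"
  proof (rule measure_eq_AE)
    have "AE X in ?M. \<forall>j\<in>{1..n}. 0 < X j \<and> X j < 1"
      unfolding sample_law_def
      by (intro AE_finite_allI AE_PiM_component AE_obs obs.prob_space_axioms) auto
    then show "AE X in ?M. X \<in> {X \<in> space ?M. t < chi2_stat n k X} \<longleftrightarrow> X \<in> (\<Union>w\<in>B. R w)"
      using AE_space
    proof eventually_elim
      case (elim X)
      define w where "w = (\<lambda>a. if a \<in> {1..n} then cell k (X a) else undefined)"
      have wr: "w j \<in> {1..k}" if "j \<in> {1..n}" for j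
        using cell_range[OF k, of "X j"] elim(1) that by (simp add: w_def)
      have wD: "w \<in> D" using wr by (auto simp: D_def PiE_dflt_def w_def)
      have ext: "X \<in> extensional {1..n}" using elim(2) by (auto simp: sample_law_def space_PiM PiE_def)
      have mem: "X \<in> R v \<longleftrightarrow> v = w" if v: "v \<in> D" for v
      proof
        assume X: "X \<in> R v"
        show "v = w"
        proof
          fix a show "v a = w a"
          proof (cases "a \<in> {1..n}")
            case True
            then have "X a \<in> cell_set k (v a)" "v a \<ge> 1" using X v by (auto simp: R_def D_def PiE_dflt_def)
            then show ?thesis using True mem_cell_set[OF k, of "v a" "X a"] by (simp add: w_def)
          next
            case False
            then show ?thesis using v by (auto simp: D_def PiE_dflt_def w_def)
          qed
        qed
      next
        assume "v = w"
        moreover have "X a \<in> cell_set k (w a)" if "a \<in> {1..n}" for a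
          using wr[OF that] that mem_cell_set[OF k, of "w a" "X a"] by (simp add: w_def)
        ultimately show "X \<in> R v" using ext by (auto simp: R_def PiE_def)
      qed
      have chi: "chi2_stat n k X = real k - 1 + sqrt 2 * sqrt k * nstat k n w"
        by (rule chi2_stat_eq_nstat[OF n k _ wr]) (auto simp: w_def)
      have "t < chi2_stat n k X \<longleftrightarrow> ?t < nstat k n w"
        unfolding chi using k by (simp add: field_simps)
      then show ?case using mem wD elim(2) by (auto simp: B_def)
    qed
    show "{X \<in> space ?M. t < chi2_stat n k X} \<in> sets ?M"
      using chi2_measurable by measurable
    show "(\<Union>w\<in>B. R w) \<in> sets ?M" using finB sR by auto
  qed
  also have "\<dots> = (\<Sum>w\<in>B. measure ?M (R w))"
  proof -
    have "disjoint_family_on R B"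
      unfolding disjoint_family_on_def
    proof (intro ballI impI)
      fix v w assume vw: "v \<in> B" "w \<in> B" "v \<noteq> w"
      show "R v \<inter> R w = {}"
      proof (rule ccontr)
        assume "R v \<inter> R w \<noteq> {}"
        then obtain X where X: "X \<in> R v" "X \<in> R w" by auto
        have "v a = w a" for a
        proof (cases "a \<in> {1..n}")
          case True
          then have "X a \<in> cell_set k (v a)" "X a \<in> cell_set k (w a)" "v a \<ge> 1" "w a \<ge> 1"
            using X vw by (auto simp: R_def B_def D_def PiE_dflt_def)
          then show ?thesis using mem_cell_set[OF k] by metis
        next
          case False
          then show ?thesis using vw by (auto simp: B_def D_def PiE_dflt_def)
        qed
        then show False using vw by auto
      qed
    qed
    then show ?thesis
      unfolding sample_law_def
      by (intro PM.finite_measure_finite_Union finB) (use sR in \<open>auto simp: sample_law_def\<close>)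
  qed
  also have "\<dots> = (\<Sum>w\<in>B. pmf (iid_pmf n (cell_pmf k)) w)"
  proof (intro sum.cong refl)
    fix w assume "w \<in> B"
    then have w: "\<And>a. a \<in> {1..n} \<Longrightarrow> w a \<in> {1..k}" "\<And>a. a \<notin> {1..n} \<Longrightarrow> w a = undefined"
      by (auto simp: B_def D_def PiE_dflt_def)
    have "measure ?M (R w) = (\<Prod>a\<in>{1..n}. measure (obs_law g) (cell_set k (w a)))"
      unfolding R_def sample_law_def by (rule PM.prob_times) (auto simp: cell_set_def)
    also have "\<dots> = (\<Prod>a\<in>{1..n}. pmf (cell_pmf k) (w a))"
      by (intro prod.cong refl) (use w(1) in \<open>simp add: pmf_cell_pmf[OF k] cell_prob_def del: atLeastAtMost_iff\<close>)
    also have "\<dots> = pmf (iid_pmf n (cell_pmf k)) w"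
      unfolding iid_pmf_def using w(2) by (intro pmf_Pi'[symmetric]) auto
    finally show "measure ?M (R w) = pmf (iid_pmf n (cell_pmf k)) w" .
  qed
  also have "\<dots> = measure_pmf.prob (iid_pmf n (cell_pmf k)) B"
    by (rule measure_measure_pmf_finite[OF finB, symmetric])
  also have "\<dots> = rej_prob n k (cell_pmf k) ?t"
    unfolding rej_prob_def
  proof (rule measure_eq_AE)
    have "set_pmf (iid_pmf n (cell_pmf k)) \<subseteq> D"
      unfolding iid_pmf_def D_def using set_cell_pmf[OF k]
      by (subst set_Pi_pmf) (auto simp: PiE_dflt_def)
    then show "AE w in measure_pmf (iid_pmf n (cell_pmf k)). (w \<in> B) = (w \<in> {w. ?t < nstat k n w})"
      by (auto simp: AE_measure_pmf_iff B_def)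
  qed auto
  finally show ?thesis .
qed

lemma compl_link:
  shows "measure (sample_law n g) {X \<in> space (sample_law n g). X \<notin> {X. t < chi2_stat n k X}}
    = 1 - measure (sample_law n g) {X \<in> space (sample_law n g). t < chi2_stat n k X}"
proof -
  interpret PM: finite_product_prob_space "\<lambda>_. obs_law g" "{1..n}"
    by unfold_locales auto
  have "{X \<in> space (sample_law n g). t < chi2_stat n k X} \<in> sets (sample_law n g)"
    using chi2_measurable by measurable
  from PM.prob_compl[OF this[unfolded sample_law_def]]
  have "measure (sample_law n g) (space (sample_law n g) - {X \<in> space (sample_law n g). t < chi2_stat n k X})
    = 1 - measure (sample_law n g) {X \<in> space (sample_law n g). t < chi2_stat n k X}"
    unfolding sample_law_def .
  moreover have "space (sample_law n g) - {X \<in> space (sample_law n g). t < chi2_stat n k X}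
    = {X \<in> space (sample_law n g). X \<notin> {X. t < chi2_stat n k X}}" by auto
  ultimately show ?thesis by simp
qed

end

section \<open>Trigonometric approximation in the mean\<close>

lemma trig_add: "trig (i + j) x = trig i x * trig j x"
  by (simp add: trig_def distrib_left distrib_right flip: exp_add)

lemma trig_0 [simp]: "trig 0 x = 1"
  by (simp add: trig_def)

lemma norm_trig [simp]: "cmod (trig j x) = 1"
proof -
  have "trig j x = iexp (2 * pi * of_int j * x)" by (simp add: trig_def mult_ac)
  then show ?thesis by (simp only: norm_exp_i_times)
qed

lemma cnj_trig: "cnj (trig j x) = trig (- j) x"
  by (simp add: trig_def exp_cnj)

lemma trig_cnj_mult: "trig i x * cnj (trig j x) = trig (i - j) x"
  by (simp add: cnj_trig flip: trig_add)

lemma continuous_trig: "continuous_on A (trig j)"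
  unfolding trig_def by (intro continuous_intros)

lemma measurable_trig [measurable]: "trig j \<in> borel_measurable borel"
  by (intro borel_measurable_continuous_onI continuous_trig)

lemma trig_derivative:
  "(trig j has_vector_derivative (2 * of_real pi * \<i> * of_int j) * trig j x) (at x within A)"
proof -
  have "((\<lambda>z. exp (2 * of_real pi * \<i> * of_int j * z)) has_field_derivative
      (2 * of_real pi * \<i> * of_int j) * exp (2 * of_real pi * \<i> * of_int j * of_real x)) (at (of_real x))"
    by (auto intro!: derivative_eq_intros)
  from has_vector_derivative_real_field[OF this] show ?thesis
    by (simp add: trig_def[abs_def] o_def has_vector_derivative_at_within)
qed

lemma trig_int [simp]: "trig j (of_int m) = 1" "trig j 1 = 1" "trig j 0 = 1"
proof -
  show *: "trig j (of_int m) = 1" for m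
    using exp_integer_2pi[of "of_int (j * m)"] by (simp add: trig_def mult_ac)
  show "trig j 1 = 1" using *[of 1] by simp
  show "trig j 0 = 1" using *[of 0] by simp
qed

text \<open>A probability measure in place of set integrals: bounded measurable functions become
  integrable and Fubini's theorem applies directly.\<close>

definition unit_law :: "real measure" where
  "unit_law = restrict_space lborel {0<..<1}"

lemma space_unit_law [simp]: "space unit_law = {0<..<1}"
  by (simp add: unit_law_def space_restrict_space)

interpretation unit_law: prob_space unit_law
  by (auto simp: unit_law_def space_restrict_space emeasure_restrict_space intro!: prob_spaceI)

lemma measurable_unit_law: "f \<in> borel_measurable borel \<Longrightarrow> f \<in> borel_measurable unit_law"
  unfolding unit_law_def by (intro measurable_restrict_space1) simp

lemma integral_unit_law:
  fixes f :: "real \<Rightarrow> 'b::{banach, second_countable_topology}"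
  shows "integral\<^sup>L unit_law f = (LINT x:{0<..<1}|lborel. f x)"
  unfolding unit_law_def set_lebesgue_integral_def by (rule integral_restrict_space) simp

lemma integrable_unit_law:
  fixes f :: "real \<Rightarrow> 'b::{banach, second_countable_topology}"
  shows "integrable unit_law f \<longleftrightarrow> set_integrable lborel {0<..<1} f"
  unfolding unit_law_def set_integrable_def by (rule integrable_restrict_space) simp

lemma AE_Icc_Ioo: "AE x in lborel. indicator {a..b::real} x = (indicator {a<..<b} x :: real)"
proof -
  have "AE x in lborel. x \<noteq> a" "AE x in lborel. x \<noteq> b" by (rule AE_lborel_singleton)+
  then show ?thesis by eventually_elim (auto simp: indicator_def)
qed

lemma LINT_Ioo_eq_Icc:
  fixes f :: "real \<Rightarrow> 'b::{banach, second_countable_topology}"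
  assumes [measurable]: "f \<in> borel_measurable borel"
  shows "(LINT x:{a<..<b}|lborel. f x) = (LINT x:{a..b}|lborel. f x)"
  unfolding set_lebesgue_integral_def
  by (rule integral_cong_AE) (use AE_Icc_Ioo[of a b] in auto)

lemma trig_interval_integral:
  assumes "a \<le> b" "j \<noteq> 0"
  shows "(LINT x:{a<..<b}|lborel. trig j x) = (trig j b - trig j a) / (2 * of_real pi * \<i> * of_int j)"
proof -
  let ?c = "2 * of_real pi * \<i> * of_int j :: complex"
  have c: "?c \<noteq> 0" using assms(2) by simp
  have "(LINT x:{a<..<b}|lborel. trig j x) = (LINT x:{a..b}|lborel. trig j x)"
    by (rule LINT_Ioo_eq_Icc) simp
  also have "\<dots> = trig j b / ?c - trig j a / ?c"
    unfolding set_lebesgue_integral_def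
  proof (rule integral_FTC_atLeastAtMost[OF assms(1)])
    fix x
    show "((\<lambda>x. trig j x / ?c) has_vector_derivative trig j x) (at x within {a..b})"
      using has_vector_derivative_divide[OF trig_derivative[of j x "{a..b}"], of ?c] c by simp
  qed (rule continuous_trig)
  finally show ?thesis by (simp add: diff_divide_distrib)
qed

lemma trig_orthonormal: "integral\<^sup>L unit_law (\<lambda>x. trig i x * cnj (trig j x)) = of_bool (i = j)"
proof (cases "i = j")
  case True
  then show ?thesis using unit_law.prob_space by (simp add: trig_cnj_mult)
next
  case False
  then have "integral\<^sup>L unit_law (trig (i - j)) = 0"
    unfolding integral_unit_law by (subst trig_interval_integral) auto
  then show ?thesis using False by (simp add: trig_cnj_mult)
qed

section \<open>Trigonometric polynomials\<close>

inductive trig_poly :: "(real \<Rightarrow> complex) \<Rightarrow> bool" where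
  monomial: "trig_poly (\<lambda>x. c * trig j x)"
| add: "trig_poly p \<Longrightarrow> trig_poly q \<Longrightarrow> trig_poly (\<lambda>x. p x + q x)"

lemma trig_poly_cmult: "trig_poly p \<Longrightarrow> trig_poly (\<lambda>x. c * p x)"
proof (induction rule: trig_poly.induct)
  case (monomial d j)
  then show ?case using trig_poly.monomial[of "c * d" j] by (simp add: mult_ac)
next
  case (add p q)
  then show ?case using trig_poly.add by (simp add: distrib_left)
qed

lemma trig_poly_mult_trig: "trig_poly p \<Longrightarrow> trig_poly (\<lambda>x. p x * trig i x)"
proof (induction rule: trig_poly.induct)
  case (monomial d j)
  then show ?case using trig_poly.monomial[of d "j + i"] by (simp add: mult_ac trig_add)
next
  case (add p q)
  then show ?case using trig_poly.add by (simp add: distrib_right)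
qed

lemma trig_poly_mult: "trig_poly p \<Longrightarrow> trig_poly q \<Longrightarrow> trig_poly (\<lambda>x. p x * q x)"
proof (induction p rule: trig_poly.induct)
  case (monomial d j)
  then show ?case using trig_poly_cmult[OF trig_poly_mult_trig[OF monomial], of d j] by (simp add: mult_ac)
next
  case (add p q)
  then show ?case using trig_poly.add by (simp add: distrib_right)
qed

lemma trig_poly_const: "trig_poly (\<lambda>x. c)"
  using trig_poly.monomial[of c 0] by simp

lemma trig_poly_sum_form:
  assumes "trig_poly p"
  obtains J c where "finite J" "p = (\<lambda>x. \<Sum>j\<in>J. c j * trig j x)"
proof -
  have "\<exists>J c. finite J \<and> p = (\<lambda>x. \<Sum>j\<in>J. c j * trig j x)"
    using assms
  proof (induction rule: trig_poly.induct)
    case (monomial c j)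
    show ?case by (intro exI[of _ "{j}"] exI[of _ "\<lambda>_. c"]) simp
  next
    case (add p q)
    then obtain J K c d where JK: "finite J" "finite K" "p = (\<lambda>x. \<Sum>j\<in>J. c j * trig j x)" "q = (\<lambda>x. \<Sum>j\<in>K. d j * trig j x)"
      by blast
    have "p x + q x = (\<Sum>j\<in>J \<union> K. ((if j \<in> J then c j else 0) + (if j \<in> K then d j else 0)) * trig j x)" for x
    proof -
      have "(\<Sum>j\<in>J. c j * trig j x) = (\<Sum>j\<in>J \<union> K. (if j \<in> J then c j else 0) * trig j x)"
        using JK by (intro sum.mono_neutral_cong_left) auto
      moreover have "(\<Sum>j\<in>K. d j * trig j x) = (\<Sum>j\<in>J \<union> K. (if j \<in> K then d j else 0) * trig j x)"
        using JK by (intro sum.mono_neutral_cong_left) auto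
      ultimately show ?thesis by (simp add: JK distrib_right sum.distrib)
    qed
    then show ?case using JK(1,2) by (intro exI[of _ "J \<union> K"] exI conjI) auto
  qed
  then show ?thesis using that by blast
qed

lemma trig_poly_continuous: "trig_poly p \<Longrightarrow> continuous_on A p"
  by (induction rule: trig_poly.induct) (intro continuous_intros continuous_trig | assumption)+

lemma trig_poly_bounded: "trig_poly p \<Longrightarrow> \<exists>B. \<forall>x. cmod (p x) \<le> B"
proof (induction rule: trig_poly.induct)
  case (monomial c j)
  then show ?case by (auto simp: norm_mult)
next
  case (add p q)
  then obtain B C where "\<forall>x. cmod (p x) \<le> B" "\<forall>x. cmod (q x) \<le> C" by blast
  then have "cmod (p x + q x) \<le> B + C" for x by (intro norm_triangle_mono) auto
  then show ?case by blast
qed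

lemma trig_poly_measurable: "trig_poly p \<Longrightarrow> p \<in> borel_measurable borel"
  by (intro borel_measurable_continuous_onI trig_poly_continuous)

text \<open>On the unit circle conjugation turns \<open>trig 1\<close> into
  \<open>trig (- 1)\<close>, so real and imaginary parts, and with them all real polynomials, become
  trigonometric polynomials.\<close>

lemma real_polynomial_on_circle:
  "real_polynomial_function g \<Longrightarrow> trig_poly (\<lambda>x. complex_of_real (g (trig 1 x)))"
proof (induction rule: real_polynomial_function.induct)
  case (linear L)
  interpret bounded_linear L by fact
  have "complex_of_real (L (trig 1 x)) = ((L 1 - \<i> * L \<i>) / 2) * trig 1 x + ((L 1 + \<i> * L \<i>) / 2) * trig (- 1) x" for x
  proof -
    define z where "z = trig 1 x"
    have "z = Re z *\<^sub>R 1 + Im z *\<^sub>R \<i>" by (simp add: complex_eq_iff)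
    then have "L z = L (Re z *\<^sub>R 1 + Im z *\<^sub>R \<i>)" by (rule arg_cong)
    also have "\<dots> = Re z * L 1 + Im z * L \<i>" by (simp only: add scaleR real_scaleR_def)
    finally have "L z = Re z * L 1 + Im z * L \<i>" .
    then have "complex_of_real (L z) = ((L 1 - \<i> * L \<i>) / 2) * z + ((L 1 + \<i> * L \<i>) / 2) * cnj z"
      by (simp add: complex_eq_iff field_simps)
    then show ?thesis by (simp add: z_def cnj_trig)
  qed
  then show ?case by (simp only: trig_poly.intros)
next
  case (const c)
  show ?case by (rule trig_poly_const)
next
  case (add f g)
  then show ?case using trig_poly.add by simp
next
  case (mult f g)
  then show ?case using trig_poly_mult by simp
qed

section \<open>Square integrable functions and their distance to trigonometric polynomials\<close>

definition sq_int :: "(real \<Rightarrow> real) \<Rightarrow> bool" where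
  "sq_int f \<longleftrightarrow> f \<in> borel_measurable unit_law \<and> integrable unit_law (\<lambda>x. (f x)\<^sup>2)"

lemma sq_int_bounded:
  assumes "f \<in> borel_measurable unit_law" "\<And>x. x \<in> {0<..<1} \<Longrightarrow> \<bar>f x\<bar> \<le> B"
  shows "sq_int f"
  unfolding sq_int_def
proof
  show "integrable unit_law (\<lambda>x. (f x)\<^sup>2)"
  proof (rule unit_law.integrable_const_bound)
    show "AE x in unit_law. norm ((f x)\<^sup>2) \<le> B\<^sup>2"
      using assms(2) by (intro AE_I2) (auto simp: abs_le_square_iff[symmetric] intro: order_trans[OF _ abs_ge_self])
  qed (use assms(1) in measurable)
qed (fact assms(1))

lemma power2_add_le: "(a + b)\<^sup>2 \<le> 2 * a\<^sup>2 + 2 * (b\<^sup>2 :: real)"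
  using zero_le_power2[of "a - b"] by (simp add: power2_eq_square algebra_simps)

lemma sq_int_linear:
  assumes f: "sq_int f" and g: "sq_int g"
  shows "sq_int (\<lambda>x. a * f x + b * g x)"
  unfolding sq_int_def
proof
  have [measurable]: "f \<in> borel_measurable unit_law" "g \<in> borel_measurable unit_law"
    using f g by (auto simp: sq_int_def)
  show "(\<lambda>x. a * f x + b * g x) \<in> borel_measurable unit_law" by measurable
  show "integrable unit_law (\<lambda>x. (a * f x + b * g x)\<^sup>2)"
  proof (rule Bochner_Integration.integrable_bound)
    show "integrable unit_law (\<lambda>x. 2 * a\<^sup>2 * (f x)\<^sup>2 + 2 * b\<^sup>2 * (g x)\<^sup>2)"
      using f g by (auto simp: sq_int_def)
    show "AE x in unit_law. norm ((a * f x + b * g x)\<^sup>2) \<le> norm (2 * a\<^sup>2 * (f x)\<^sup>2 + 2 * b\<^sup>2 * (g x)\<^sup>2)"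
    proof (rule AE_I2)
      fix x
      show "norm ((a * f x + b * g x)\<^sup>2) \<le> norm (2 * a\<^sup>2 * (f x)\<^sup>2 + 2 * b\<^sup>2 * (g x)\<^sup>2)"
        using power2_add_le[of "a * f x" "b * g x"] by (simp add: power_mult_distrib mult.assoc)
    qed
  qed measurable
qed

lemma sq_int_product:
  assumes f: "sq_int f" and g: "sq_int g"
  shows "integrable unit_law (\<lambda>x. f x * g x)"
proof (rule Bochner_Integration.integrable_bound)
  have [measurable]: "f \<in> borel_measurable unit_law" "g \<in> borel_measurable unit_law"
    using f g by (auto simp: sq_int_def)
  show "integrable unit_law (\<lambda>x. (f x)\<^sup>2 + (g x)\<^sup>2)"
    using f g by (auto simp: sq_int_def)
  show "AE x in unit_law. norm (f x * g x) \<le> norm ((f x)\<^sup>2 + (g x)\<^sup>2)"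
  proof (rule AE_I2)
    fix x
    have "2 * (\<bar>f x\<bar> * \<bar>g x\<bar>) \<le> (f x)\<^sup>2 + (g x)\<^sup>2"
      using zero_le_power2[of "\<bar>f x\<bar> - \<bar>g x\<bar>"] by (simp add: power2_diff)
    moreover have "0 \<le> \<bar>f x\<bar> * \<bar>g x\<bar>" by simp
    ultimately have "\<bar>f x\<bar> * \<bar>g x\<bar> \<le> (f x)\<^sup>2 + (g x)\<^sup>2" by linarith
    then show "norm (f x * g x) \<le> norm ((f x)\<^sup>2 + (g x)\<^sup>2)" by (simp add: abs_mult)
  qed
  show "(\<lambda>x. f x * g x) \<in> borel_measurable unit_law" by measurable
qed

lemma sq_int_integrable:
  assumes "sq_int f" shows "integrable unit_law f"
  using sq_int_product[OF assms sq_int_bounded[of "\<lambda>_. 1" 1]] by simp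

definition sq_dist :: "(real \<Rightarrow> real) \<Rightarrow> (real \<Rightarrow> complex) \<Rightarrow> real" where
  "sq_dist f p = (LINT x|unit_law. (cmod (complex_of_real (f x) - p x))\<^sup>2)"

lemma sq_dist_integrable:
  assumes f: "sq_int f" and p: "p \<in> borel_measurable borel" "\<And>x. cmod (p x) \<le> B"
  shows "integrable unit_law (\<lambda>x. (cmod (complex_of_real (f x) - p x))\<^sup>2)"
proof (rule Bochner_Integration.integrable_bound)
  have [measurable]: "f \<in> borel_measurable unit_law" "p \<in> borel_measurable unit_law"
    using f p by (auto simp: sq_int_def intro: measurable_unit_law)
  show "integrable unit_law (\<lambda>x. 2 * (f x)\<^sup>2 + 2 * B\<^sup>2)"
    using f by (auto simp: sq_int_def)
  show "AE x in unit_law. norm ((cmod (complex_of_real (f x) - p x))\<^sup>2) \<le> norm (2 * (f x)\<^sup>2 + 2 * B\<^sup>2)"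
  proof (rule AE_I2)
    fix x
    have "cmod (complex_of_real (f x) - p x) \<le> \<bar>f x\<bar> + B"
      using norm_triangle_ineq4[of "complex_of_real (f x)" "p x"] p(2)[of x] by simp
    then have "(cmod (complex_of_real (f x) - p x))\<^sup>2 \<le> (\<bar>f x\<bar> + B)\<^sup>2" by (intro power_mono) auto
    also have "\<dots> \<le> 2 * (f x)\<^sup>2 + 2 * B\<^sup>2" using power2_add_le[of "\<bar>f x\<bar>" B] by simp
    finally show "norm ((cmod (complex_of_real (f x) - p x))\<^sup>2) \<le> norm (2 * (f x)\<^sup>2 + 2 * B\<^sup>2)" by simp
  qed
  show "(\<lambda>x. (cmod (complex_of_real (f x) - p x))\<^sup>2) \<in> borel_measurable unit_law" by measurable
qed

lemma sq_dist_triangle: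
  assumes f: "sq_int f" and g: "sq_int g" and p: "trig_poly p"
  shows "sq_dist f p \<le> 2 * (LINT x|unit_law. (f x - g x)\<^sup>2) + 2 * sq_dist g p"
proof -
  obtain B where B: "\<And>x. cmod (p x) \<le> B" using trig_poly_bounded[OF p] by blast
  note int = sq_dist_integrable[OF _ trig_poly_measurable[OF p] B]
  have fg: "integrable unit_law (\<lambda>x. (f x - g x)\<^sup>2)"
    using sq_int_linear[OF f g, of 1 "-1"] by (simp add: sq_int_def)
  have "sq_dist f p \<le> (LINT x|unit_law. 2 * (f x - g x)\<^sup>2 + 2 * (cmod (complex_of_real (g x) - p x))\<^sup>2)"
    unfolding sq_dist_def
  proof (intro integral_mono int f)
    fix x
    have "cmod (complex_of_real (f x) - p x) \<le> \<bar>f x - g x\<bar> + cmod (complex_of_real (g x) - p x)"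
      using norm_triangle_ineq[of "complex_of_real (f x - g x)" "complex_of_real (g x) - p x"]
      by (simp del: of_real_diff add: of_real_diff[symmetric]) simp
    then have "(cmod (complex_of_real (f x) - p x))\<^sup>2 \<le> (\<bar>f x - g x\<bar> + cmod (complex_of_real (g x) - p x))\<^sup>2"
      by (intro power_mono) auto
    also have "\<dots> \<le> 2 * (f x - g x)\<^sup>2 + 2 * (cmod (complex_of_real (g x) - p x))\<^sup>2"
      using power2_add_le[of "\<bar>f x - g x\<bar>" "cmod (complex_of_real (g x) - p x)"] by simp
    finally show "(cmod (complex_of_real (f x) - p x))\<^sup>2 \<le> 2 * (f x - g x)\<^sup>2 + 2 * (cmod (complex_of_real (g x) - p x))\<^sup>2" .
  qed (use fg int[OF g] in auto)
  then show ?thesis using fg int[OF g] by (simp add: sq_dist_def)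
qed

text \<open>Membership in the mean square closure of the trigonometric polynomials.\<close>

definition approximable :: "(real \<Rightarrow> real) \<Rightarrow> bool" where
  "approximable f \<longleftrightarrow> (\<forall>e>0. \<exists>p. trig_poly p \<and> sq_dist f p < e)"

lemma approximable_closure:
  assumes f: "sq_int f" and g: "\<And>i. sq_int (g i)" "\<And>i. approximable (g i)"
    and lim: "(\<lambda>i. LINT x|unit_law. (f x - g i x)\<^sup>2) \<longlonglongrightarrow> 0"
  shows "approximable f"
  unfolding approximable_def
proof (intro allI impI)
  fix e :: real assume e: "e > 0"
  have "eventually (\<lambda>i. (LINT x|unit_law. (f x - g i x)\<^sup>2) < e / 4) sequentially"
    by (rule order_tendstoD(2)[OF lim]) (use e in auto)
  then obtain i where i: "(LINT x|unit_law. (f x - g i x)\<^sup>2) < e / 4"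
    using eventually_happens'[OF sequentially_bot] by blast
  obtain p where p: "trig_poly p" "sq_dist (g i) p < e / 4"
    using g(2)[of i] e unfolding approximable_def by (metis divide_pos_pos zero_less_numeral)
  have "sq_dist f p < e" using sq_dist_triangle[OF f g(1) p(1), of i] i p(2) by linarith
  then show "\<exists>p. trig_poly p \<and> sq_dist f p < e" using p(1) by blast
qed

text \<open>The tool for every extension below: a pointwise limit stays in the closure if the error
  has a square integrable majorant.\<close>

lemma approximable_dominated:
  assumes f: "sq_int f" and g: "\<And>i. sq_int (g i)" "\<And>i. approximable (g i)"
    and bd: "sq_int d" "\<And>i x. x \<in> {0<..<1} \<Longrightarrow> \<bar>f x - g i x\<bar> \<le> d x"
    and lim: "\<And>x. x \<in> {0<..<1} \<Longrightarrow> (\<lambda>i. g i x) \<longlonglongrightarrow> f x"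
  shows "approximable f"
proof (rule approximable_closure[OF f g])
  have [measurable]: "f \<in> borel_measurable unit_law" "\<And>i. g i \<in> borel_measurable unit_law"
    using f g by (auto simp: sq_int_def)
  have "(\<lambda>i. LINT x|unit_law. (f x - g i x)\<^sup>2) \<longlonglongrightarrow> (LINT x|unit_law. 0)"
  proof (rule integral_dominated_convergence)
    show "integrable unit_law (\<lambda>x. (d x)\<^sup>2)" using bd by (simp add: sq_int_def)
    show "AE x in unit_law. (\<lambda>i. (f x - g i x)\<^sup>2) \<longlonglongrightarrow> 0"
    proof (intro AE_I2)
      fix x assume "x \<in> space unit_law"
      then have "(\<lambda>i. (f x - g i x)\<^sup>2) \<longlonglongrightarrow> (f x - f x)\<^sup>2"
        using lim by (intro tendsto_intros) auto
      then show "(\<lambda>i. (f x - g i x)\<^sup>2) \<longlonglongrightarrow> 0" by simp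
    qed
    show "AE x in unit_law. norm ((f x - g i x)\<^sup>2) \<le> (d x)\<^sup>2" for i
    proof (intro AE_I2)
      fix x assume "x \<in> space unit_law"
      then have "\<bar>f x - g i x\<bar> \<le> d x" using bd(2) by simp
      then have "\<bar>f x - g i x\<bar>\<^sup>2 \<le> (d x)\<^sup>2" by (intro power_mono) auto
      then show "norm ((f x - g i x)\<^sup>2) \<le> (d x)\<^sup>2" by simp
    qed
  qed measurable
  then show "(\<lambda>i. LINT x|unit_law. (f x - g i x)\<^sup>2) \<longlonglongrightarrow> 0" by simp
qed

lemma approximable_linear:
  assumes f: "sq_int f" "approximable f" and g: "sq_int g" "approximable g"
  shows "approximable (\<lambda>x. a * f x + b * g x)"
  unfolding approximable_def
proof (intro allI impI)
  fix e :: real assume e: "e > 0"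
  define C where "C = 4 * (1 + a\<^sup>2 + b\<^sup>2)"
  have C: "C > 0" by (simp add: C_def add_pos_nonneg)
  obtain p where p: "trig_poly p" "sq_dist f p < e / C"
    using f(2) e C unfolding approximable_def by (metis divide_pos_pos)
  obtain q where q: "trig_poly q" "sq_dist g q < e / C"
    using g(2) e C unfolding approximable_def by (metis divide_pos_pos)
  define r where "r x = of_real a * p x + of_real b * q x" for x
  have r: "trig_poly r" unfolding r_def by (intro trig_poly.add trig_poly_cmult p q)
  obtain B where B: "\<And>x. cmod (p x) \<le> B" using trig_poly_bounded[OF p(1)] by blast
  obtain D where D: "\<And>x. cmod (q x) \<le> D" using trig_poly_bounded[OF q(1)] by blast
  obtain R where R: "\<And>x. cmod (r x) \<le> R" using trig_poly_bounded[OF r] by blast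
  note intf = sq_dist_integrable[OF f(1) trig_poly_measurable[OF p(1)] B]
    and intg = sq_dist_integrable[OF g(1) trig_poly_measurable[OF q(1)] D]
  have "sq_dist (\<lambda>x. a * f x + b * g x) r
    \<le> (LINT x|unit_law. 2 * a\<^sup>2 * (cmod (complex_of_real (f x) - p x))\<^sup>2 + 2 * b\<^sup>2 * (cmod (complex_of_real (g x) - q x))\<^sup>2)"
    unfolding sq_dist_def
  proof (intro integral_mono sq_dist_integrable[OF sq_int_linear[OF f(1) g(1)] trig_poly_measurable[OF r] R])
    fix x
    have "complex_of_real (a * f x + b * g x) - r x = of_real a * (complex_of_real (f x) - p x) + of_real b * (complex_of_real (g x) - q x)"
      by (simp add: r_def algebra_simps)
    then have "cmod (complex_of_real (a * f x + b * g x) - r x)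
      \<le> \<bar>a\<bar> * cmod (complex_of_real (f x) - p x) + \<bar>b\<bar> * cmod (complex_of_real (g x) - q x)"
      using norm_triangle_ineq[of "of_real a * (complex_of_real (f x) - p x)" "of_real b * (complex_of_real (g x) - q x)"]
      by (simp add: norm_mult)
    then have "(cmod (complex_of_real (a * f x + b * g x) - r x))\<^sup>2
      \<le> (\<bar>a\<bar> * cmod (complex_of_real (f x) - p x) + \<bar>b\<bar> * cmod (complex_of_real (g x) - q x))\<^sup>2"
      by (intro power_mono) auto
    also have "\<dots> \<le> 2 * (\<bar>a\<bar> * cmod (complex_of_real (f x) - p x))\<^sup>2 + 2 * (\<bar>b\<bar> * cmod (complex_of_real (g x) - q x))\<^sup>2"
      by (rule power2_add_le)
    finally show "(cmod (complex_of_real (a * f x + b * g x) - r x))\<^sup>2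
      \<le> 2 * a\<^sup>2 * (cmod (complex_of_real (f x) - p x))\<^sup>2 + 2 * b\<^sup>2 * (cmod (complex_of_real (g x) - q x))\<^sup>2"
      by (simp add: power_mult_distrib mult.assoc)
  qed (use intf intg in auto)
  also have "\<dots> = 2 * a\<^sup>2 * sq_dist f p + 2 * b\<^sup>2 * sq_dist g q"
    using intf intg by (simp add: sq_dist_def)
  also have "\<dots> \<le> 2 * a\<^sup>2 * (e / C) + 2 * b\<^sup>2 * (e / C)"
    using p(2) q(2) by (intro add_mono mult_left_mono) auto
  also have "\<dots> = 2 * (a\<^sup>2 + b\<^sup>2) * e / C" by (simp add: distrib_right add_divide_distrib distrib_left)
  also have "\<dots> < e"
    using e C by (simp add: pos_divide_less_eq C_def)
  finally show "\<exists>p. trig_poly p \<and> sq_dist (\<lambda>x. a * f x + b * g x) p < e" using r by blast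
qed

text \<open>Stone-Weierstrass on the circle in the complex plane; composing with
  \<open>trig 1\<close> builds in the periodicity.\<close>

lemma approximable_continuous:
  assumes phi: "continuous_on (sphere 0 1) phi"
  shows "sq_int (\<lambda>x. phi (trig 1 x))" "approximable (\<lambda>x. phi (trig 1 x))"
proof -
  have cont: "continuous_on UNIV (\<lambda>x. phi (trig 1 x))"
    by (rule continuous_on_compose2[OF phi continuous_trig]) auto
  have "compact (phi ` sphere 0 1)" by (intro compact_continuous_image phi) simp
  then have "bounded (phi ` sphere 0 1)" by (rule compact_imp_bounded)
  then obtain B where "\<forall>y\<in>phi ` sphere 0 1. norm y \<le> B" unfolding bounded_iff by blast
  then have B: "\<bar>phi (trig 1 x)\<bar> \<le> B" for x by auto
  show sq: "sq_int (\<lambda>x. phi (trig 1 x))"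
    by (rule sq_int_bounded[OF _ B]) (intro measurable_unit_law borel_measurable_continuous_onI cont)
  show "approximable (\<lambda>x. phi (trig 1 x))"
    unfolding approximable_def
  proof (intro allI impI)
    fix e :: real assume e: "e > 0"
    obtain g where g: "real_polynomial_function g" "\<And>z. z \<in> sphere 0 1 \<Longrightarrow> \<bar>phi z - g z\<bar> < sqrt (e / 2)"
      using Stone_Weierstrass_real_polynomial_function[of "sphere (0::complex) 1" phi "sqrt (e / 2)"] phi e by auto
    let ?p = "\<lambda>x. complex_of_real (g (trig 1 x))"
    have p: "trig_poly ?p" by (rule real_polynomial_on_circle[OF g(1)])
    obtain C where C: "\<And>x. cmod (?p x) \<le> C" using trig_poly_bounded[OF p] by blast
    have "sq_dist (\<lambda>x. phi (trig 1 x)) ?p \<le> (LINT x|unit_law. e / 2)"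
      unfolding sq_dist_def
    proof (intro integral_mono sq_dist_integrable[OF sq trig_poly_measurable[OF p] C])
      fix x
      have "\<bar>phi (trig 1 x) - g (trig 1 x)\<bar> \<le> sqrt (e / 2)" using g(2)[of "trig 1 x"] by simp
      then have "\<bar>phi (trig 1 x) - g (trig 1 x)\<bar>\<^sup>2 \<le> (sqrt (e / 2))\<^sup>2" by (intro power_mono) auto
      then show "(cmod (complex_of_real (phi (trig 1 x)) - ?p x))\<^sup>2 \<le> e / 2"
        using e by (simp flip: of_real_diff)
    qed simp
    also have "\<dots> < e" using e unit_law.prob_space by simp
    finally show "\<exists>p. trig_poly p \<and> sq_dist (\<lambda>x. phi (trig 1 x)) p < e" using p by blast
  qed
qed

lemma trig_1_inj:
  assumes "trig 1 x = trig 1 y" "\<bar>x - y\<bar> < 1"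
  shows "x = y"
proof -
  have "trig 1 (x - y) = trig 1 x * trig 1 (- y)"
    by (simp add: trig_def right_diff_distrib exp_diff exp_minus field_simps)
  also have "trig 1 (- y) = cnj (trig 1 y)" by (simp add: trig_def exp_cnj)
  also have "trig 1 x * cnj (trig 1 y) = 1" by (simp add: assms(1) trig_cnj_mult)
  finally have "exp (2 * of_real pi * \<i> * of_real (x - y)) = 1" by (simp add: trig_def)
  then obtain m :: int where "2 * pi * (x - y) = of_int (2 * m) * pi"
    by (auto simp: exp_eq_1)
  then have m: "x - y = of_int m" by simp
  then have "m = 0" using assms(2) by linarith
  then show ?thesis using m by simp
qed

text \<open>Within the unit interval a half-line is the preimage of a closed arc \<open>K\<close>,
  whose indicator is the pointwise limit of the continuous functions
  \<open>max 0 (1 - n * infdist z K)\<close>.\<close>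

lemma approximable_atMost: "approximable (indicator {..b})"
proof -
  consider "b \<le> 0" | "b \<ge> 1" | "0 < b" "b < 1" by linarith
  then show ?thesis
  proof cases
    case 1
    have "sq_dist (indicator {..b}) (\<lambda>x. 0) = (LINT x|unit_law. 0)"
      unfolding sq_dist_def by (rule Bochner_Integration.integral_cong) (use 1 in auto)
    then show ?thesis unfolding approximable_def using trig_poly_const[of 0] by fastforce
  next
    case 2
    have "sq_dist (indicator {..b}) (\<lambda>x. 1) = (LINT x|unit_law. 0)"
      unfolding sq_dist_def by (rule Bochner_Integration.integral_cong) (use 2 in auto)
    then show ?thesis unfolding approximable_def using trig_poly_const[of 1] by fastforce
  next
    case 3
    define K where "K = trig 1 ` {0..b}"
    have K: "compact K" "K \<noteq> {}"
      unfolding K_def using 3 by (auto intro!: compact_continuous_image continuous_trig)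
    define phi where "phi n z = max 0 (1 - real n * infdist z K)" for n z
    have cont: "continuous_on (sphere 0 1) (phi n)" for n
      unfolding phi_def by (intro continuous_intros)
    \<comment> \<open>\<open>b < 1\<close> keeps the arc from closing up, so that
      \<open>trig_1_inj\<close> applies.\<close>
    have mem: "trig 1 x \<in> K \<longleftrightarrow> x \<le> b" if "x \<in> {0<..<1}" for x
    proof
      assume "trig 1 x \<in> K"
      then obtain y where y: "y \<in> {0..b}" "trig 1 x = trig 1 y" by (auto simp: K_def)
      then have "x = y" using that 3 by (intro trig_1_inj) auto
      then show "x \<le> b" using y by simp
    qed (use that in \<open>auto simp: K_def\<close>)
    have meas: "(indicator {..b} :: real \<Rightarrow> real) \<in> borel_measurable unit_law" by (rule measurable_unit_law) simp
    show ?thesis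
    proof (rule approximable_dominated)
      show "sq_int (indicator {..b})" by (rule sq_int_bounded[OF meas, of 1]) (simp add: indicator_def)
      show "sq_int (\<lambda>x. phi n (trig 1 x))" "approximable (\<lambda>x. phi n (trig 1 x))" for n
        by (rule approximable_continuous[OF cont])+
      show "sq_int (\<lambda>_. 1)" by (rule sq_int_bounded[of _ 1]) auto
      show "\<bar>indicator {..b} x - phi n (trig 1 x)\<bar> \<le> 1" for n x
        using infdist_nonneg[of "trig 1 x" K] by (auto simp: phi_def indicator_def)
      show "(\<lambda>n. phi n (trig 1 x)) \<longlonglongrightarrow> indicator {..b} x" if x: "x \<in> {0<..<1}" for x
      proof (cases "x \<le> b")
        case True
        then have "infdist (trig 1 x) K = 0" using mem[OF x] by simp
        then show ?thesis using True by (simp add: phi_def)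
      next
        case False
        then have d: "infdist (trig 1 x) K > 0"
          using mem[OF x] K by (simp add: infdist_pos_not_in_closed compact_imp_closed)
        have "eventually (\<lambda>n. phi n (trig 1 x) = 0) sequentially"
          using eventually_ge_at_top[of "nat \<lceil>1 / infdist (trig 1 x) K\<rceil>"]
        proof eventually_elim
          case (elim n)
          then have "1 / infdist (trig 1 x) K \<le> real n" by linarith
          then show ?case using d by (simp add: phi_def field_simps)
        qed
        then show ?thesis using False by (simp add: tendsto_eventually)
      qed
    qed
  qed
qed

lemma sq_int_indicator: "A \<in> sets borel \<Longrightarrow> sq_int (indicator A)"
  by (rule sq_int_bounded[of _ 1]) (auto simp: indicator_def intro!: measurable_unit_law)

lemma sq_int_const: "sq_int (\<lambda>_. c)"
  by (rule sq_int_bounded[of _ "\<bar>c\<bar>"]) auto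

lemma approximable_const: "approximable (\<lambda>_. c)"
  using approximable_continuous(2)[of "\<lambda>_. c"] by simp

text \<open>Dynkin's theorem, starting from the half-lines, which are stable under intersection and
  generate the Borel sets.\<close>

lemma approximable_indicator:
  assumes "A \<in> sets borel"
  shows "approximable (indicator A)"
proof -
  have gen: "sets (borel :: real measure) = sigma_sets UNIV (range (\<lambda>a. {..a}))"
    by (subst borel_eq_atMost) simp
  have A: "A \<in> sigma_sets UNIV (range (\<lambda>a::real. {..a}))" using assms by (simp add: gen)
  have stable: "Int_stable (range (\<lambda>a::real. {..a}))" by (auto simp: Int_stable_def)
  from stable subset_Pow_Union[of "range (\<lambda>a::real. {..a})", THEN order_trans, OF Pow_mono[OF subset_UNIV]] A
  show ?thesis
  proof (induction rule: sigma_sets_induct_disjoint)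
    case (basic A)
    then show ?case using approximable_atMost by auto
  next
    case empty
    show ?case using approximable_const[of 0] by simp
  next
    case (compl A)
    then have "A \<in> sets borel" by (simp add: gen)
    then have "approximable (\<lambda>x. 1 * 1 + (-1) * indicator A x)"
      by (intro approximable_linear sq_int_const approximable_const sq_int_indicator compl)
    also have "(\<lambda>x. 1 * 1 + (-1) * indicator A x) = (indicator (UNIV - A) :: real \<Rightarrow> real)"
      by (auto simp: indicator_def)
    finally show ?case .
  next
    case (union A)
    have A: "A i \<in> sets borel" for i using union(2) by (auto simp: gen)
    have fin: "sq_int (indicator (\<Union>i<n. A i))" "approximable (indicator (\<Union>i<n. A i))" for n
    proof -
      show "sq_int (indicator (\<Union>i<n. A i))" by (intro sq_int_indicator sets.finite_UN) (use A in auto)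
      show "approximable (indicator (\<Union>i<n. A i))"
      proof (induction n)
        case 0
        show ?case using approximable_const[of 0] by simp
      next
        case (Suc n)
        have "approximable (\<lambda>x. 1 * indicator (\<Union>i<n. A i) x + 1 * indicator (A n) x)"
          by (intro approximable_linear Suc union sq_int_indicator sets.finite_UN) (use A in auto)
        also have "(\<lambda>x. 1 * indicator (\<Union>i<n. A i) x + 1 * indicator (A n) x) = (indicator (\<Union>i<Suc n. A i) :: real \<Rightarrow> real)"
        proof
          fix x
          have "\<not> (x \<in> A n \<and> x \<in> A i)" if "i < n" for i
          proof -
            have "A n \<inter> A i = {}" using union(1) that unfolding disjoint_family_on_def by (metis UNIV_I less_irrefl_nat)
            then show ?thesis by auto
          qed
          then show "1 * indicator (\<Union>i<n. A i) x + 1 * indicator (A n) x = (indicator (\<Union>i<Suc n. A i) x :: real)"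
            by (auto simp: indicator_def lessThan_Suc)
        qed
        finally show ?case .
      qed
    qed
    show ?case
    proof (rule approximable_dominated[OF _ fin])
      show "sq_int (indicator (\<Union>i. A i))" by (intro sq_int_indicator sets.countable_UN) (use A in auto)
      show "sq_int (\<lambda>_. 1)" by (rule sq_int_const)
      show "\<bar>indicator (\<Union>i. A i) x - indicator (\<Union>i<n. A i) x\<bar> \<le> (1::real)" for n x
        by (auto simp: indicator_def)
      show "(\<lambda>n. indicator (\<Union>i<n. A i) x) \<longlonglongrightarrow> (indicator (\<Union>i. A i) x :: real)" for x
        by (rule LIMSEQ_indicator_UN)
    qed
  qed
qed

text \<open>A monotone class argument for the positive and the negative part. The induction carries
  an implication from \<open>sq_int\<close>, because the pieces of a square integrable function are
  square integrable only by domination.\<close>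

theorem approximable_sq_int:
  assumes f: "sq_int f"
  shows "approximable f"
proof -
  have nonneg: "sq_int u \<longrightarrow> approximable u" if "u \<in> borel_measurable unit_law" "\<And>x. 0 \<le> u x" for u
    using that
  proof (induction rule: borel_measurable_induct_real)
    case (set A)
    then have "A \<in> sets borel" by (auto simp: unit_law_def sets_restrict_space)
    then show ?case using approximable_indicator by simp
  next
    case (mult u c)
    show ?case
    proof (cases "c = 0")
      case True
      then show ?thesis using approximable_const[of 0] by simp
    next
      case False
      show ?thesis
      proof
        assume "sq_int (\<lambda>x. c * u x)"
        then have u: "sq_int u"
          using False sq_int_linear[of "\<lambda>x. c * u x" "\<lambda>x. c * u x" "1 / c" 0] by simp
        then show "approximable (\<lambda>x. c * u x)"
          using approximable_linear[OF u _ u, of c 0] mult by simp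
      qed
    qed
  next
    case (add u v)
    show ?case
    proof
      assume s: "sq_int (\<lambda>x. v x + u x)"
      \<comment> \<open>Both summands are nonnegative, hence dominated by their sum.\<close>
      have sub: "sq_int w" if "w \<in> borel_measurable unit_law" "\<And>x. 0 \<le> w x" "\<And>x. w x \<le> v x + u x" for w
        unfolding sq_int_def
      proof
        show "integrable unit_law (\<lambda>x. (w x)\<^sup>2)"
        proof (rule Bochner_Integration.integrable_bound)
          show "integrable unit_law (\<lambda>x. (v x + u x)\<^sup>2)" using s by (simp add: sq_int_def)
          show "AE x in unit_law. norm ((w x)\<^sup>2) \<le> norm ((v x + u x)\<^sup>2)"
            using that(2,3) by (intro AE_I2) (auto intro: power_mono)
        qed (use that(1) in measurable)
      qed (fact that(1))
      have "sq_int v" "sq_int u" using add by (auto intro!: sub)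
      then show "approximable (\<lambda>x. v x + u x)"
        using approximable_linear[of v u 1 1] add by simp
    qed
  next
    case (seq U)
    have meas: "\<And>i. U i \<in> borel_measurable unit_law" and pos: "\<And>i x. 0 \<le> U i x"
      and IH: "\<And>i. sq_int (U i) \<longrightarrow> approximable (U i)" and inc: "incseq U"
      and lim: "\<And>x. x \<in> space unit_law \<Longrightarrow> (\<lambda>i. U i x) \<longlonglongrightarrow> u x"
      using seq by blast+
    show ?case
    proof
      assume u: "sq_int u"
      have le: "U i x \<le> u x" if "x \<in> {0<..<1}" for i x
      proof (rule incseq_le)
        show "incseq (\<lambda>i. U i x)" using inc by (auto simp: incseq_def le_fun_def)
        show "(\<lambda>i. U i x) \<longlonglongrightarrow> u x" using lim that by simp
      qed
      have U: "sq_int (U i)" for i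
        unfolding sq_int_def
      proof
        show "integrable unit_law (\<lambda>x. (U i x)\<^sup>2)"
        proof (rule Bochner_Integration.integrable_bound)
          show "integrable unit_law (\<lambda>x. (u x)\<^sup>2)" using u by (simp add: sq_int_def)
          show "AE x in unit_law. norm ((U i x)\<^sup>2) \<le> norm ((u x)\<^sup>2)"
            using pos le by (intro AE_I2) (auto intro: power_mono)
        qed (use meas in measurable)
      qed (fact meas)
      show "approximable u"
      proof (rule approximable_dominated[OF u U _ u])
        show "approximable (U i)" for i using IH U by simp
        show "\<bar>u x - U i x\<bar> \<le> u x" if "x \<in> {0<..<1}" for i x
          using le[OF that, of i] pos[of i x] by simp
        show "(\<lambda>i. U i x) \<longlonglongrightarrow> u x" if "x \<in> {0<..<1}" for x using lim that by simp
      qed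
    qed
  qed
  have pm: "sq_int (\<lambda>x. max 0 (a * f x))" if "\<bar>a\<bar> = 1" for a
    unfolding sq_int_def
  proof
    have [measurable]: "f \<in> borel_measurable unit_law" using f by (simp add: sq_int_def)
    show "(\<lambda>x. max 0 (a * f x)) \<in> borel_measurable unit_law" by measurable
    show "integrable unit_law (\<lambda>x. (max 0 (a * f x))\<^sup>2)"
    proof (rule Bochner_Integration.integrable_bound)
      show "integrable unit_law (\<lambda>x. (f x)\<^sup>2)" using f by (simp add: sq_int_def)
      have "(max 0 (a * f x))\<^sup>2 \<le> (f x)\<^sup>2" for x
      proof -
        have "\<bar>a * f x\<bar> = \<bar>f x\<bar>" using that by (simp add: abs_mult)
        then have "\<bar>max 0 (a * f x)\<bar> \<le> \<bar>f x\<bar>" by linarith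
        then show ?thesis by (simp only: abs_le_square_iff)
      qed
      then show "AE x in unit_law. norm ((max 0 (a * f x))\<^sup>2) \<le> norm ((f x)\<^sup>2)" by simp
    qed measurable
  qed
  have pa: "approximable (\<lambda>x. max 0 (a * f x))" if "\<bar>a\<bar> = 1" for a
    using nonneg[of "\<lambda>x. max 0 (a * f x)"] pm[OF that] by (auto simp: sq_int_def)
  have "approximable (\<lambda>x. 1 * max 0 (1 * f x) + (-1) * max 0 ((-1) * f x))"
    by (intro approximable_linear pm pa) auto
  also have "(\<lambda>x. 1 * max 0 (1 * f x) + (-1) * max 0 ((-1) * f x)) = f" by (auto simp: max_def)
  finally show ?thesis .
qed

section \<open>Parseval's identity\<close>

lemma fourier_coeff_unit_law: "fourier_coeff f j = (LINT x|unit_law. complex_of_real (f x) * cnj (trig j x))"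
  by (simp add: fourier_coeff_def integral_unit_law)

lemma sq_int_trig_integrable:
  assumes f: "sq_int f"
  shows "integrable unit_law (\<lambda>x. complex_of_real (f x) * cnj (trig j x))"
    "integrable unit_law (\<lambda>x. complex_of_real (f x) * trig j x)"
proof -
  have [measurable]: "f \<in> borel_measurable unit_law" "trig i \<in> borel_measurable unit_law" for i
    using f by (auto simp: sq_int_def intro: measurable_unit_law)
  show *: "integrable unit_law (\<lambda>x. complex_of_real (f x) * trig j x)" for j
    by (rule Bochner_Integration.integrable_bound[OF sq_int_integrable[OF f]]) (auto simp: norm_mult)
  show "integrable unit_law (\<lambda>x. complex_of_real (f x) * cnj (trig j x))"
    using *[of "- j"] by (simp add: cnj_trig)
qed

lemma trig_product_integrable: "integrable unit_law (\<lambda>x. trig i x * cnj (trig j x))"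
  unfolding trig_cnj_mult
  by (rule unit_law.integrable_const_bound[of _ 1]) (auto intro: measurable_unit_law)

lemma sq_dist_nonneg: "sq_dist f p \<ge> 0"
  by (simp add: sq_dist_def)

text \<open>Completing the square in the coefficients. With \<open>c\<close> the Fourier
  coefficients this gives Bessel's inequality, with general \<open>c\<close> their optimality, and
  with \<open>f = 0\<close> the norm of a trigonometric sum.\<close>

lemma sq_dist_expand:
  assumes f: "sq_int f" and J: "finite J"
  shows "sq_dist f (\<lambda>x. \<Sum>j\<in>J. c j * trig j x)
    = (LINT x|unit_law. (f x)\<^sup>2) - (\<Sum>j\<in>J. (cmod (fourier_coeff f j))\<^sup>2)
      + (\<Sum>j\<in>J. (cmod (fourier_coeff f j - c j))\<^sup>2)"
proof -
  define p where "p x = (\<Sum>j\<in>J. c j * trig j x)" for x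
  let ?t = "fourier_coeff f"
  have e: "(cmod (complex_of_real (f x) - p x))\<^sup>2
    = (f x)\<^sup>2 - 2 * Re (\<Sum>j\<in>J. cnj (c j) * (complex_of_real (f x) * cnj (trig j x)))
      + Re (\<Sum>i\<in>J. \<Sum>j\<in>J. c i * cnj (c j) * (trig i x * cnj (trig j x)))" for x
  proof -
    have 1: "(\<Sum>j\<in>J. cnj (c j) * (complex_of_real (f x) * cnj (trig j x))) = complex_of_real (f x) * cnj (p x)"
      by (simp add: p_def sum_distrib_left mult_ac)
    have 2: "(\<Sum>i\<in>J. \<Sum>j\<in>J. c i * cnj (c j) * (trig i x * cnj (trig j x))) = p x * cnj (p x)"
      by (simp add: p_def sum_product mult_ac)
    show ?thesis unfolding 1 2 cmod_power2
      by (simp add: power2_eq_square algebra_simps)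
  qed
  have "sq_dist f p = (LINT x|unit_law. (f x)\<^sup>2)
      - 2 * Re (\<Sum>j\<in>J. cnj (c j) * ?t j)
      + Re (\<Sum>i\<in>J. \<Sum>j\<in>J. c i * cnj (c j) * of_bool (i = j))"
  proof -
    have i1: "integrable unit_law (\<lambda>x. \<Sum>j\<in>J. cnj (c j) * (complex_of_real (f x) * cnj (trig j x)))"
      by (intro Bochner_Integration.integrable_sum integrable_mult_right sq_int_trig_integrable f)
    have i2: "integrable unit_law (\<lambda>x. \<Sum>i\<in>J. \<Sum>j\<in>J. c i * cnj (c j) * (trig i x * cnj (trig j x)))"
      by (intro Bochner_Integration.integrable_sum integrable_mult_right trig_product_integrable)
    have v1: "(LINT x|unit_law. (\<Sum>j\<in>J. cnj (c j) * (complex_of_real (f x) * cnj (trig j x)))) = (\<Sum>j\<in>J. cnj (c j) * ?t j)"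
      by (subst Bochner_Integration.integral_sum)
        (auto intro!: sq_int_trig_integrable f integrable_mult_right simp: fourier_coeff_unit_law)
    have v2: "(LINT x|unit_law. (\<Sum>i\<in>J. \<Sum>j\<in>J. c i * cnj (c j) * (trig i x * cnj (trig j x))))
      = (\<Sum>i\<in>J. \<Sum>j\<in>J. c i * cnj (c j) * of_bool (i = j))"
      by (subst Bochner_Integration.integral_sum, intro Bochner_Integration.integrable_sum integrable_mult_right trig_product_integrable,
          subst Bochner_Integration.integral_sum)
        (auto intro!: trig_product_integrable simp: trig_orthonormal simp del: mult_eq_0_iff)
    have i0: "integrable unit_law (\<lambda>x. (f x)\<^sup>2)" using f by (simp add: sq_int_def)
    show ?thesis
      unfolding sq_dist_def e using i0 i1 i2 v1 v2
      by (simp add: integrable_Re Bochner_Integration.integral_add Bochner_Integration.integral_diff integral_Re del: Re_sum)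
  qed
  also have "(\<Sum>i\<in>J. \<Sum>j\<in>J. c i * cnj (c j) * of_bool (i = j)) = (\<Sum>i\<in>J. c i * cnj (c i))"
  proof (intro sum.cong refl)
    fix i assume i: "i \<in> J"
    have "(\<Sum>j\<in>J. c i * cnj (c j) * of_bool (i = j)) = (\<Sum>j\<in>J. if j = i then c i * cnj (c i) else 0)"
      by (intro sum.cong refl) auto
    then show "(\<Sum>j\<in>J. c i * cnj (c j) * of_bool (i = j)) = c i * cnj (c i)" using i J by simp
  qed
  also have "(LINT x|unit_law. (f x)\<^sup>2) - 2 * Re (\<Sum>j\<in>J. cnj (c j) * ?t j) + Re (\<Sum>i\<in>J. c i * cnj (c i))
    = (LINT x|unit_law. (f x)\<^sup>2) + (\<Sum>j\<in>J. (cmod (?t j - c j))\<^sup>2 - (cmod (?t j))\<^sup>2)"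
  proof -
    have "Re (c j * cnj (c j)) - 2 * Re (cnj (c j) * ?t j) = (cmod (?t j - c j))\<^sup>2 - (cmod (?t j))\<^sup>2" for j
      unfolding cmod_power2 by (simp add: power2_eq_square algebra_simps)
    then have "(\<Sum>j\<in>J. (cmod (?t j - c j))\<^sup>2 - (cmod (?t j))\<^sup>2) = (\<Sum>j\<in>J. Re (c j * cnj (c j)) - 2 * Re (cnj (c j) * ?t j))"
      by simp
    also have "\<dots> = Re (\<Sum>i\<in>J. c i * cnj (c i)) - 2 * Re (\<Sum>j\<in>J. cnj (c j) * ?t j)"
      by (simp only: sum_subtractf Re_sum sum_distrib_left)
    finally show ?thesis by simp
  qed
  finally show ?thesis by (simp add: p_def[abs_def] sum_subtractf)
qed

text \<open>Bessel bounds all finite sums by the norm. Density of the trigonometric polynomials and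
  optimality of the Fourier coefficients make the bound sharp.\<close>

theorem Parseval:
  assumes f: "sq_int f"
  shows "((\<lambda>j. (cmod (fourier_coeff f j))\<^sup>2) has_sum (LINT x|unit_law. (f x)\<^sup>2)) UNIV"
proof -
  let ?E = "LINT x|unit_law. (f x)\<^sup>2" and ?a = "\<lambda>j. (cmod (fourier_coeff f j))\<^sup>2"
  have bessel: "sum ?a F \<le> ?E" if "finite F" for F
    using sq_dist_expand[OF f that, of "fourier_coeff f"] sq_dist_nonneg[of f "\<lambda>x. \<Sum>j\<in>F. fourier_coeff f j * trig j x"]
    by simp
  have approx: "\<exists>F. finite F \<and> ?E - e < sum ?a F" if e: "e > 0" for e
  proof -
    obtain p where p: "trig_poly p" "sq_dist f p < e"
      using approximable_sq_int[OF f] e by (auto simp: approximable_def)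
    obtain J c where J: "finite J" "p = (\<lambda>x. \<Sum>j\<in>J. c j * trig j x)" using trig_poly_sum_form[OF p(1)] .
    have "0 \<le> (\<Sum>j\<in>J. (cmod (fourier_coeff f j - c j))\<^sup>2)" by (simp add: sum_nonneg)
    then have "?E - e < sum ?a J" using sq_dist_expand[OF f J(1), of c] p(2) J(2) by simp
    then show ?thesis using J(1) by blast
  qed
  have bdd: "bdd_above (sum ?a ` {F. F \<subseteq> UNIV \<and> finite F})"
    using bessel by (auto intro!: bdd_aboveI2)
  have "(SUP F\<in>{F. finite F \<and> F \<subseteq> UNIV}. sum ?a F) = ?E"
  proof (rule antisym)
    show "(SUP F\<in>{F. finite F \<and> F \<subseteq> UNIV}. sum ?a F) \<le> ?E" using bessel by (intro cSUP_least) auto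
    show "?E \<le> (SUP F\<in>{F. finite F \<and> F \<subseteq> UNIV}. sum ?a F)"
    proof (rule field_le_epsilon)
      fix e :: real assume "e > 0"
      then obtain F where F: "finite F" "?E - e < sum ?a F" using approx by blast
      have "sum ?a F \<le> (SUP F\<in>{F. finite F \<and> F \<subseteq> UNIV}. sum ?a F)"
        using F(1) bdd by (intro cSUP_upper) (auto simp: conj_commute)
      then show "?E \<le> (SUP F\<in>{F. finite F \<and> F \<subseteq> UNIV}. sum ?a F) + e" using F(2) by linarith
    qed
  qed
  then show ?thesis using nonneg_bdd_above_has_sum[of UNIV ?a, OF _ bdd] by simp
qed

lemma abs_gt_nat: "{j::int. real_of_int \<bar>j\<bar> > real N} = UNIV - {- int N..int N}"
  by auto

lemma Parseval_tail:
  assumes f: "sq_int f"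
  shows "(\<Sum>\<^sub>\<infinity>j\<in>{j::int. real_of_int \<bar>j\<bar> > real N}. (cmod (fourier_coeff f j))\<^sup>2)
    = (LINT x|unit_law. (f x)\<^sup>2) - (\<Sum>j\<in>{- int N..int N}. (cmod (fourier_coeff f j))\<^sup>2)"
  unfolding abs_gt_nat using Parseval[OF f]
  by (subst infsum_Diff) (auto simp: infsumI has_sum_imp_summable)

lemma fourier_coeff_uminus: "fourier_coeff f (- j) = cnj (fourier_coeff f j)"
proof -
  have "cnj (fourier_coeff f j) = (LINT x|unit_law. cnj (complex_of_real (f x) * cnj (trig j x)))"
    unfolding fourier_coeff_unit_law by (rule Bochner_Integration.integral_cnj[symmetric])
  then show ?thesis by (simp add: fourier_coeff_unit_law cnj_trig)
qed

section \<open>Partial sums and remainders\<close>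

definition partial_sum :: "(real \<Rightarrow> real) \<Rightarrow> nat \<Rightarrow> real \<Rightarrow> complex" where
  "partial_sum f N x = (\<Sum>j\<in>{- int N..int N}. fourier_coeff f j * trig j x)"

lemma partial_sum_real: "partial_sum f N x = complex_of_real (Re (partial_sum f N x))"
proof -
  have "cnj (partial_sum f N x) = (\<Sum>j\<in>{- int N..int N}. fourier_coeff f (- j) * trig (- j) x)"
    by (simp add: partial_sum_def fourier_coeff_uminus cnj_trig)
  also have "\<dots> = partial_sum f N x"
    unfolding partial_sum_def by (rule sum.reindex_bij_witness[of _ uminus uminus]) auto
  finally show ?thesis by (metis Reals_cnj_iff of_real_Re)
qed

lemma sq_int_partial_sum: "sq_int (\<lambda>x. Re (partial_sum f N x))"
proof (rule sq_int_bounded)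
  show "(\<lambda>x. Re (partial_sum f N x)) \<in> borel_measurable unit_law"
    unfolding partial_sum_def by (intro measurable_unit_law) measurable
  fix x
  have "\<bar>Re (partial_sum f N x)\<bar> \<le> cmod (partial_sum f N x)" by (rule abs_Re_le_cmod)
  also have "\<dots> \<le> (\<Sum>j\<in>{- int N..int N}. cmod (fourier_coeff f j))"
    unfolding partial_sum_def by (rule order_trans[OF norm_sum]) (simp add: norm_mult)
  finally show "\<bar>Re (partial_sum f N x)\<bar> \<le> (\<Sum>j\<in>{- int N..int N}. cmod (fourier_coeff f j))" .
qed

lemma fourier_remainder_eq: "fourier_remainder f N x = f x - Re (partial_sum f N x)"
  by (simp add: fourier_remainder_def partial_sum_def)

lemma sq_int_remainder:
  assumes "sq_int f" shows "sq_int (fourier_remainder f N)"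
  using sq_int_linear[OF assms sq_int_partial_sum, of 1 "-1" f N]
  by (simp add: fourier_remainder_eq[abs_def])

lemma remainder_norm:
  assumes f: "sq_int f"
  shows "(LINT x|unit_law. (fourier_remainder f N x)\<^sup>2)
    = (LINT x|unit_law. (f x)\<^sup>2) - (\<Sum>j\<in>{- int N..int N}. (cmod (fourier_coeff f j))\<^sup>2)"
proof -
  have "sq_dist f (partial_sum f N) = (LINT x|unit_law. (fourier_remainder f N x)\<^sup>2)"
    unfolding sq_dist_def
  proof (rule Bochner_Integration.integral_cong[OF refl])
    fix x
    have "complex_of_real (f x) - partial_sum f N x = complex_of_real (fourier_remainder f N x)"
      by (subst partial_sum_real) (simp add: fourier_remainder_eq)
    then show "(cmod (complex_of_real (f x) - partial_sum f N x))\<^sup>2 = (fourier_remainder f N x)\<^sup>2" by simp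
  qed
  then show ?thesis
    using sq_dist_expand[OF f, of "{- int N..int N}" "fourier_coeff f"] by (simp add: partial_sum_def[abs_def])
qed

lemma fourier_coeff_diff:
  assumes "sq_int f" "sq_int g"
  shows "fourier_coeff (\<lambda>x. f x - g x) j = fourier_coeff f j - fourier_coeff g j"
  unfolding fourier_coeff_unit_law
  using sq_int_trig_integrable(1)[OF assms(1)] sq_int_trig_integrable(1)[OF assms(2)]
  by (simp add: left_diff_distrib)

lemma fourier_coeff_partial_sum:
  "fourier_coeff (\<lambda>x. Re (partial_sum f N x)) j = (if \<bar>j\<bar> \<le> int N then fourier_coeff f j else 0)"
proof -
  have "fourier_coeff (\<lambda>x. Re (partial_sum f N x)) j
    = (LINT x|unit_law. (\<Sum>i\<in>{- int N..int N}. fourier_coeff f i * (trig i x * cnj (trig j x))))"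
    unfolding fourier_coeff_unit_law[of "\<lambda>x. Re (partial_sum f N x)"] partial_sum_real[symmetric]
    by (simp add: partial_sum_def sum_distrib_right mult.assoc)
  also have "\<dots> = (\<Sum>i\<in>{- int N..int N}. fourier_coeff f i * of_bool (i = j))"
    by (subst Bochner_Integration.integral_sum) (auto intro!: trig_product_integrable simp: trig_orthonormal)
  also have "\<dots> = (\<Sum>i\<in>{- int N..int N}. if i = j then fourier_coeff f j else 0)"
    by (intro sum.cong) auto
  finally show ?thesis by auto
qed

lemma fourier_coeff_remainder:
  assumes "sq_int f"
  shows "fourier_coeff (fourier_remainder f N) j = (if \<bar>j\<bar> \<le> int N then 0 else fourier_coeff f j)"
  using fourier_coeff_diff[OF assms sq_int_partial_sum, of f N j]
  by (simp add: fourier_remainder_eq[abs_def] fourier_coeff_partial_sum)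

lemma L2_norm_unit_law: "L2_norm f = sqrt (LINT x|unit_law. (f x)\<^sup>2)"
  by (simp add: L2_norm_def integral_unit_law)

lemma L2_per_sq_int: "f \<in> L2_per \<Longrightarrow> sq_int f"
  unfolding L2_per_def sq_int_def by (auto intro: measurable_unit_law simp: integrable_unit_law)

section \<open>Mean values over intervals\<close>

lemma sq_int_interval:
  assumes f: "sq_int f" "f \<in> borel_measurable borel" and I: "{a<..<b} \<subseteq> {0<..<1}"
  shows "set_integrable lborel {a<..<b} f" "set_integrable lborel {a<..<b} (\<lambda>x. (f x)\<^sup>2)"
proof -
  have "set_integrable lborel {0<..<1} f" "set_integrable lborel {0<..<1} (\<lambda>x. (f x)\<^sup>2)"
    using sq_int_integrable[OF f(1)] f(1) by (auto simp: sq_int_def simp flip: integrable_unit_law)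
  then show "set_integrable lborel {a<..<b} f" "set_integrable lborel {a<..<b} (\<lambda>x. (f x)\<^sup>2)"
    using I by (auto intro: set_integrable_subset)
qed

text \<open>The left side is the minimum of the right side over \<open>c\<close>, attained at the
  mean value.\<close>

lemma interval_variance:
  fixes f :: "real \<Rightarrow> real"
  assumes ab: "a < b" and f: "set_integrable lborel {a<..<b} f" "set_integrable lborel {a<..<b} (\<lambda>x. (f x)\<^sup>2)"
  shows "(LINT x:{a<..<b}|lborel. (f x)\<^sup>2) - (LINT x:{a<..<b}|lborel. f x)\<^sup>2 / (b - a)
    \<le> (LINT x:{a<..<b}|lborel. (f x - c)\<^sup>2)"
proof -
  let ?I = "{a<..<b}"
  have 1: "set_integrable lborel ?I (\<lambda>x. c\<^sup>2)" using ab by (simp add: set_integrable_def)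
  have "(LINT x:?I|lborel. (f x - c)\<^sup>2) = (LINT x:?I|lborel. (f x)\<^sup>2 - (2 * c) * f x + c\<^sup>2)"
    by (simp add: power2_diff algebra_simps)
  also have "\<dots> = (LINT x:?I|lborel. (f x)\<^sup>2) - 2 * c * (LINT x:?I|lborel. f x) + c\<^sup>2 * (b - a)"
    using f 1 ab by (simp add: set_integral_add set_integral_diff) (simp add: set_lebesgue_integral_def)
  finally have e: "(LINT x:?I|lborel. (f x - c)\<^sup>2) = (LINT x:?I|lborel. (f x)\<^sup>2) - 2 * c * (LINT x:?I|lborel. f x) + c\<^sup>2 * (b - a)" .
  define m where "m = (LINT x:?I|lborel. f x)"
  have "0 \<le> (m - c * (b - a))\<^sup>2 / (b - a)" using ab by simp
  also have "\<dots> = m\<^sup>2 / (b - a) - 2 * c * m + c\<^sup>2 * (b - a)"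
    using ab by (simp add: field_simps power2_eq_square)
  finally show ?thesis unfolding e m_def by simp
qed

lemma interval_Cauchy_Schwarz:
  fixes f :: "real \<Rightarrow> real"
  assumes ab: "a \<le> b" and f: "set_integrable lborel {a<..<b} f" "set_integrable lborel {a<..<b} (\<lambda>x. (f x)\<^sup>2)"
  shows "(LINT x:{a<..<b}|lborel. f x)\<^sup>2 \<le> (b - a) * (LINT x:{a<..<b}|lborel. (f x)\<^sup>2)"
proof (cases "a = b")
  case False
  then have ab: "a < b" using ab by simp
  let ?I = "{a<..<b}"
  define m where "m = (LINT x:?I|lborel. f x)"
  have 1: "set_integrable lborel ?I (\<lambda>x. c)" for c :: real using ab by (simp add: set_integrable_def)
  define c where "c = m / (b - a)"
  have "0 \<le> (LINT x:?I|lborel. (f x - c)\<^sup>2)" by (simp add: set_lebesgue_integral_def)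
  also have "(LINT x:?I|lborel. (f x - c)\<^sup>2) = (LINT x:?I|lborel. (f x)\<^sup>2 - (2 * c) * f x + c\<^sup>2)"
    by (simp add: power2_diff algebra_simps)
  also have "\<dots> = (LINT x:?I|lborel. (f x)\<^sup>2) - 2 * c * m + c\<^sup>2 * (b - a)"
    using f 1 ab by (simp add: set_integral_add set_integral_diff m_def) (simp add: set_lebesgue_integral_def)
  also have "\<dots> = (LINT x:?I|lborel. (f x)\<^sup>2) - m\<^sup>2 / (b - a)"
  proof -
    have "m = c * (b - a)" using ab by (simp add: c_def)
    then show ?thesis using ab by (simp add: power2_eq_square)
  qed
  finally show ?thesis using ab by (simp add: m_def field_simps)
qed (simp add: set_lebesgue_integral_def)

lemma interval_split:
  fixes f :: "real \<Rightarrow> 'b::{banach, second_countable_topology}"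
  assumes "a \<le> b" "b \<le> c" and f: "set_integrable lborel {a<..<c} f"
  shows "(LINT x:{a<..<c}|lborel. f x) = (LINT x:{a<..<b}|lborel. f x) + (LINT x:{b<..<c}|lborel. f x)"
proof -
  have i: "set_integrable lborel {a<..<b} f" "set_integrable lborel {b<..<c} f"
    using assms by (auto intro: set_integrable_subset[OF f])
  have "(LINT x:{a<..<c}|lborel. f x) = (LINT x|lborel. indicator {a<..<b} x *\<^sub>R f x + indicator {b<..<c} x *\<^sub>R f x)"
    unfolding set_lebesgue_integral_def
  proof (rule integral_cong_AE)
    show "AE x in lborel. indicator {a<..<c} x *\<^sub>R f x = indicator {a<..<b} x *\<^sub>R f x + indicator {b<..<c} x *\<^sub>R f x"
      using AE_lborel_singleton[of b] by eventually_elim (use assms in \<open>auto simp: indicator_def\<close>)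
  qed (use i f in \<open>auto simp: set_integrable_def intro!: borel_measurable_integrable\<close>)
  also have "\<dots> = (LINT x:{a<..<b}|lborel. f x) + (LINT x:{b<..<c}|lborel. f x)"
    unfolding set_lebesgue_integral_def using i
    by (intro Bochner_Integration.integral_add) (auto simp: set_integrable_def)
  finally show ?thesis .
qed

lemma cells_sum:
  fixes f :: "real \<Rightarrow> real"
  assumes k: "k > 0" and f: "set_integrable lborel {0<..<1} f"
  shows "(\<Sum>l\<in>{1..k}. LINT x:{(real l - 1) / k<..<real l / k}|lborel. f x) = (LINT x:{0<..<1}|lborel. f x)"
proof -
  have "m \<le> k \<Longrightarrow> (\<Sum>l\<in>{1..m}. LINT x:{(real l - 1) / k<..<real l / k}|lborel. f x) = (LINT x:{0<..<real m / k}|lborel. f x)" for m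
  proof (induction m)
    case 0
    show ?case by (simp add: set_lebesgue_integral_def)
  next
    case (Suc m)
    have "real (Suc m) / k \<le> 1" using Suc.prems k by simp
    then have "set_integrable lborel {0<..<real (Suc m) / k} f"
      by (intro set_integrable_subset[OF f]) auto
    then have "(LINT x:{0<..<real (Suc m) / k}|lborel. f x)
      = (LINT x:{0<..<real m / k}|lborel. f x) + (LINT x:{real m / k<..<real (Suc m) / k}|lborel. f x)"
      by (intro interval_split) (auto simp: divide_right_mono)
    then show ?case using Suc by simp
  qed
  from this[of k] show ?thesis using k by simp
qed

section \<open>Low frequencies are seen by the cells\<close>

lemma cell_interval:
  fixes k l :: nat
  assumes "k > 0" "l \<in> {1..k}"
  shows "{(real l - 1) / k<..<real l / k} \<subseteq> {0<..<1}" "(real l - 1) / k < real l / k"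
    "real l / k - (real l - 1) / k = 1 / k"
proof -
  have "0 \<le> (real l - 1) / k" "real l / k \<le> 1" using assms by (auto simp: field_simps)
  then show "{(real l - 1) / k<..<real l / k} \<subseteq> {0<..<1}" by auto
  show "(real l - 1) / k < real l / k" using assms by (simp add: divide_strict_right_mono)
  show "real l / k - (real l - 1) / k = 1 / k" by (simp flip: diff_divide_distrib)
qed

text \<open>By the fundamental theorem and Cauchy-Schwarz \<open>p\<close> differs from
  \<open>p a\<close> by at most \<open>sqrt ((b - a) * D)\<close>; then
  \<open>interval_variance\<close> applies with \<open>c = p a\<close>. No sharp constant is
  sought.\<close>

lemma cell_poincare:
  fixes p p' :: "real \<Rightarrow> real"
  assumes ab: "a < b"
    and d: "\<And>x. (p has_vector_derivative p' x) (at x)" and c: "continuous_on UNIV p'"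
  shows "(LINT x:{a<..<b}|lborel. (p x)\<^sup>2) - (LINT x:{a<..<b}|lborel. p x)\<^sup>2 / (b - a)
    \<le> (b - a)\<^sup>2 * (LINT x:{a<..<b}|lborel. (p' x)\<^sup>2)"
proof -
  have cp: "continuous_on A p" for A
    using d by (intro continuous_at_imp_continuous_on ballI) (metis has_vector_derivative_continuous)
  have cp': "continuous_on A p'" for A using c continuous_on_subset by blast
  have si: "set_integrable lborel {u<..<v} f" if "continuous_on {u..v} f" for u v :: real and f :: "real \<Rightarrow> real"
    by (rule set_integrable_subset[OF borel_integrable_atLeastAtMost'[OF that]]) auto
  define D where "D = (LINT x:{a<..<b}|lborel. (p' x)\<^sup>2)"
  have osc: "(p x - p a)\<^sup>2 \<le> (b - a) * D" if x: "x \<in> {a<..<b}" for x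
  proof -
    have "(LINT y:{a<..<x}|lborel. p' y) = (LINT y:{a..x}|lborel. p' y)"
      by (rule LINT_Ioo_eq_Icc) (intro borel_measurable_continuous_onI c)
    also have "\<dots> = p x - p a"
      unfolding set_lebesgue_integral_def using x d
      by (intro integral_FTC_atLeastAtMost cp') (auto intro: has_vector_derivative_at_within)
    finally have "(p x - p a)\<^sup>2 = (LINT y:{a<..<x}|lborel. p' y)\<^sup>2" by simp
    also have "\<dots> \<le> (x - a) * (LINT y:{a<..<x}|lborel. (p' y)\<^sup>2)"
      using x by (intro interval_Cauchy_Schwarz si continuous_intros cp') auto
    also have "\<dots> \<le> (b - a) * D"
    proof (intro mult_mono)
      show "(LINT y:{a<..<x}|lborel. (p' y)\<^sup>2) \<le> D"
        unfolding D_def set_lebesgue_integral_def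
        using x si[of a x "\<lambda>y. (p' y)\<^sup>2"] si[of a b "\<lambda>y. (p' y)\<^sup>2"]
        by (intro integral_mono) (auto simp: set_integrable_def indicator_def intro!: continuous_intros cp')
    qed (use x in \<open>auto simp: set_lebesgue_integral_def\<close>)
    finally show ?thesis .
  qed
  have "(LINT x:{a<..<b}|lborel. (p x)\<^sup>2) - (LINT x:{a<..<b}|lborel. p x)\<^sup>2 / (b - a)
    \<le> (LINT x:{a<..<b}|lborel. (p x - p a)\<^sup>2)"
    by (intro interval_variance ab si continuous_intros cp)
  also have "\<dots> \<le> (LINT x:{a<..<b}|lborel. (b - a) * D)"
    unfolding set_lebesgue_integral_def
  proof (rule integral_mono)
    show "integrable lborel (\<lambda>x. indicat_real {a<..<b} x *\<^sub>R (p x - p a)\<^sup>2)"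
    proof -
      have "set_integrable lborel {a<..<b} (\<lambda>x. (p x - p a)\<^sup>2)" by (intro si continuous_intros cp)
      then show ?thesis by (simp add: set_integrable_def)
    qed
    show "integrable lborel (\<lambda>x. indicat_real {a<..<b} x *\<^sub>R ((b - a) * D))"
      using si[of a b "\<lambda>x. (b - a) * D"] by (auto simp: set_integrable_def)
    show "indicat_real {a<..<b} x *\<^sub>R (p x - p a)\<^sup>2 \<le> indicat_real {a<..<b} x *\<^sub>R ((b - a) * D)" for x
      using osc[of x] by (auto simp: indicator_def)
  qed
  also have "\<dots> = (b - a)\<^sup>2 * D"
    using ab by (simp add: set_lebesgue_integral_def power2_eq_square)
  finally show ?thesis by (simp add: D_def)
qed

definition cell_energy :: "nat \<Rightarrow> (real \<Rightarrow> real) \<Rightarrow> real" where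
  "cell_energy k f = real k * (\<Sum>l\<in>{1..k}. (LINT x:{(real l - 1) / k<..<real l / k}|lborel. f x)\<^sup>2)"

text \<open>Averaging over cells is a contraction, by Cauchy-Schwarz on each cell.\<close>

lemma cell_energy_le:
  assumes k: "k > 0" and f: "sq_int f" "f \<in> borel_measurable borel"
  shows "cell_energy k f \<le> (LINT x|unit_law. (f x)\<^sup>2)"
proof -
  have "cell_energy k f \<le> real k * (\<Sum>l\<in>{1..k}. 1 / k * (LINT x:{(real l - 1) / k<..<real l / k}|lborel. (f x)\<^sup>2))"
    unfolding cell_energy_def
  proof (intro mult_left_mono sum_mono)
    fix l assume l: "l \<in> {1..k}"
    note c = cell_interval[OF k l]
    show "(LINT x:{(real l - 1) / k<..<real l / k}|lborel. f x)\<^sup>2 \<le> 1 / k * (LINT x:{(real l - 1) / k<..<real l / k}|lborel. (f x)\<^sup>2)"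
      using interval_Cauchy_Schwarz[OF less_imp_le[OF c(2)] sq_int_interval[OF f c(1)]] unfolding c(3) .
  qed simp
  also have "\<dots> = (\<Sum>l\<in>{1..k}. LINT x:{(real l - 1) / k<..<real l / k}|lborel. (f x)\<^sup>2)"
    using k by (simp flip: sum_distrib_left sum_divide_distrib)
  also have "\<dots> = (LINT x:{0<..<1}|lborel. (f x)\<^sup>2)"
    by (rule cells_sum[OF k]) (use f in \<open>auto simp: sq_int_def simp flip: integrable_unit_law\<close>)
  finally show ?thesis by (simp add: integral_unit_law)
qed

lemma trig_sum_norm:
  assumes "finite J"
  shows "(LINT x|unit_law. (cmod (\<Sum>j\<in>J. c j * trig j x))\<^sup>2) = (\<Sum>j\<in>J. (cmod (c j))\<^sup>2)"
  using sq_dist_expand[OF sq_int_const[of 0] assms, of c]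
  by (simp add: sq_dist_def fourier_coeff_def)

lemma partial_sum_norm:
  "(LINT x|unit_law. (Re (partial_sum f N x))\<^sup>2) = (\<Sum>j\<in>{- int N..int N}. (cmod (fourier_coeff f j))\<^sup>2)"
proof -
  have "(Re (partial_sum f N x))\<^sup>2 = (cmod (partial_sum f N x))\<^sup>2" for x
    by (subst (2) partial_sum_real) simp
  then show ?thesis using trig_sum_norm[of "{- int N..int N}" "fourier_coeff f"] by (simp add: partial_sum_def)
qed

text \<open>Bernstein's inequality bounds the norm of the derivative by \<open>2 * pi * N\<close>
  times that of the partial sum. By \<open>cell_poincare\<close> averaging then loses at most the
  fraction \<open>(2 * pi * N / k)\<^sup>2\<close> of the energy, which \<open>N\<close> limits to
  one half.\<close>

lemma cell_energy_partial_sum: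
  assumes k: "k > 0" and N: "2 * (2 * pi * N)\<^sup>2 \<le> (real k)\<^sup>2"
  shows "(\<Sum>j\<in>{- int N..int N}. (cmod (fourier_coeff f j))\<^sup>2) / 2 \<le> cell_energy k (\<lambda>x. Re (partial_sum f N x))"
proof -
  let ?J = "{- int N..int N}"
  define p where "p x = Re (partial_sum f N x)" for x
  define T where "T x = (\<Sum>j\<in>?J. (2 * of_real pi * \<i> * of_int j * fourier_coeff f j) * trig j x)" for x
  define p' where "p' x = Re (T x)" for x
  define S where "S = (\<Sum>j\<in>?J. (cmod (fourier_coeff f j))\<^sup>2)"
  have dT: "(partial_sum f N has_vector_derivative T x) (at x)" for x
  proof -
    have "((\<lambda>x. \<Sum>j\<in>?J. fourier_coeff f j * trig j x) has_vector_derivative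
      (\<Sum>j\<in>?J. fourier_coeff f j * (2 * of_real pi * \<i> * of_int j * trig j x))) (at x)"
      by (intro has_vector_derivative_sum has_vector_derivative_mult_right trig_derivative)
    then show ?thesis by (simp add: T_def partial_sum_def[abs_def] mult_ac)
  qed
  have d: "(p has_vector_derivative p' x) (at x)" for x
    unfolding p_def p'_def
    by (rule bounded_linear.has_vector_derivative[OF bounded_linear_Re dT])
  have cT: "continuous_on UNIV T" unfolding T_def by (intro continuous_intros continuous_trig)
  have cp': "continuous_on A p'" for A
    unfolding p'_def by (intro continuous_intros continuous_on_subset[OF cT]) auto
  have sqp: "sq_int p" "p \<in> borel_measurable borel"
    using sq_int_partial_sum[of f N] unfolding p_def partial_sum_def by (simp, measurable)
  have mp': "p' \<in> borel_measurable borel" by (intro borel_measurable_continuous_onI cp')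
  have p'le: "(p' x)\<^sup>2 \<le> (cmod (T x))\<^sup>2" for x
    unfolding p'_def by (metis abs_Re_le_cmod abs_le_square_iff abs_norm_cancel)
  have Tint: "integrable unit_law (\<lambda>x. (cmod (T x))\<^sup>2)"
  proof -
    have "(\<lambda>x. (cmod (T x))\<^sup>2) = (\<lambda>x. (cmod (complex_of_real 0 - T x))\<^sup>2)" by simp
    moreover have tp: "trig_poly T"
    proof -
      have "trig_poly (\<lambda>x. \<Sum>j\<in>J. c j * trig j x)" if "finite J" for J c
        using that
      proof induction
        case empty
        show ?case using trig_poly_const[of 0] by simp
      next
        case (insert j J)
        then show ?case using trig_poly.add[OF trig_poly.monomial] by simp
      qed
      then show ?thesis unfolding T_def by simp
    qed
    obtain B where "\<And>x. cmod (T x) \<le> B" using trig_poly_bounded[OF tp] by blast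
    from sq_dist_integrable[OF sq_int_const[of 0] trig_poly_measurable[OF tp] this] show ?thesis by simp
  qed
  have intp': "integrable unit_law (\<lambda>x. (p' x)\<^sup>2)"
    by (rule Bochner_Integration.integrable_bound[OF Tint])
      (use p'le mp' in \<open>auto intro!: measurable_unit_law\<close>)
  have "(LINT x|unit_law. (p' x)\<^sup>2) \<le> (LINT x|unit_law. (cmod (T x))\<^sup>2)"
    by (rule integral_mono[OF intp' Tint p'le])
  also have "\<dots> = (\<Sum>j\<in>?J. (cmod (2 * of_real pi * \<i> * of_int j * fourier_coeff f j))\<^sup>2)"
    unfolding T_def by (rule trig_sum_norm) simp
  also have "\<dots> \<le> (\<Sum>j\<in>?J. (2 * pi * N)\<^sup>2 * (cmod (fourier_coeff f j))\<^sup>2)"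
  proof (intro sum_mono)
    fix j assume "j \<in> ?J"
    then have "\<bar>real_of_int j\<bar> \<le> real N" by auto
    then have "(2 * pi * \<bar>real_of_int j\<bar>)\<^sup>2 \<le> (2 * pi * N)\<^sup>2" by (intro power_mono mult_left_mono) auto
    then have "(2 * pi * \<bar>real_of_int j\<bar>)\<^sup>2 * (cmod (fourier_coeff f j))\<^sup>2 \<le> (2 * pi * N)\<^sup>2 * (cmod (fourier_coeff f j))\<^sup>2"
      by (intro mult_right_mono) auto
    then show "(cmod (2 * of_real pi * \<i> * of_int j * fourier_coeff f j))\<^sup>2 \<le> (2 * pi * N)\<^sup>2 * (cmod (fourier_coeff f j))\<^sup>2"
      by (simp add: norm_mult power_mult_distrib)
  qed
  also have "\<dots> = (2 * pi * N)\<^sup>2 * S" by (simp add: S_def sum_distrib_left)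
  finally have D: "(LINT x|unit_law. (p' x)\<^sup>2) \<le> (2 * pi * N)\<^sup>2 * S" .
  have cell: "(LINT x:{(real l - 1) / k<..<real l / k}|lborel. (p x)\<^sup>2)
      - (1 / k)\<^sup>2 * (LINT x:{(real l - 1) / k<..<real l / k}|lborel. (p' x)\<^sup>2)
      \<le> real k * (LINT x:{(real l - 1) / k<..<real l / k}|lborel. p x)\<^sup>2" if l: "l \<in> {1..k}" for l
    using cell_poincare[OF cell_interval(2)[OF k l] d cp', unfolded cell_interval(3)[OF k l]] by (simp add: mult.commute)
  have "S - (1 / k)\<^sup>2 * (LINT x|unit_law. (p' x)\<^sup>2)
    = (\<Sum>l\<in>{1..k}. (LINT x:{(real l - 1) / k<..<real l / k}|lborel. (p x)\<^sup>2)
      - (1 / k)\<^sup>2 * (LINT x:{(real l - 1) / k<..<real l / k}|lborel. (p' x)\<^sup>2))"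
  proof -
    have "(\<Sum>l\<in>{1..k}. LINT x:{(real l - 1) / k<..<real l / k}|lborel. (p x)\<^sup>2) = S"
      using cells_sum[OF k, of "\<lambda>x. (p x)\<^sup>2"] sqp partial_sum_norm[of f N]
      by (simp add: sq_int_def p_def S_def integral_unit_law flip: integrable_unit_law)
    moreover have "(\<Sum>l\<in>{1..k}. LINT x:{(real l - 1) / k<..<real l / k}|lborel. (p' x)\<^sup>2) = (LINT x|unit_law. (p' x)\<^sup>2)"
      using cells_sum[OF k, of "\<lambda>x. (p' x)\<^sup>2"] intp' by (simp add: integral_unit_law integrable_unit_law)
    ultimately show ?thesis by (simp only: sum_subtractf sum_distrib_left[symmetric])
  qed
  also have "\<dots> \<le> cell_energy k p"
    unfolding cell_energy_def sum_distrib_left by (intro sum_mono cell)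
  finally have *: "S - (1 / k)\<^sup>2 * (LINT x|unit_law. (p' x)\<^sup>2) \<le> cell_energy k p" .
  have S0: "S \<ge> 0" by (simp add: S_def sum_nonneg)
  have "(1 / k)\<^sup>2 * (LINT x|unit_law. (p' x)\<^sup>2) \<le> (1 / k)\<^sup>2 * ((2 * pi * N)\<^sup>2 * S)"
    by (intro mult_left_mono D) auto
  also have "\<dots> \<le> (1 / k)\<^sup>2 * ((real k)\<^sup>2 / 2 * S)"
    using N S0 by (intro mult_left_mono mult_right_mono) auto
  also have "\<dots> = S / 2" using k by (simp add: power_divide)
  finally show ?thesis using * by (simp add: S_def p_def[abs_def])
qed

text \<open>For \<open>p = f - r\<close> the energy of \<open>p\<close> is at most twice that of
  \<open>f\<close> plus twice the squared norm of \<open>r\<close>, while \<open>p\<close> keeps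
  half of its squared norm, the difference of those of \<open>f\<close> and \<open>r\<close>.
  Solving for the energy of \<open>f\<close> gives 1/4 and 5/4.\<close>

theorem cell_energy_lower:
  assumes k: "k > 0" and N: "2 * (2 * pi * N)\<^sup>2 \<le> (real k)\<^sup>2" and f: "sq_int f" "f \<in> borel_measurable borel"
  shows "(LINT x|unit_law. (f x)\<^sup>2) / 4 - 5 / 4 * (LINT x|unit_law. (fourier_remainder f N x)\<^sup>2) \<le> cell_energy k f"
proof -
  define p where "p x = Re (partial_sum f N x)" for x
  define r where "r = fourier_remainder f N"
  have mp: "p \<in> borel_measurable borel" unfolding p_def partial_sum_def by measurable
  have mr: "r \<in> borel_measurable borel"
    unfolding r_def fourier_remainder_eq[abs_def] using f(2) mp by (simp add: p_def[abs_def])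
  have sr: "sq_int r" unfolding r_def by (rule sq_int_remainder[OF f(1)])
  have "cell_energy k p \<le> 2 * cell_energy k f + 2 * cell_energy k r"
  proof -
    have "(LINT x:{(real l - 1) / k<..<real l / k}|lborel. p x)\<^sup>2
      \<le> 2 * (LINT x:{(real l - 1) / k<..<real l / k}|lborel. f x)\<^sup>2 + 2 * (LINT x:{(real l - 1) / k<..<real l / k}|lborel. r x)\<^sup>2"
      if l: "l \<in> {1..k}" for l
    proof -
      note c = cell_interval(1)[OF k l]
      have "(LINT x:{(real l - 1) / k<..<real l / k}|lborel. p x)
        = (LINT x:{(real l - 1) / k<..<real l / k}|lborel. f x - r x)"
        by (simp add: r_def fourier_remainder_eq p_def)
      also have "\<dots> = (LINT x:{(real l - 1) / k<..<real l / k}|lborel. f x) + - (LINT x:{(real l - 1) / k<..<real l / k}|lborel. r x)"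
        by (simp add: set_integral_diff(2)[OF sq_int_interval(1)[OF f c] sq_int_interval(1)[OF sr mr c]])
      finally show ?thesis
        using power2_add_le[of "LINT x:{(real l - 1) / k<..<real l / k}|lborel. f x" "- (LINT x:{(real l - 1) / k<..<real l / k}|lborel. r x)"]
        by simp
    qed
    then have "(\<Sum>l\<in>{1..k}. (LINT x:{(real l - 1) / k<..<real l / k}|lborel. p x)\<^sup>2)
      \<le> (\<Sum>l\<in>{1..k}. 2 * (LINT x:{(real l - 1) / k<..<real l / k}|lborel. f x)\<^sup>2 + 2 * (LINT x:{(real l - 1) / k<..<real l / k}|lborel. r x)\<^sup>2)"
      by (rule sum_mono)
    then have "cell_energy k p \<le> real k * (\<Sum>l\<in>{1..k}. 2 * (LINT x:{(real l - 1) / k<..<real l / k}|lborel. f x)\<^sup>2 + 2 * (LINT x:{(real l - 1) / k<..<real l / k}|lborel. r x)\<^sup>2)"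
      unfolding cell_energy_def by (intro mult_left_mono) auto
    also have "\<dots> = 2 * cell_energy k f + 2 * cell_energy k r"
      unfolding cell_energy_def sum.distrib sum_distrib_left[symmetric] by (simp add: distrib_left)
    finally show ?thesis .
  qed
  moreover have "cell_energy k r \<le> (LINT x|unit_law. (r x)\<^sup>2)" by (rule cell_energy_le[OF k sr mr])
  moreover have "((LINT x|unit_law. (f x)\<^sup>2) - (LINT x|unit_law. (r x)\<^sup>2)) / 2 \<le> cell_energy k p"
    using cell_energy_partial_sum[OF k N, of f] remainder_norm[OF f(1), of N] by (simp add: p_def[abs_def] r_def)
  ultimately show ?thesis unfolding r_def by argo
qed

section \<open>High frequencies are averaged out by the cells\<close>

text \<open>An integral with a parameter over a fixed domain, so that measurability in
  \<open>x\<close> is immediate and Fubini's theorem applies; on the unit interval it is the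
  integral of \<open>h\<close> from 0 to \<open>x\<close>.\<close>

definition primitive :: "(real \<Rightarrow> real) \<Rightarrow> real \<Rightarrow> real" where
  "primitive h x = (LINT y|unit_law. (if y < x then h y else 0))"

interpretation unit_pair: pair_sigma_finite unit_law unit_law ..

context
  fixes h :: "real \<Rightarrow> real"
  assumes h: "sq_int h" "h \<in> borel_measurable borel" and h0: "fourier_coeff h 0 = 0"
begin

lemma measurable_h [measurable]: "h \<in> borel_measurable borel" "h \<in> borel_measurable unit_law"
  using h measurable_unit_law by auto

lemma id_unit_law [measurable]: "(\<lambda>x. x) \<in> borel_measurable unit_law"
  by (rule measurable_unit_law) simp

lemma primitive_measurable: "primitive h \<in> borel_measurable borel"
proof -
  have "(\<lambda>x. LINT y|unit_law. (if y < x then h y else 0)) \<in> borel_measurable borel"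
    by measurable
  then show ?thesis by (simp add: primitive_def[abs_def])
qed

lemma primitive_eq:
  assumes "z \<le> 1"
  shows "primitive h z = (LINT y:{0<..<z}|lborel. h y)"
  unfolding primitive_def integral_unit_law set_lebesgue_integral_def
  by (rule Bochner_Integration.integral_cong) (use assms in \<open>auto simp: indicator_def\<close>)

lemma primitive_diff:
  assumes "0 \<le> y" "y \<le> z" "z \<le> 1"
  shows "primitive h z - primitive h y = (LINT x:{y<..<z}|lborel. h x)"
proof -
  have "set_integrable lborel {0<..<z} h" using assms by (intro sq_int_interval(1)[OF h]) auto
  from interval_split[OF assms(1,2) this] show ?thesis using assms by (simp add: primitive_eq)
qed

lemma integral_h_0: "(LINT x|unit_law. h x) = 0"
proof -
  have "fourier_coeff h 0 = (LINT x|unit_law. complex_of_real (h x))"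
    by (simp add: fourier_coeff_unit_law)
  then have "complex_of_real (LINT x|unit_law. h x) = 0" using h0 by simp
  then show ?thesis by simp
qed

text \<open>Mean zero makes the primitive periodic, so that \<open>cell_energy_upper\<close> can sum
  over cell end points cyclically.\<close>

lemma primitive_ends: "primitive h 0 = 0" "primitive h 1 = 0"
proof -
  show "primitive h 0 = 0" by (simp add: primitive_eq set_lebesgue_integral_def)
  show "primitive h 1 = 0" using integral_h_0 by (simp add: primitive_eq integral_unit_law)
qed

lemma sq_int_primitive: "sq_int (primitive h)"
proof (rule sq_int_bounded)
  show "primitive h \<in> borel_measurable unit_law" by (rule measurable_unit_law[OF primitive_measurable])
  fix x
  have "\<bar>primitive h x\<bar> \<le> (LINT y|unit_law. \<bar>if y < x then h y else 0\<bar>)"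
    unfolding primitive_def by (rule integral_abs_bound)
  also have "\<dots> \<le> (LINT y|unit_law. \<bar>h y\<bar>)"
  proof (rule integral_mono)
    show "integrable unit_law (\<lambda>y. \<bar>h y\<bar>)" using sq_int_integrable[OF h(1)] by simp
    show "integrable unit_law (\<lambda>y. \<bar>if y < x then h y else 0\<bar>)"
      by (rule Bochner_Integration.integrable_bound[OF sq_int_integrable[OF h(1)]]) auto
  qed auto
  finally show "\<bar>primitive h x\<bar> \<le> (LINT y|unit_law. \<bar>h y\<bar>)" .
qed

text \<open>Integration by parts in the form of Fubini's theorem, as \<open>h\<close> is merely
  square integrable. The boundary term is a multiple of the integral of \<open>h\<close>, which is
  0.\<close>

lemma fourier_coeff_primitive:
  assumes j: "j \<noteq> 0"
  shows "fourier_coeff (primitive h) j = fourier_coeff h j / (2 * of_real pi * \<i> * of_int j)"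
proof -
  let ?c = "2 * of_real pi * \<i> * of_int j :: complex"
  define K where "K x y = (if y < x then complex_of_real (h y) * cnj (trig j x) else 0)" for x y
  have [measurable]: "trig i \<in> borel_measurable unit_law" for i by (rule measurable_unit_law) simp
  have meas: "(\<lambda>(x, y). K x y) \<in> borel_measurable (unit_law \<Otimes>\<^sub>M unit_law)"
    unfolding K_def cnj_trig by measurable
  have hint: "integrable unit_law (\<lambda>y. complex_of_real (h y))" using sq_int_integrable[OF h(1)] by simp
  have int: "integrable (unit_law \<Otimes>\<^sub>M unit_law) (\<lambda>(x, y). K x y)"
  proof (rule Bochner_Integration.integrable_bound[OF _ meas])
    show "integrable (unit_law \<Otimes>\<^sub>M unit_law) (\<lambda>(x, y). h y)"
      by (rule unit_pair.Fubini_integrable) (use sq_int_integrable[OF h(1)] in auto)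
    show "AE z in unit_law \<Otimes>\<^sub>M unit_law. norm (case z of (x, y) \<Rightarrow> K x y) \<le> norm (case z of (x, y) \<Rightarrow> h y)"
      by (auto simp: K_def norm_mult)
  qed
  have "fourier_coeff (primitive h) j = (LINT x|unit_law. LINT y|unit_law. K x y)"
    unfolding fourier_coeff_unit_law
  proof (rule Bochner_Integration.integral_cong[OF refl])
    fix x
    have "complex_of_real (primitive h x) * cnj (trig j x) = (LINT y|unit_law. complex_of_real (if y < x then h y else 0)) * cnj (trig j x)"
      unfolding primitive_def by simp
    also have "\<dots> = (LINT y|unit_law. complex_of_real (if y < x then h y else 0) * cnj (trig j x))"
      by (rule integral_mult_left_zero[symmetric])
    also have "\<dots> = (LINT y|unit_law. K x y)"
      by (rule Bochner_Integration.integral_cong) (auto simp: K_def)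
    finally show "complex_of_real (primitive h x) * cnj (trig j x) = (LINT y|unit_law. K x y)" .
  qed
  also have "\<dots> = (LINT y|unit_law. LINT x|unit_law. K x y)"
    by (rule unit_pair.Fubini_integral[OF int, symmetric])
  also have "\<dots> = (LINT y|unit_law. (complex_of_real (h y) * cnj (trig j y) - complex_of_real (h y)) / ?c)"
  proof (rule Bochner_Integration.integral_cong[OF refl])
    fix y assume "y \<in> space unit_law"
    then have y: "0 < y" "y < 1" by auto
    have "(LINT x|unit_law. K x y) = (LINT x|unit_law. complex_of_real (h y) * (indicator {y<..<1} x *\<^sub>R trig (- j) x))"
      by (rule Bochner_Integration.integral_cong) (auto simp: K_def cnj_trig indicator_def)
    also have "\<dots> = complex_of_real (h y) * (LINT x|unit_law. indicator {y<..<1} x *\<^sub>R trig (- j) x)"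
      by (rule integral_mult_right_zero)
    also have "(LINT x|unit_law. indicator {y<..<1} x *\<^sub>R trig (- j) x) = (LINT x:{y<..<1}|lborel. trig (- j) x)"
      unfolding integral_unit_law set_lebesgue_integral_def
      by (rule Bochner_Integration.integral_cong) (use y in \<open>auto simp: indicator_def\<close>)
    also have "\<dots> = (1 - trig (- j) y) / (2 * of_real pi * \<i> * of_int (- j))"
      using y j by (subst trig_interval_integral) auto
    also have "complex_of_real (h y) * \<dots> = (complex_of_real (h y) * cnj (trig j y) - complex_of_real (h y)) / ?c"
      using j by (simp add: cnj_trig field_simps)
    finally show "(LINT x|unit_law. K x y) = (complex_of_real (h y) * cnj (trig j y) - complex_of_real (h y)) / ?c" .
  qed
  also have "\<dots> = (LINT y|unit_law. complex_of_real (h y) * cnj (trig j y) - complex_of_real (h y)) / ?c"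
    by (rule integral_divide_zero)
  also have "(LINT y|unit_law. complex_of_real (h y) * cnj (trig j y) - complex_of_real (h y))
    = fourier_coeff h j - complex_of_real (LINT y|unit_law. h y)"
    unfolding fourier_coeff_unit_law
    by (subst Bochner_Integration.integral_diff) (auto intro: sq_int_trig_integrable(1)[OF h(1)] hint)
  finally show ?thesis by (simp add: integral_h_0)
qed

text \<open>Removing the mean kills the coefficient at 0, where division by \<open>j\<close> fails,
  and changes no increment.\<close>

definition centred :: "real \<Rightarrow> real" where
  "centred x = primitive h x - (LINT y|unit_law. primitive h y)"

lemma centred_measurable: "centred \<in> borel_measurable borel"
  unfolding centred_def[abs_def] using primitive_measurable by measurable

lemma sq_int_centred: "sq_int centred"
  using sq_int_linear[OF sq_int_primitive sq_int_const[of "LINT y|unit_law. primitive h y"], of 1 "-1"]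
  by (simp add: centred_def[abs_def])

text \<open>Integration divides the coefficient at \<open>j\<close> by a number of modulus
  \<open>2 * pi * \<bar>j\<bar>\<close>, and only \<open>\<bar>j\<bar> > i\<close> occur; Parseval
  is applied on both sides.\<close>

lemma centred_norm:
  assumes i: "i > 0" and hi: "\<And>j. \<bar>j\<bar> \<le> int i \<Longrightarrow> fourier_coeff h j = 0"
  shows "(LINT x|unit_law. (centred x)\<^sup>2) \<le> (LINT x|unit_law. (h x)\<^sup>2) / (2 * pi * i)\<^sup>2"
proof -
  let ?m = "LINT y|unit_law. primitive h y"
  have const: "fourier_coeff (\<lambda>_. ?m) j = complex_of_real ?m * of_bool (j = 0)" for j
  proof -
    have "fourier_coeff (\<lambda>_. ?m) j = complex_of_real ?m * (LINT x|unit_law. trig 0 x * cnj (trig j x))"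
      by (simp add: fourier_coeff_unit_law)
    then show ?thesis by (simp only: trig_orthonormal eq_commute)
  qed
  have coeff: "fourier_coeff centred j = fourier_coeff (primitive h) j - complex_of_real ?m * of_bool (j = 0)" for j
    unfolding centred_def[abs_def] const[symmetric] by (rule fourier_coeff_diff[OF sq_int_primitive sq_int_const])
  have c0: "fourier_coeff centred 0 = 0"
  proof -
    have "fourier_coeff (primitive h) 0 = complex_of_real ?m" by (simp add: fourier_coeff_unit_law)
    then show ?thesis by (simp add: coeff)
  qed
  have le: "(cmod (fourier_coeff centred j))\<^sup>2 \<le> (cmod (fourier_coeff h j))\<^sup>2 * (1 / (2 * pi * i)\<^sup>2)" for j
  proof (cases "\<bar>j\<bar> \<le> int i")
    case True
    then have "fourier_coeff centred j = 0"
      using c0 hi by (cases "j = 0") (auto simp: coeff fourier_coeff_primitive)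
    then show ?thesis by simp
  next
    case False
    then have j: "j \<noteq> 0" "real i \<le> \<bar>real_of_int j\<bar>" by auto
    have "(cmod (fourier_coeff centred j))\<^sup>2 = (cmod (fourier_coeff h j))\<^sup>2 * (1 / (2 * pi * \<bar>real_of_int j\<bar>)\<^sup>2)"
      using j(1) by (simp add: coeff fourier_coeff_primitive norm_divide norm_mult power_divide)
    also have "\<dots> \<le> (cmod (fourier_coeff h j))\<^sup>2 * (1 / (2 * pi * i)\<^sup>2)"
      using j i by (intro mult_left_mono divide_left_mono power_mono) auto
    finally show ?thesis .
  qed
  have "(LINT x|unit_law. (centred x)\<^sup>2) \<le> (LINT x|unit_law. (h x)\<^sup>2) * (1 / (2 * pi * i)\<^sup>2)"
    by (rule has_sum_mono[OF Parseval[OF sq_int_centred] has_sum_cmult_left[OF Parseval[OF h(1)]]]) (rule le)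
  then show ?thesis by simp
qed

text \<open>The endpoint values of the primitive are compared with its averages over windows of length \<open>1 / i\<close>.\<close>

theorem cell_energy_upper:
  assumes k: "k > 0" and ki: "k \<le> i" and hi: "\<And>j. \<bar>j\<bar> \<le> int i \<Longrightarrow> fourier_coeff h j = 0"
  shows "cell_energy k h \<le> 16 * (real k / real i) * (LINT x|unit_law. (h x)\<^sup>2)"
proof -
  have i: "i > 0" using k ki by simp
  define w where "w = 1 / real i"
  \<comment> \<open>By \<open>k \<le> i\<close> the window to the left of an end point stays inside
    one cell.\<close>
  have w: "w > 0" "w \<le> 1 / k" using k ki i by (auto simp: w_def frac_le)
  define E where "E = (LINT x|unit_law. (h x)\<^sup>2)"
  have E0: "E \<ge> 0" by (simp add: E_def)
  let ?I = "\<lambda>l. {(real l - 1) / k<..<real l / k}"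
  define G where "G l = centred (real l / k)" for l :: nat
  have window: "w * (G l)\<^sup>2 \<le> 2 * (LINT x:?I l|lborel. (centred x)\<^sup>2) + 2 * w\<^sup>2 * (LINT x:?I l|lborel. (h x)\<^sup>2)"
    if l: "l \<in> {1..k}" for l
  proof -
    note c = cell_interval[OF k l]
    let ?z = "real l / k"
    have sub: "{?z - w<..<?z} \<subseteq> ?I l" using w c(3) by auto
    have z: "?z \<le> 1" "0 \<le> ?z - w"
    proof -
      show "?z \<le> 1" using l k by (auto simp: field_simps)
      have "0 \<le> (real l - 1) / k" using l by auto
      then show "0 \<le> ?z - w" using w c(3) by linarith
    qed
    define H where "H = (LINT x:?I l|lborel. (h x)\<^sup>2)"
    note hI = sq_int_interval[OF h c(1)] and cI = sq_int_interval[OF sq_int_centred centred_measurable c(1)]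
    \<comment> \<open>Cauchy-Schwarz controls the oscillation within the window; integrating this
      bound over the window replaces an end point value by a mean square.\<close>
    have pt: "(G l)\<^sup>2 \<le> 2 * (centred y)\<^sup>2 + 2 * w * H" if y: "y \<in> {?z - w<..<?z}" for y
    proof -
      have yz: "0 \<le> y" "y \<le> ?z" using y z by auto
      have "G l - centred y = (LINT x:{y<..<?z}|lborel. h x)"
        unfolding G_def centred_def using primitive_diff[OF yz z(1)] by simp
      then have "(G l - centred y)\<^sup>2 = (LINT x:{y<..<?z}|lborel. h x)\<^sup>2" by simp
      also have "\<dots> \<le> (?z - y) * (LINT x:{y<..<?z}|lborel. (h x)\<^sup>2)"
        using yz z by (intro interval_Cauchy_Schwarz sq_int_interval[OF h]) auto
      also have "\<dots> \<le> w * H"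
      proof (intro mult_mono)
        show "(LINT x:{y<..<?z}|lborel. (h x)\<^sup>2) \<le> H"
          unfolding H_def set_lebesgue_integral_def
        proof (rule integral_mono)
          have "{y<..<?z} \<subseteq> ?I l" using sub y by auto
          then show "indicat_real {y<..<?z} x *\<^sub>R (h x)\<^sup>2 \<le> indicat_real (?I l) x *\<^sub>R (h x)\<^sup>2" for x
            by (auto simp: indicator_def)
          have "{y<..<?z} \<subseteq> {0<..<1}" using yz z by auto
          from sq_int_interval(2)[OF h this]
          show "integrable lborel (\<lambda>x. indicat_real {y<..<?z} x *\<^sub>R (h x)\<^sup>2)" by (simp add: set_integrable_def)
          show "integrable lborel (\<lambda>x. indicat_real (?I l) x *\<^sub>R (h x)\<^sup>2)" using hI(2) by (simp add: set_integrable_def)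
        qed
      qed (use y w in \<open>auto simp: set_lebesgue_integral_def\<close>)
      finally have "(G l - centred y)\<^sup>2 \<le> w * H" .
      then show ?thesis using power2_add_le[of "centred y" "G l - centred y"] by simp
    qed
    have W: "set_integrable lborel {?z - w<..<?z} (\<lambda>y. (centred y)\<^sup>2)" "set_integrable lborel {?z - w<..<?z} (\<lambda>y. c)" for c :: real
      using w by (auto intro: set_integrable_subset[OF cI(2) _ sub]) (simp add: set_integrable_def)
    have "w * (G l)\<^sup>2 = (LINT y:{?z - w<..<?z}|lborel. (G l)\<^sup>2)" using w by (simp add: set_lebesgue_integral_def)
    also have "\<dots> \<le> (LINT y:{?z - w<..<?z}|lborel. 2 * (centred y)\<^sup>2 + 2 * w * H)"
      unfolding set_lebesgue_integral_def
    proof (rule integral_mono)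
      show "integrable lborel (\<lambda>x. indicat_real {?z - w<..<?z} x *\<^sub>R (G l)\<^sup>2)" using W(2) by (simp add: set_integrable_def)
      have "set_integrable lborel {?z - w<..<?z} (\<lambda>y. 2 * (centred y)\<^sup>2 + 2 * w * H)"
        by (intro set_integral_add(1) set_integrable_mult_right impI W)
      then show "integrable lborel (\<lambda>x. indicat_real {?z - w<..<?z} x *\<^sub>R (2 * (centred x)\<^sup>2 + 2 * w * H))"
        by (simp add: set_integrable_def)
      show "indicat_real {?z - w<..<?z} x *\<^sub>R (G l)\<^sup>2 \<le> indicat_real {?z - w<..<?z} x *\<^sub>R (2 * (centred x)\<^sup>2 + 2 * w * H)" for x
        using pt[of x] by (auto simp: indicator_def)
    qed
    also have "\<dots> = 2 * (LINT y:{?z - w<..<?z}|lborel. (centred y)\<^sup>2) + w * (2 * w * H)"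
    proof -
      have "(LINT y:{?z - w<..<?z}|lborel. 2 * (centred y)\<^sup>2 + 2 * w * H)
        = (LINT y:{?z - w<..<?z}|lborel. 2 * (centred y)\<^sup>2) + (LINT y:{?z - w<..<?z}|lborel. 2 * w * H)"
        by (intro set_integral_add(2) set_integrable_mult_right impI W)
      also have "(LINT y:{?z - w<..<?z}|lborel. 2 * w * H) = w * (2 * w * H)"
        using w by (simp add: set_lebesgue_integral_def)
      finally show ?thesis by simp
    qed
    also have "(LINT y:{?z - w<..<?z}|lborel. (centred y)\<^sup>2) \<le> (LINT x:?I l|lborel. (centred x)\<^sup>2)"
      unfolding set_lebesgue_integral_def
    proof (rule integral_mono)
      show "integrable lborel (\<lambda>x. indicat_real {?z - w<..<?z} x *\<^sub>R (centred x)\<^sup>2)" using W(1) by (simp add: set_integrable_def)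
      show "integrable lborel (\<lambda>x. indicat_real (?I l) x *\<^sub>R (centred x)\<^sup>2)" using cI(2) by (simp add: set_integrable_def)
      show "indicat_real {?z - w<..<?z} x *\<^sub>R (centred x)\<^sup>2 \<le> indicat_real (?I l) x *\<^sub>R (centred x)\<^sup>2" for x
        using sub by (auto simp: indicator_def)
    qed
    finally show ?thesis by (simp add: H_def power2_eq_square)
  qed
  have "w * (\<Sum>l\<in>{1..k}. (G l)\<^sup>2) \<le> (\<Sum>l\<in>{1..k}. 2 * (LINT x:?I l|lborel. (centred x)\<^sup>2) + 2 * w\<^sup>2 * (LINT x:?I l|lborel. (h x)\<^sup>2))"
    unfolding sum_distrib_left by (rule sum_mono[OF window])
  also have "\<dots> = 2 * (LINT x|unit_law. (centred x)\<^sup>2) + 2 * w\<^sup>2 * E"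
  proof -
    have "(\<Sum>l\<in>{1..k}. LINT x:?I l|lborel. (f x)\<^sup>2) = (LINT x|unit_law. (f x)\<^sup>2)" if "sq_int f" for f
      using cells_sum[OF k, of "\<lambda>x. (f x)\<^sup>2"] that by (simp add: sq_int_def integral_unit_law integrable_unit_law)
    then show ?thesis using sq_int_centred h(1)
      by (simp only: sum.distrib sum_distrib_left[symmetric] E_def)
  qed
  \<comment> \<open>The centred primitive contributes \<open>E * w\<^sup>2\<close> by
    \<open>centred_norm\<close>, the same order as the oscillation: this is why the window has
    length \<open>1 / i\<close>.\<close>
  also have "\<dots> \<le> 2 * (E * w\<^sup>2) + 2 * w\<^sup>2 * E"
  proof -
    have "(LINT x|unit_law. (centred x)\<^sup>2) \<le> E / (2 * pi * i)\<^sup>2" using centred_norm[OF i hi] by (simp add: E_def)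
    also have "\<dots> \<le> E / (real i)\<^sup>2"
    proof (rule divide_left_mono)
      have "1 * real i \<le> 2 * pi * real i" using pi_ge_two by (intro mult_right_mono) auto
      then show "(real i)\<^sup>2 \<le> (2 * pi * real i)\<^sup>2" by (intro power_mono) auto
    qed (use E0 i in auto)
    finally show ?thesis by (simp add: w_def power_divide)
  qed
  finally have "w * (\<Sum>l\<in>{1..k}. (G l)\<^sup>2) \<le> w * (4 * w * E)" by (simp add: power2_eq_square mult_ac)
  then have G: "(\<Sum>l\<in>{1..k}. (G l)\<^sup>2) \<le> 4 * w * E" using w by simp
  \<comment> \<open>Left and right end points of the cells have equal sums, because periodicity
    gives \<open>G 0 = G k\<close>.\<close>
  have shift: "(\<Sum>l\<in>{1..k}. (G (l - 1))\<^sup>2) = (\<Sum>l\<in>{1..k}. (G l)\<^sup>2)"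
  proof -
    have ends: "G 0 = G k" using k primitive_ends by (simp add: G_def centred_def)
    have "(\<Sum>l\<in>{1..m}. (G (l - 1))\<^sup>2) + (G m)\<^sup>2 = (\<Sum>l\<in>{1..m}. (G l)\<^sup>2) + (G 0)\<^sup>2" for m
      by (induction m) auto
    from this[of k] show ?thesis by (simp add: ends)
  qed
  have "cell_energy k h \<le> real k * (\<Sum>l\<in>{1..k}. 2 * (G l)\<^sup>2 + 2 * (G (l - 1))\<^sup>2)"
    unfolding cell_energy_def
  proof (intro mult_left_mono sum_mono)
    fix l assume l: "l \<in> {1..k}"
    note c = cell_interval[OF k l]
    have "(LINT x:?I l|lborel. h x) = primitive h (real l / k) - primitive h ((real l - 1) / k)"
      using l k c(2) by (intro primitive_diff[symmetric]) (auto simp: field_simps)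
    also have "\<dots> = G l + - G (l - 1)" using l by (simp add: G_def centred_def of_nat_diff)
    finally show "(LINT x:?I l|lborel. h x)\<^sup>2 \<le> 2 * (G l)\<^sup>2 + 2 * (G (l - 1))\<^sup>2"
      using power2_add_le[of "G l" "- G (l - 1)"] by simp
  qed simp
  also have "\<dots> = real k * (4 * (\<Sum>l\<in>{1..k}. (G l)\<^sup>2))"
    by (simp only: sum.distrib sum_distrib_left[symmetric] shift) simp
  also have "\<dots> \<le> real k * (4 * (4 * w * E))" by (intro mult_left_mono G) auto
  also have "\<dots> = 16 * (real k / real i) * E" by (simp add: w_def)
  finally show ?thesis unfolding E_def .
qed

end

section \<open>The maxiset theorem\<close>

lemma powr_at_top:
  fixes e :: real
  assumes e: "e > 0"
  shows "filterlim (\<lambda>x::real. x powr e) at_top at_top"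
  unfolding filterlim_at_top
proof
  fix Z :: real
  show "eventually (\<lambda>x. Z \<le> x powr e) at_top"
    using eventually_ge_at_top[of "(\<bar>Z\<bar> + 1) powr (1 / e)"]
  proof eventually_elim
    case (elim x)
    have "Z \<le> ((\<bar>Z\<bar> + 1) powr (1 / e)) powr e" using e by (simp add: powr_powr)
    also have "\<dots> \<le> x powr e" using e elim by (intro powr_mono2) auto
    finally show ?case .
  qed
qed

lemma density_model_zero: "density_model (\<lambda>_. 0)"
  by unfold_locales (auto simp: perturbs_to_density_def set_lebesgue_integral_def)

lemma cell_pmf_zero:
  assumes k: "k > 0"
  shows "density_model.cell_pmf (\<lambda>_. 0) k = uniform_pmf k"
proof -
  interpret density_model "\<lambda>_. 0" by (rule density_model_zero)
  show ?thesis
  proof (rule pmf_eqI)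
    fix l
    have "cell_prob k l = 1 / k" if "l \<in> {1..k}"
      using cell_prob_eq[OF k that] by (simp add: set_lebesgue_integral_def)
    then show "pmf (cell_pmf k) l = pmf (uniform_pmf k) l"
      using k by (auto simp: pmf_cell_pmf uniform_pmf_def indicator_def)
  qed
qed

text \<open>Inverse of the affine change in \<open>chi2_stat_eq_nstat\<close>.\<close>

definition standardized :: "nat \<Rightarrow> real \<Rightarrow> real" where
  "standardized k t = (t - (real k - 1)) / (sqrt 2 * sqrt k)"

lemma type_I_error_eq:
  assumes "n > 0" "k > 0"
  shows "type_I_error n {X. t < chi2_stat n k X} = rej_prob n k (uniform_pmf k) (standardized k t)"
proof -
  interpret density_model "\<lambda>_. 0" by (rule density_model_zero)
  show ?thesis
    using law_link[OF assms, of t] cell_pmf_zero[OF assms(2)] by (simp add: type_I_error_def standardized_def)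
qed

lemma type_II_error_eq:
  assumes "n > 0" "k > 0" "density_model g"
  shows "type_II_error n {X. t < chi2_stat n k X} g
    = 1 - rej_prob n k (density_model.cell_pmf g k) (standardized k t)"
proof -
  interpret density_model g by fact
  show ?thesis
    using compl_link[of n t k] law_link[OF assms(1,2), of t] unfolding type_II_error_def standardized_def by simp
qed

text \<open>The link between the probabilistic and the analytic half: the deviation of a cell
  probability from \<open>1 / k\<close> is the integral of \<open>g\<close> over the cell.\<close>

lemma noncentrality_cell_energy:
  assumes k: "k > 0" and g: "density_model g"
  shows "noncentrality k n (density_model.cell_pmf g k) = real n * cell_energy k g / sqrt k"
proof -
  interpret density_model g by fact
  have "sqrt k * S = real k * S / sqrt k" for S
    using k real_div_sqrt[of "real k"] by (simp add: field_simps)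
  then show ?thesis
    by (simp add: noncentrality_def sq_dev_cell_pmf[OF k] cell_energy_def mult.assoc)
qed

lemma L2_per_measurable: "f \<in> L2_per \<Longrightarrow> f \<in> borel_measurable borel"
  by (simp add: L2_per_def)

text \<open>The Besov condition is used at the real cut-off \<open>k / 20\<close>, which selects the
  same frequencies as the integer \<open>k div 20\<close>.\<close>

lemma besov_tail:
  assumes g: "g \<in> besov_ball s P0" and k: "k > 0"
  shows "(real k / 20) powr (2 * s) * (LINT x|unit_law. (fourier_remainder g (k div 20) x)\<^sup>2) \<le> P0"
proof -
  have sq: "sq_int g" using g by (auto simp: besov_ball_def intro: L2_per_sq_int)
  have "{j::int. real_of_int \<bar>j\<bar> > real k / 20} = {j::int. real_of_int \<bar>j\<bar> > real (k div 20)}"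
  proof (rule Collect_cong)
    fix j :: int
    have dv: "x < 20 * y \<longleftrightarrow> x div 20 < y" for x y :: int
      using mult_div_mod_eq[of 20 x] pos_mod_sign[of 20 x] pos_mod_bound[of 20 x] by linarith
    have "real k / 20 < real_of_int \<bar>j\<bar> \<longleftrightarrow> real_of_int (int k) < real_of_int (20 * \<bar>j\<bar>)"
      by (simp add: divide_less_eq mult.commute)
    also have "\<dots> \<longleftrightarrow> int k div 20 < \<bar>j\<bar>"
      unfolding of_int_less_iff by (rule dv)
    also have "\<dots> \<longleftrightarrow> real_of_int (int (k div 20)) < real_of_int \<bar>j\<bar>"
      unfolding of_int_less_iff by (simp add: zdiv_int)
    finally show "real k / 20 < real_of_int \<bar>j\<bar> \<longleftrightarrow> real (k div 20) < real_of_int \<bar>j\<bar>" by simp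
  qed
  then have R: "(LINT x|unit_law. (fourier_remainder g (k div 20) x)\<^sup>2)
    = (\<Sum>\<^sub>\<infinity>j\<in>{j::int. real_of_int \<bar>j\<bar> > real k / 20}. (cmod (fourier_coeff g j))\<^sup>2)"
    using Parseval_tail[OF sq, of "k div 20"] remainder_norm[OF sq, of "k div 20"] by simp
  have pos: "real k / 20 > 0" using k by simp
  have "\<forall>l>0. l powr (2 * s) * (\<Sum>\<^sub>\<infinity>j\<in>{j::int. real_of_int \<bar>j\<bar> > l}. (cmod (fourier_coeff g j))\<^sup>2) \<le> P0"
    using g by (simp add: besov_ball_def)
  then show ?thesis unfolding R using pos by blast
qed

text \<open>\<open>same_order\<close> with named constants: \<open>b\<close> bounds the number of
  cells from above, \<open>C\<close> from below.\<close>

locale cell_growth =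
  fixes r :: real and k :: "nat \<Rightarrow> nat" and b C :: real
  assumes r: "0 < r" "r < 1/2" and b: "b > 0" and C: "C > 0" and kpos: "\<And>n. n \<ge> 1 \<Longrightarrow> k n > 0"
    and lower: "\<And>n. n \<ge> 1 \<Longrightarrow> b * real (k n) \<le> real n powr (2 - 4 * r)"
    and upper: "\<And>n. n \<ge> 1 \<Longrightarrow> real n powr (2 - 4 * r) \<le> C * real (k n)"
begin

lemma sqrt_k_le:
  assumes n: "n \<ge> 1"
  shows "sqrt (k n) \<le> real n powr (1 - 2 * r) / sqrt b"
proof -
  have "real (k n) \<le> real n powr (2 - 4 * r) / b" using lower[OF n] b by (simp add: field_simps)
  then have "sqrt (k n) \<le> sqrt (real n powr (2 - 4 * r) / b)" by (rule real_sqrt_le_mono)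
  also have "\<dots> = real n powr (1 - 2 * r) / sqrt b"
  proof -
    have e: "(2 - 4 * r) * (1 / 2) = 1 - 2 * r" by simp
    have "sqrt (real n powr (2 - 4 * r)) = real n powr (1 - 2 * r)"
      by (simp only: powr_half_sqrt[symmetric] powr_ge_zero powr_powr e)
    then show ?thesis by (simp add: real_sqrt_divide)
  qed
  finally show ?thesis .
qed

text \<open>\<open>r < 1/2\<close> makes the number of cells tend to infinity; \<open>r > 0\<close>
  makes its ratio to the squared sample size, at most of order \<open>m powr (- (4 * r))\<close>,
  tend to 0.\<close>

lemma asymptotics_subsequence:
  assumes m: "\<And>j. m j \<ge> 1" and mlim: "filterlim m at_top sequentially"
  shows "asymptotics m (\<lambda>j. k (m j))"
proof
  show "m j > 0" for j using m[of j] by simp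
  show "k (m j) > 0" for j using kpos[OF m] .
  show "filterlim m at_top sequentially" by fact
  have m': "filterlim (\<lambda>j. real (m j)) at_top sequentially"
    using filterlim_compose[OF filterlim_real_sequentially mlim] by simp
  have "filterlim (\<lambda>j. real (m j) powr (2 - 4 * r)) at_top sequentially"
    using r by (intro filterlim_compose[OF powr_at_top m']) auto
  then have "filterlim (\<lambda>j. (1 / C) * real (m j) powr (2 - 4 * r)) at_top sequentially"
    using C by (intro filterlim_tendsto_pos_mult_at_top[OF tendsto_const]) auto
  then have "filterlim (\<lambda>j. real (k (m j))) at_top sequentially"
  proof (rule filterlim_at_top_mono)
    show "eventually (\<lambda>j. 1 / C * real (m j) powr (2 - 4 * r) \<le> real (k (m j))) sequentially"
      using upper[OF m] C by (intro always_eventually allI) (simp add: field_simps)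
  qed
  then show "filterlim (\<lambda>j. k (m j)) at_top sequentially"
  proof -
    assume lim: "filterlim (\<lambda>j. real (k (m j))) at_top sequentially"
    show ?thesis
      unfolding filterlim_at_top
    proof
      fix Z
      have "eventually (\<lambda>j. real Z \<le> real (k (m j))) sequentially"
        using lim unfolding filterlim_at_top by blast
      then show "eventually (\<lambda>j. Z \<le> k (m j)) sequentially" by simp
    qed
  qed
  have "(\<lambda>j. (1 / b) * real (m j) powr (- (4 * r))) \<longlonglongrightarrow> (1 / b) * 0"
    using r by (intro tendsto_intros tendsto_neg_powr m') auto
  then have lim: "(\<lambda>j. (1 / b) * real (m j) powr (- (4 * r))) \<longlonglongrightarrow> 0" by simp
  show "(\<lambda>j. real (k (m j)) / (real (m j))\<^sup>2) \<longlonglongrightarrow> 0"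
  proof (rule tendsto_sandwich[OF _ _ tendsto_const lim])
    show "eventually (\<lambda>j. real (k (m j)) / (real (m j))\<^sup>2 \<le> (1 / b) * real (m j) powr (- (4 * r))) sequentially"
    proof (intro always_eventually allI)
      fix j
      have mj: "real (m j) > 0" using m[of j] by simp
      have "real (m j) powr (2 - 4 * r) = real (m j) powr (- (4 * r)) * (real (m j))\<^sup>2"
        using mj by (simp add: powr_diff powr_minus powr_numeral field_simps)
      then have "b * real (k (m j)) \<le> real (m j) powr (- (4 * r)) * (real (m j))\<^sup>2" using lower[OF m, of j] by simp
      then show "real (k (m j)) / (real (m j))\<^sup>2 \<le> (1 / b) * real (m j) powr (- (4 * r))"
        using b mj by (simp add: field_simps)
    qed
  qed simp
qed

text \<open>The factor 20 in \<open>c0\<close> serves the Poincare inequality for frequencies up to \<open>k div 20\<close>, since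
  \<open>2 * (2 * pi / 20)\<^sup>2 < 1\<close>; the factor 10 makes the remaining frequencies contribute less than half.\<close>

lemma consistency_on_ball:
  fixes c P0 s c0 :: real
  assumes c: "c > 0" and P0: "P0 > 0" and s: "s = r / (2 - 4 * r)"
    and c0: "c0 = 20 * (10 * P0 / c\<^sup>2) powr (1 / (2 * s))"
    and kc0: "\<And>n. n \<ge> 1 \<Longrightarrow> real (k n) > c0 * real n powr (2 - 4 * r)"
    and n: "n \<ge> 1" and g: "g \<in> besov_ball s P0" "perturbs_to_density g" "L2_norm g \<ge> c * real n powr (- r)"
  shows "c\<^sup>2 * sqrt b / 8 \<le> noncentrality (k n) n (density_model.cell_pmf g (k n))"
proof -
  have gL: "g \<in> L2_per" using g(1) by (simp add: besov_ball_def)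
  note sq = L2_per_sq_int[OF gL] and meas = L2_per_measurable[OF gL]
  have dm: "density_model g" by unfold_locales (use g(2) meas in auto)
  have K: "k n > 0" by (rule kpos[OF n])
  have N0: "real n > 0" using n by simp
  have s0: "s > 0" using r by (simp add: s)
  define E where "E = (LINT x|unit_law. (g x)\<^sup>2)"
  define R where "R = (LINT x|unit_law. (fourier_remainder g (k n div 20) x)\<^sup>2)"
  define q where "q = real n powr (- (2 * r))"
  have q: "q > 0" using N0 by (simp add: q_def)
  have E: "c\<^sup>2 * q \<le> E"
  proof -
    have "(c * real n powr (- r))\<^sup>2 \<le> (sqrt E)\<^sup>2"
      using g(3) c by (intro power_mono) (auto simp: L2_norm_unit_law E_def)
    moreover have "(real n powr (- r))\<^sup>2 = q" using N0 by (simp add: q_def power2_eq_square flip: powr_add)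
    moreover have "(sqrt E)\<^sup>2 = E" by (simp add: E_def)
    ultimately show ?thesis by (simp add: power_mult_distrib)
  qed
  have R: "R \<le> c\<^sup>2 * q / 10"
  proof -
    \<comment> \<open>\<open>c0\<close> is chosen so that \<open>k / 20\<close> exceeds the base on
      the right; \<open>(2 - 4 * r) * (2 * s) = 2 * r\<close> turns the power of \<open>n\<close>
      into \<open>1 / q\<close>.\<close>
    have "10 * P0 / c\<^sup>2 * (1 / q) = ((10 * P0 / c\<^sup>2) powr (1 / (2 * s)) * real n powr (2 - 4 * r)) powr (2 * s)"
    proof -
      have e: "(2 - 4 * r) * (2 * s) = 2 * r" using r by (simp add: s field_simps)
      have "(real n powr (2 - 4 * r)) powr (2 * s) = 1 / q"
        unfolding powr_powr e by (simp add: q_def powr_minus_divide)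
      moreover have "((10 * P0 / c\<^sup>2) powr (1 / (2 * s))) powr (2 * s) = 10 * P0 / c\<^sup>2"
        using s0 P0 c by (simp add: powr_powr)
      ultimately show ?thesis by (simp add: powr_mult)
    qed
    also have "\<dots> \<le> (real (k n) / 20) powr (2 * s)"
      using kc0[OF n] s0 by (intro powr_mono2) (auto simp: c0)
    finally have "10 * P0 / c\<^sup>2 * (1 / q) * R \<le> (real (k n) / 20) powr (2 * s) * R"
      by (intro mult_right_mono) (auto simp: R_def)
    also have "\<dots> \<le> P0" unfolding R_def by (rule besov_tail[OF g(1) K])
    finally have "P0 * (10 * R) \<le> P0 * (c\<^sup>2 * q)" using c q by (simp add: field_simps)
    then show ?thesis using P0 by simp
  qed
  have "2 * (2 * pi * (k n div 20))\<^sup>2 \<le> (real (k n))\<^sup>2"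
  proof -
    have "real (k n div 20) \<le> real (k n) / 20" by linarith
    then have "2 * pi * (k n div 20) \<le> 2 * 4 * (real (k n) / 20)"
      using pi_less_4 by (intro mult_mono) auto
    then have "(2 * pi * (k n div 20))\<^sup>2 \<le> (2 * 4 * (real (k n) / 20))\<^sup>2" by (intro power_mono) auto
    also have "(2 * 4 * (real (k n) / 20))\<^sup>2 = (real (k n))\<^sup>2 * (4 / 25)" by (simp add: power2_eq_square)
    finally have "2 * (2 * pi * (k n div 20))\<^sup>2 \<le> (real (k n))\<^sup>2 * (8 / 25)" by simp
    also have "\<dots> \<le> (real (k n))\<^sup>2" by simp
    finally show ?thesis .
  qed
  from cell_energy_lower[OF K this sq meas] have "E / 4 - 5 / 4 * R \<le> cell_energy (k n) g"
    by (simp add: E_def R_def)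
  \<comment> \<open>The constant is \<open>1/4 - 5/4 * 1/10 = 1/8\<close>.\<close>
  then have ce: "c\<^sup>2 * q / 8 \<le> cell_energy (k n) g" using E R by argo
  have ce0: "0 \<le> cell_energy (k n) g" by (simp add: cell_energy_def sum_nonneg)
  \<comment> \<open>The powers of \<open>n\<close> cancel: \<open>n * q\<close> is
    \<open>n powr (1 - 2 * r)\<close>, the order of \<open>sqrt k\<close>.\<close>
  have "c\<^sup>2 * sqrt b / 8 = real n * (c\<^sup>2 * q / 8) / (real n powr (1 - 2 * r) / sqrt b)"
    using N0 b by (simp add: q_def powr_diff powr_minus field_simps)
  also have "\<dots> \<le> real n * cell_energy (k n) g / sqrt (k n)"
    using ce sqrt_k_le[OF n] K c q ce0 by (intro frac_le mult_left_mono mult_nonneg_nonneg) auto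
  finally show ?thesis unfolding noncentrality_cell_energy[OF K dm] .
qed

text \<open>The threshold is the upper normal quantile of \<open>\<alpha>\<close>, carried over to
  the chi-squared scale. By \<open>consistency_on_ball\<close> the noncentrality has a lower bound
  independent of \<open>n\<close>, so for large \<open>n\<close> the power exceeds
  \<open>\<alpha>\<close> by a fixed \<open>eta\<close> for all alternatives at once.\<close>

lemma maxiset_i:
  fixes c P0 s c0 \<alpha> :: real
  assumes c: "c > 0" and P0: "P0 > 0" and s: "s = r / (2 - 4 * r)"
    and c0: "c0 = 20 * (10 * P0 / c\<^sup>2) powr (1 / (2 * s))"
    and kc0: "\<And>n. n \<ge> 1 \<Longrightarrow> real (k n) > c0 * real n powr (2 - 4 * r)"
    and \<alpha>: "0 < \<alpha>" "\<alpha> < 1"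
  shows "\<exists>K :: nat \<Rightarrow> (nat \<Rightarrow> real) set.
          (\<forall>n. generated_by (K n) (chi2_stat n (k n))) \<and>
          (\<lambda>n. type_I_error n (K n)) \<longlonglongrightarrow> \<alpha> \<and>
          limsup (\<lambda>n. ereal (type_I_error n (K n)) +
            type_II_error_sup n (K n)
              {g \<in> besov_ball s P0. perturbs_to_density g \<and> L2_norm g \<ge> c * real n powr (- r)})
          < 1"
proof -
  \<comment> \<open>Sample sizes start at 1, hence the shift by \<open>Suc\<close>.\<close>
  interpret A: asymptotics Suc "\<lambda>j. k (Suc j)"
    by (rule asymptotics_subsequence) (auto intro: filterlim_Suc)
  obtain z where z: "gauss_tail z = \<alpha>" using gauss_tail_onto[OF \<alpha>] .
  define t where "t n = (real (k n) - 1) + sqrt 2 * sqrt (k n) * z" for n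
  define K where "K n = {X. t n < chi2_stat n (k n) X}" for n
  let ?V = "\<lambda>n. {g \<in> besov_ball s P0. perturbs_to_density g \<and> L2_norm g \<ge> c * real n powr (- r)}"
  have st: "standardized (k n) (t n) = z" if "n \<ge> 1" for n
    using kpos[OF that] by (simp add: standardized_def t_def)
  have I: "type_I_error n (K n) = rej_prob n (k n) (uniform_pmf (k n)) z" if "n \<ge> 1" for n
    using type_I_error_eq[of n "k n" "t n"] kpos[OF that] that by (simp add: K_def st)
  have "(\<lambda>j. type_I_error (Suc j) (K (Suc j))) \<longlonglongrightarrow> \<alpha>"
    using A.rej_null[of z] by (simp add: I z)
  then have limI: "(\<lambda>n. type_I_error n (K n)) \<longlonglongrightarrow> \<alpha>" by (rule LIMSEQ_imp_Suc)
  define d where "d = c\<^sup>2 * sqrt b / 8"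
  have d: "d > 0" using c b by (simp add: d_def)
  obtain eta where eta: "eta > 0" and ev: "eventually (\<lambda>j. \<forall>p. set_pmf p \<subseteq> {1..k (Suc j)} \<longrightarrow>
      d \<le> noncentrality (k (Suc j)) (Suc j) p \<longrightarrow> gauss_tail z + eta \<le> rej_prob (Suc j) (k (Suc j)) p z) sequentially"
    using A.rej_lower_limit[OF d] by blast
  have ev': "eventually (\<lambda>n. \<forall>p. set_pmf p \<subseteq> {1..k n} \<longrightarrow>
      d \<le> noncentrality (k n) n p \<longrightarrow> \<alpha> + eta \<le> rej_prob n (k n) p z) sequentially"
    using ev unfolding z by (subst (asm) eventually_sequentially_Suc)
  \<comment> \<open>Half of \<open>eta\<close> pays for the convergence of the level; the other half
    is the gap below 1.\<close>
  have "eventually (\<lambda>n. type_I_error n (K n) < \<alpha> + eta / 2) sequentially"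
    by (rule order_tendstoD(2)[OF limI]) (use eta in simp)
  with ev' eventually_ge_at_top[of 1]
  have "eventually (\<lambda>n. ereal (type_I_error n (K n)) + type_II_error_sup n (K n) (?V n) \<le> ereal (1 - eta / 2)) sequentially"
  proof eventually_elim
    case (elim n)
    have "type_II_error_sup n (K n) (?V n) \<le> ereal (1 - (\<alpha> + eta))"
      unfolding type_II_error_sup_def
    proof (rule SUP_least)
      fix g assume "g \<in> ?V n"
      then have g: "g \<in> besov_ball s P0" "perturbs_to_density g" "L2_norm g \<ge> c * real n powr (- r)" by auto
      have "g \<in> L2_per" using g(1) by (simp add: besov_ball_def)
      then have dm: "density_model g" by unfold_locales (use g(2) in \<open>auto intro: L2_per_measurable\<close>)
      have nc: "d \<le> noncentrality (k n) n (density_model.cell_pmf g (k n))"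
        unfolding d_def by (rule consistency_on_ball[OF c P0 s c0 kc0 _ g]) (use elim in auto)
      have "\<alpha> + eta \<le> rej_prob n (k n) (density_model.cell_pmf g (k n)) z"
        using elim(1) nc density_model.set_cell_pmf[OF dm kpos[OF elim(2)]] by blast
      then show "ereal (type_II_error n (K n) g) \<le> ereal (1 - (\<alpha> + eta))"
        using type_II_error_eq[OF _ kpos[OF elim(2)] dm, of n "t n"] elim(2) by (simp add: K_def st)
    qed
    then have "ereal (type_I_error n (K n)) + type_II_error_sup n (K n) (?V n)
      \<le> ereal (\<alpha> + eta / 2) + ereal (1 - (\<alpha> + eta))"
      using elim(3) by (intro add_mono) auto
    then show ?case by simp
  qed
  then have "limsup (\<lambda>n. ereal (type_I_error n (K n)) + type_II_error_sup n (K n) (?V n)) \<le> ereal (1 - eta / 2)"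
    by (rule Limsup_bounded)
  also have "\<dots> < 1" using eta by (simp add: one_ereal_def)
  finally have "limsup (\<lambda>n. ereal (type_I_error n (K n)) + type_II_error_sup n (K n) (?V n)) < 1" .
  moreover have "generated_by (K n) (chi2_stat n (k n))" for n
    by (auto simp: generated_by_def K_def)
  ultimately show ?thesis using limI by blast
qed

text \<open>Outside the Besov space the defining bound fails at some cut-off \<open>l n\<close> by
  any prescribed margin. There the remainder is so large that the sample size matched to its norm
  has at most of order \<open>i n / Y n\<close> cells, with \<open>Y n\<close> tending to infinity,
  and \<open>cell_energy_upper\<close> sends the noncentrality to 0.\<close>

lemma maxiset_ii:
  fixes s :: real and f
  assumes s: "s = r / (2 - 4 * r)"
    and f: "f \<in> L2_per" "f \<notin> besov_space s" "(LINT x:{0<..<1}|lborel. f x) = 0"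
  shows "\<exists>(i :: nat \<Rightarrow> nat) (m :: nat \<Rightarrow> nat) c1 C1.
          (\<forall>n. 0 < i n \<and> 0 < m n) \<and> filterlim i at_top sequentially \<and> 0 < c1 \<and> c1 < C1 \<and>
          (\<forall>n. c1 * real (m n) powr (- r) < L2_norm (fourier_remainder f (i n)) \<and>
               L2_norm (fourier_remainder f (i n)) < C1 * real (m n) powr (- r)) \<and>
          ((\<forall>n. \<forall>x\<in>{0..1}. 0 \<le> 1 + fourier_remainder f (i n) x) \<longrightarrow>
             (\<forall>\<alpha> (K :: nat \<Rightarrow> (nat \<Rightarrow> real) set).
                0 < \<alpha> \<and> \<alpha> < 1 \<longrightarrow>
                (\<forall>n. generated_by (K n) (chi2_stat (m n) (k (m n)))) \<longrightarrow>
                (\<lambda>n. type_I_error (m n) (K n)) \<longlonglongrightarrow> \<alpha> \<longrightarrow>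
                liminf (\<lambda>n. ereal (type_I_error (m n) (K n) +
                  type_II_error (m n) (K n) (fourier_remainder f (i n)))) \<ge> 1))"
proof -
  have s0: "s > 0" using r by (simp add: s)
  note sq = L2_per_sq_int[OF f(1)] and meas = L2_per_measurable[OF f(1)]
  define E where "E = (LINT x|unit_law. (f x)\<^sup>2)"
  have E0: "E \<ge> 0" by (simp add: E_def)
  define a where "a j = (cmod (fourier_coeff f j))\<^sup>2" for j
  define T where "T N = E - (\<Sum>j\<in>{- int N..int N}. a j)" for N
  have T_rem: "(LINT x|unit_law. (fourier_remainder f N x)\<^sup>2) = T N" for N
    using remainder_norm[OF sq] by (simp add: T_def E_def a_def)
  have T_le: "T N \<le> E" for N unfolding T_def by (simp add: a_def sum_nonneg)
  have tail: "(\<Sum>\<^sub>\<infinity>j\<in>{j::int. real_of_int \<bar>j\<bar> > l}. a j) = T (nat \<lfloor>l\<rfloor>)" if "l > 0" for l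
  proof -
    have "{j::int. real_of_int \<bar>j\<bar> > l} = {j::int. real_of_int \<bar>j\<bar> > real (nat \<lfloor>l\<rfloor>)}"
    proof (rule Collect_cong)
      fix j :: int
      have "l < real_of_int \<bar>j\<bar> \<longleftrightarrow> \<lfloor>l\<rfloor> < \<bar>j\<bar>" by (simp add: floor_less_iff)
      then show "l < real_of_int \<bar>j\<bar> \<longleftrightarrow> real (nat \<lfloor>l\<rfloor>) < real_of_int \<bar>j\<bar>" using that by simp linarith
    qed
    then show ?thesis using Parseval_tail[OF sq, of "nat \<lfloor>l\<rfloor>"] by (simp add: T_def E_def a_def)
  qed
  have c0: "fourier_coeff f 0 = 0"
  proof -
    have "fourier_coeff f 0 = complex_of_real (LINT x|unit_law. f x)" by (simp add: fourier_coeff_unit_law)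
    then show ?thesis using f(3) by (simp add: integral_unit_law)
  qed
  \<comment> \<open>The margin exceeds \<open>E\<close>, which excludes \<open>l < 1\<close>, and
    grows with \<open>n\<close>, which forces the cut-offs to infinity.\<close>
  have "\<exists>l>0. real n + E + 1 < l powr (2 * s) * T (nat \<lfloor>l\<rfloor>)" for n
  proof -
    have "real n + E + 1 > 0" using E0 by simp
    then have "f \<notin> besov_ball s (real n + E + 1)" using f(2) by (auto simp: besov_space_def)
    then have "\<exists>l>0. \<not> l powr (2 * s) * (\<Sum>\<^sub>\<infinity>j\<in>{j::int. real_of_int \<bar>j\<bar> > l}. a j) \<le> real n + E + 1"
      using f(1) c0 by (auto simp: besov_ball_def a_def)
    then show ?thesis using tail by (metis not_le)
  qed
  then obtain l where l: "\<And>n. l n > 0" "\<And>n. real n + E + 1 < l n powr (2 * s) * T (nat \<lfloor>l n\<rfloor>)" by metis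
  define i where "i n = nat \<lfloor>l n\<rfloor>" for n
  note lT = l(2)[folded i_def]
  have l1: "l n \<ge> 1" for n
  proof (rule ccontr)
    assume "\<not> l n \<ge> 1"
    then have "l n powr (2 * s) \<le> 1" using l(1)[of n] s0 by (intro powr_le1) auto
    then have "l n powr (2 * s) * T (i n) \<le> 1 * E"
    proof (cases "T (i n) \<ge> 0")
      case True
      with \<open>l n powr (2 * s) \<le> 1\<close> show ?thesis using T_le by (intro mult_mono) auto
    next
      case False
      then show ?thesis using E0 mult_nonneg_nonpos[of "l n powr (2 * s)" "T (i n)"] by simp
    qed
    then show False using lT[of n] by simp
  qed
  have i1: "i n \<ge> 1" for n using l1[of n] by (simp add: i_def le_nat_iff le_floor_iff)
  have li: "l n < real (i n) + 1" for n using l(1)[of n] by (simp add: i_def; linarith)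
  have Tpos: "T (i n) > 0" for n
  proof -
    have "0 < l n powr (2 * s) * T (i n)" using lT[of n] E0 by linarith
    then show ?thesis by (simp add: zero_less_mult_iff)
  qed
  have ilim: "filterlim i at_top sequentially"
    unfolding filterlim_at_top
  proof
    fix M
    show "eventually (\<lambda>n. M \<le> i n) sequentially"
      using eventually_ge_at_top[of "nat \<lceil>real M powr (2 * s) * E\<rceil>"]
    proof eventually_elim
      case (elim n)
      show "M \<le> i n"
      proof (rule ccontr)
        assume "\<not> M \<le> i n"
        then have "l n \<le> real M" using li[of n] by linarith
        then have "l n powr (2 * s) \<le> real M powr (2 * s)" using l(1)[of n] s0 by (intro powr_mono2) auto
        then have "l n powr (2 * s) * T (i n) \<le> real M powr (2 * s) * E"
          using T_le Tpos[of n] by (intro mult_mono) auto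
        moreover have "real M powr (2 * s) * E \<le> real n" using elim by linarith
        ultimately show False using lT[of n] E0 by linarith
      qed
    qed
  qed
  \<comment> \<open>Symmetric intervals eventually contain every finite set of integers, so the
    unordered sum in \<open>Parseval\<close> is the limit of the partial sums.\<close>
  have Tlim: "(\<lambda>n. T (i n)) \<longlonglongrightarrow> 0"
  proof -
    have "filterlim (\<lambda>N. {- int N..int N}) (finite_subsets_at_top UNIV) sequentially"
      unfolding filterlim_finite_subsets_at_top
    proof (intro allI impI)
      fix X :: "int set" assume X: "finite X \<and> X \<subseteq> UNIV"
      obtain B where B: "\<And>x. x \<in> X \<Longrightarrow> \<bar>x\<bar> \<le> B"
        using X finite_imageI[of X abs] by (metis Max_ge imageI)
      show "eventually (\<lambda>N. finite {- int N..int N} \<and> X \<subseteq> {- int N..int N} \<and> {- int N..int N} \<subseteq> UNIV) sequentially"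
        using eventually_ge_at_top[of "nat B"]
      proof eventually_elim
        case (elim N)
        show ?case using B elim by (force simp: abs_le_iff)
      qed
    qed
    from filterlim_compose[OF Parseval[OF sq, unfolded has_sum_def] this]
    have "(\<lambda>N. \<Sum>j\<in>{- int N..int N}. a j) \<longlonglongrightarrow> E" by (simp add: a_def E_def)
    from tendsto_diff[OF tendsto_const this, of E] have "T \<longlonglongrightarrow> 0" by (simp add: T_def[abs_def])
    from filterlim_compose[OF this ilim] show ?thesis .
  qed
  define v where "v n = L2_norm (fourier_remainder f (i n))" for n
  have v: "v n = sqrt (T (i n))" for n by (simp add: v_def L2_norm_unit_law T_rem)
  have vpos: "v n > 0" for n using Tpos by (simp add: v)
  have vlim: "v \<longlonglongrightarrow> 0" using tendsto_real_sqrt[OF Tlim] by (simp add: v[abs_def])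
  \<comment> \<open>The real sample size that satisfies \<open>v n = x n powr (- r)\<close> exactly;
    \<open>m n\<close> rounds it up.\<close>
  define x where "x n = v n powr (- (1 / r))" for n
  have xpos: "x n > 0" for n using vpos[of n] by (simp add: x_def)
  have vx: "v n = x n powr (- r)" for n using r vpos[of n] by (simp add: x_def powr_powr)
  define m where "m n = nat \<lceil>x n\<rceil>" for n
  have xm: "x n \<le> real (m n)" for n unfolding m_def by (rule real_nat_ceiling_ge)
  have m1: "m n \<ge> 1" for n using xpos[of n] by (simp add: m_def Suc_le_eq)
  \<comment> \<open>\<open>v n\<close> is bounded, so \<open>x n\<close> is bounded away from 0 and
    rounding up costs at most the factor \<open>1 + 1 / B\<close>.\<close>
  define B where "B = (sqrt E + 1) powr (- (1 / r))"
  have "sqrt E + 1 > 0" using real_sqrt_ge_zero[OF E0] by linarith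
  then have B: "B > 0" by (simp add: B_def)
  have Bx: "B \<le> x n" for n
  proof -
    have "v n \<le> sqrt E + 1" using real_sqrt_le_mono[OF T_le[of "i n"]] unfolding v by linarith
    then show ?thesis unfolding x_def B_def using vpos[of n] r by (intro powr_mono2') auto
  qed
  have mx: "real (m n) \<le> (1 + 1 / B) * x n" for n
  proof -
    have "real (m n) \<le> x n + 1" using xpos[of n] by (simp add: m_def)
    moreover have "1 \<le> x n / B" using Bx[of n] B by simp
    ultimately show ?thesis by (simp add: distrib_right)
  qed
  \<comment> \<open>The added 1, like the constant 1/2 in the lower bound, makes the inequality
    strict.\<close>
  define C1 where "C1 = (1 + 1 / B) powr r + 1"
  have C1: "1/2 < C1" using powr_ge_zero[of "1 + 1 / B" r] unfolding C1_def by linarith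
  have bd1: "1/2 * real (m n) powr (- r) < v n" for n
  proof -
    have "real (m n) powr (- r) \<le> v n" unfolding vx using xm xpos r by (intro powr_mono2') auto
    moreover have "real (m n) powr (- r) > 0" using m1[of n] by simp
    ultimately show ?thesis by linarith
  qed
  have bd2: "v n < C1 * real (m n) powr (- r)" for n
  proof -
    have mp: "real (m n) powr (- r) > 0" using m1[of n] by simp
    have "real (m n) / (1 + 1 / B) \<le> x n" using mx[of n] B by (simp add: divide_le_eq mult.commute add_pos_pos)
    then have "v n \<le> (real (m n) / (1 + 1 / B)) powr (- r)"
      unfolding vx using m1[of n] B r by (intro powr_mono2') (auto simp: add_pos_pos)
    also have "\<dots> = (1 + 1 / B) powr r * real (m n) powr (- r)"
    proof -
      have "(x / y) powr (- r) = y powr r * x powr (- r)" if "x > 0" "y > 0" for x y :: real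
        using that by (simp add: powr_divide powr_minus_divide)
      then show ?thesis using m1[of n] B by (simp add: add_pos_pos)
    qed
    also have "\<dots> < C1 * real (m n) powr (- r)" using mp by (simp add: C1_def distrib_right)
    finally show ?thesis .
  qed
  have mlim: "filterlim m at_top sequentially"
    unfolding filterlim_at_top
  proof
    fix M :: nat
    have "eventually (\<lambda>n. v n < (real M + 1) powr (- r)) sequentially"
      by (rule order_tendstoD(2)[OF vlim]) simp
    then show "eventually (\<lambda>n. M \<le> m n) sequentially"
    proof eventually_elim
      case (elim n)
      have "((real M + 1) powr (- r)) powr (- (1 / r)) \<le> x n"
        unfolding x_def using elim vpos[of n] r by (intro powr_mono2') auto
      then have "real M + 1 \<le> x n" using r by (simp add: powr_powr)
      then show ?case using xm[of n] by linarith
    qed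
  qed
  interpret A: asymptotics m "\<lambda>j. k (m j)"
    by (rule asymptotics_subsequence[OF m1 mlim])
  \<comment> \<open>The factor, up to 2, by which \<open>i n\<close> exceeds the order of the number
    of cells at sample size \<open>m n\<close>.\<close>
  define Y where "Y n = ((real n + E + 1) / C1\<^sup>2) powr (1 / (2 * s))" for n
  have C1p: "C1 > 0" using C1 by simp
  have Ypos: "Y n > 0" for n
  proof -
    have "real n + E + 1 > 0" using E0 by linarith
    then show ?thesis using C1p by (simp add: Y_def)
  qed
  have Ylim: "filterlim Y at_top sequentially"
  proof -
    have "filterlim (\<lambda>n. real n + (E + 1)) at_top sequentially"
      using filterlim_tendsto_add_at_top[OF tendsto_const filterlim_real_sequentially, of "E + 1"]
      by (simp add: add.commute)
    then have "filterlim (\<lambda>n. (1 / C1\<^sup>2) * (real n + (E + 1))) at_top sequentially"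
      using C1p by (intro filterlim_tendsto_pos_mult_at_top[OF tendsto_const]) auto
    then have "filterlim (\<lambda>n. (real n + E + 1) / C1\<^sup>2) at_top sequentially" by (simp add: add.assoc)
    then show ?thesis unfolding Y_def[abs_def] using s0 by (intro filterlim_compose[OF powr_at_top]) auto
  qed
  \<comment> \<open>The bound of \<open>T (i n)\<close> by
    \<open>(C1 * m n powr (- r))\<^sup>2\<close> is inserted into the violated Besov inequality; the
    root \<open>1 / (2 * s)\<close> produces the exponent
    \<open>2 * r / (2 * s) = 2 - 4 * r\<close>.\<close>
  have key: "Y n * real (m n) powr (2 - 4 * r) \<le> 2 * real (i n)" for n
  proof -
    have mp: "real (m n) > 0" using m1[of n] by simp
    have "T (i n) = (v n)\<^sup>2" using Tpos[of n] by (simp add: v)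
    also have "\<dots> \<le> (C1 * real (m n) powr (- r))\<^sup>2" using bd2[of n] vpos[of n] by (intro power_mono) auto
    also have "\<dots> = C1\<^sup>2 / real (m n) powr (2 * r)"
      using mp by (simp add: power_mult_distrib power2_eq_square powr_minus field_simps flip: powr_add)
    finally have T: "T (i n) \<le> C1\<^sup>2 / real (m n) powr (2 * r)" .
    have "l n \<le> 2 * real (i n)" using li[of n] i1[of n] by linarith
    then have "l n powr (2 * s) \<le> (2 * real (i n)) powr (2 * s)" using l(1)[of n] s0 by (intro powr_mono2) auto
    then have "l n powr (2 * s) * T (i n) \<le> (2 * real (i n)) powr (2 * s) * (C1\<^sup>2 / real (m n) powr (2 * r))"
      using T Tpos[of n] by (intro mult_mono) auto
    then have "real n + E + 1 \<le> (2 * real (i n)) powr (2 * s) * (C1\<^sup>2 / real (m n) powr (2 * r))" using lT[of n] by linarith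
    then have le: "(real n + E + 1) / C1\<^sup>2 * real (m n) powr (2 * r) \<le> (2 * real (i n)) powr (2 * s)"
      using C1p mp by (simp add: field_simps)
    have "((real n + E + 1) / C1\<^sup>2 * real (m n) powr (2 * r)) powr (1 / (2 * s)) \<le> ((2 * real (i n)) powr (2 * s)) powr (1 / (2 * s))"
      using le s0 E0 by (intro powr_mono2) auto
    also have "\<dots> = 2 * real (i n)" using s0 by (simp add: powr_powr)
    also have "((real n + E + 1) / C1\<^sup>2 * real (m n) powr (2 * r)) powr (1 / (2 * s)) = Y n * real (m n) powr (2 - 4 * r)"
    proof -
      have e: "2 * r * (1 / (2 * s)) = 2 - 4 * r" using r by (simp add: s field_simps)
      have "(A * M powr (2 * r)) powr w = A powr w * M powr (2 * r * w)" if "A \<ge> 0" for A M w :: real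
        using that by (simp add: powr_mult powr_powr)
      from this[of "(real n + E + 1) / C1\<^sup>2" "real (m n)" "1 / (2 * s)"]
      show ?thesis unfolding Y_def e using E0 by simp
    qed
    finally show ?thesis .
  qed
  have main: "liminf (\<lambda>n. ereal (type_I_error (m n) (K n) + type_II_error (m n) (K n) (fourier_remainder f (i n)))) \<ge> 1"
    if nonneg: "\<forall>n. \<forall>x\<in>{0..1}. 0 \<le> 1 + fourier_remainder f (i n) x" and \<alpha>: "0 < \<alpha>" "\<alpha> < 1"
      and gen: "\<forall>n. generated_by (K n) (chi2_stat (m n) (k (m n)))"
      and lim: "(\<lambda>n. type_I_error (m n) (K n)) \<longlonglongrightarrow> \<alpha>" for \<alpha> and K :: "nat \<Rightarrow> (nat \<Rightarrow> real) set"
  proof -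
    define h where "h n = fourier_remainder f (i n)" for n
    have hm: "h n \<in> borel_measurable borel" for n
      unfolding h_def fourier_remainder_def[abs_def] using meas by measurable
    have hs: "sq_int (h n)" for n unfolding h_def by (rule sq_int_remainder[OF sq])
    have hc: "fourier_coeff (h n) j = 0" if "\<bar>j\<bar> \<le> int (i n)" for n j
      using that unfolding h_def by (simp add: fourier_coeff_remainder[OF sq])
    \<comment> \<open>The coefficient at 0 is among those removed, so the remainder integrates to 0
      and adding it to 1 keeps total mass 1.\<close>
    have dm: "density_model (h n)" for n
    proof
      show "h n \<in> borel_measurable borel" by (rule hm)
      have "integrable unit_law (h n)" by (rule sq_int_integrable[OF hs])
      then have "(LINT x|unit_law. 1 + h n x) = 1 + (LINT x|unit_law. h n x)"
        using unit_law.prob_space by simp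
      moreover have "(LINT x|unit_law. h n x) = 0" by (rule integral_h_0[OF hs hm hc]) simp
      ultimately have "(LINT x:{0<..<1}|lborel. 1 + h n x) = 1" by (simp add: integral_unit_law)
      then show "perturbs_to_density (h n)"
        using nonneg by (auto simp: perturbs_to_density_def h_def)
    qed
    obtain t where t: "\<And>n. K n = {X. t n < chi2_stat (m n) (k (m n)) X}"
      using gen unfolding generated_by_def by metis
    define p where "p n = density_model.cell_pmf (h n) (k (m n))" for n
    have p: "set_pmf (p n) \<subseteq> {1..k (m n)}" for n
      unfolding p_def by (rule density_model.set_cell_pmf[OF dm A.kpos])
    have I: "type_I_error (m n) (K n) = rej_prob (m n) (k (m n)) (uniform_pmf (k (m n))) (standardized (k (m n)) (t n))" for n
      unfolding t by (rule type_I_error_eq[OF A.npos A.kpos])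
    have II: "type_II_error (m n) (K n) (h n) = 1 - rej_prob (m n) (k (m n)) (p n) (standardized (k (m n)) (t n))" for n
      unfolding t p_def by (rule type_II_error_eq[OF A.npos A.kpos dm])
    have nc: "(\<lambda>n. noncentrality (k (m n)) (m n) (p n)) \<longlonglongrightarrow> 0"
    proof (rule tendsto_sandwich)
      show "eventually (\<lambda>n. 0 \<le> noncentrality (k (m n)) (m n) (p n)) sequentially"
        by (simp add: noncentrality_def sq_dev_nonneg)
      have "(\<lambda>n. (32 * C1\<^sup>2 / sqrt b) * (1 / Y n)) \<longlonglongrightarrow> (32 * C1\<^sup>2 / sqrt b) * 0"
        by (intro tendsto_mult tendsto_const tendsto_divide_0[OF tendsto_const] filterlim_at_top_imp_at_infinity Ylim)
      then show "(\<lambda>n. (32 * C1\<^sup>2 / sqrt b) * (1 / Y n)) \<longlonglongrightarrow> 0" by simp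
      \<comment> \<open>From this point on the number of cells is at most \<open>i n\<close>, as
        \<open>cell_energy_upper\<close> demands.\<close>
      have "eventually (\<lambda>n. 2 / b \<le> Y n) sequentially" using Ylim by (simp add: filterlim_at_top)
      then show "eventually (\<lambda>n. noncentrality (k (m n)) (m n) (p n) \<le> (32 * C1\<^sup>2 / sqrt b) * (1 / Y n)) sequentially"
      proof eventually_elim
        case (elim n)
        define M where "M = real (m n)"
        define kk where "kk = real (k (m n))"
        define I where "I = real (i n)"
        have M: "M > 0" using m1[of n] by (simp add: M_def)
        have kk: "kk > 0" using A.kpos[of n] by (simp add: kk_def)
        have I0: "I > 0" using i1[of n] by (simp add: I_def)
        have bk: "b * kk \<le> M powr (2 - 4 * r)" using lower[OF m1] by (simp add: kk_def M_def)
        have ky: "Y n * M powr (2 - 4 * r) \<le> 2 * I" using key[of n] by (simp add: M_def I_def)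
        have "2 * kk \<le> 2 * I"
        proof -
          have "2 * kk = 2 / b * (b * kk)" using b by simp
          also have "\<dots> \<le> Y n * M powr (2 - 4 * r)" using elim bk b kk less_imp_le[OF Ypos[of n]] by (intro mult_mono) auto
          finally show ?thesis using ky by linarith
        qed
        then have ki: "k (m n) \<le> i n" by (simp add: kk_def I_def)
        have "cell_energy (k (m n)) (h n) \<le> 16 * (kk / I) * (LINT x|unit_law. (h n x)\<^sup>2)"
          unfolding kk_def I_def
          by (rule cell_energy_upper[OF hs hm hc A.kpos ki hc]) auto
        also have "(LINT x|unit_law. (h n x)\<^sup>2) = (v n)\<^sup>2" using Tpos[of n] by (simp add: h_def T_rem v)
        also have "16 * (kk / I) * (v n)\<^sup>2 \<le> 16 * (kk / I) * (C1 * M powr (- r))\<^sup>2"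
          using bd2[of n] vpos[of n] kk I0 by (intro mult_left_mono power_mono) (auto simp: M_def)
        finally have ce: "cell_energy (k (m n)) (h n) \<le> 16 * (kk / I) * (C1 * M powr (- r))\<^sup>2" .
        have "noncentrality (k (m n)) (m n) (p n) = M * cell_energy (k (m n)) (h n) / sqrt kk"
          unfolding p_def noncentrality_cell_energy[OF A.kpos dm] by (simp add: M_def kk_def)
        also have "\<dots> \<le> M * (16 * (kk / I) * (C1 * M powr (- r))\<^sup>2) / sqrt kk"
          using ce M kk by (intro divide_right_mono mult_left_mono) auto
        also have "\<dots> = 16 * C1\<^sup>2 / I * (M * (M powr (- r))\<^sup>2 * sqrt kk)"
        proof -
          have "M * (16 * (S * S / I) * (C1 * Z)\<^sup>2) / S = 16 * C1\<^sup>2 / I * (M * Z\<^sup>2 * S)" if "S > 0" for S Z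
            using that I0 by (simp add: field_simps power2_eq_square)
          from this[of "sqrt kk" "M powr (- r)"] show ?thesis using kk by simp
        qed
        also have "\<dots> \<le> 16 * C1\<^sup>2 / I * (M * (M powr (- r))\<^sup>2 * (M powr (1 - 2 * r) / sqrt b))"
          using sqrt_k_le[OF m1, of n] M I0 by (intro mult_left_mono) (auto simp: kk_def M_def)
        also have "M * (M powr (- r))\<^sup>2 * (M powr (1 - 2 * r) / sqrt b) = M powr (2 - 4 * r) / sqrt b"
        proof -
          have "M * (M powr (- r))\<^sup>2 * M powr (1 - 2 * r) = M powr (1 + (- r + - r) + (1 - 2 * r))"
            using M by (simp only: powr_add power2_eq_square powr_one)
          also have "1 + (- r + - r) + (1 - 2 * r) = 2 - 4 * r" by simp
          finally show ?thesis by simp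
        qed
        also have "16 * C1\<^sup>2 / I * (M powr (2 - 4 * r) / sqrt b) = 16 * C1\<^sup>2 / sqrt b * (M powr (2 - 4 * r) / I)" by simp
        also have "\<dots> \<le> 16 * C1\<^sup>2 / sqrt b * (2 / Y n)"
          using ky Ypos[of n] I0 b by (intro mult_left_mono) (auto simp: field_simps)
        finally show ?case by simp
      qed
    qed simp
    show ?thesis
    proof (rule ereal_le_epsilon2)
      fix e :: real assume e: "e > 0"
      have e2: "e / 2 > 0" using e by simp
      \<comment> \<open>The power is eventually below \<open>\<alpha> + e / 2\<close> and the level
        above \<open>\<alpha> - e / 2\<close>, so the two errors add up to at least
        \<open>1 - e\<close>.\<close>
      have "eventually (\<lambda>n. rej_prob (m n) (k (m n)) (p n) (standardized (k (m n)) (t n)) < \<alpha> + e / 2) sequentially"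
        by (rule A.rej_upper_limit[OF p nc \<alpha> _ e2]) (use lim in \<open>simp add: I\<close>)
      moreover have "eventually (\<lambda>n. \<alpha> - e / 2 < type_I_error (m n) (K n)) sequentially"
        by (rule order_tendstoD(1)[OF lim]) (use e in simp)
      ultimately have "eventually (\<lambda>n. ereal (1 - e) \<le> ereal (type_I_error (m n) (K n) + type_II_error (m n) (K n) (h n))) sequentially"
      proof eventually_elim
        case (elim n)
        then have "1 - e \<le> type_I_error (m n) (K n) + type_II_error (m n) (K n) (h n)" unfolding II by linarith
        then show ?case by simp
      qed
      then have "ereal (1 - e) \<le> liminf (\<lambda>n. ereal (type_I_error (m n) (K n) + type_II_error (m n) (K n) (h n)))"
        by (rule Liminf_bounded)
      then have "ereal (1 - e) + ereal e \<le> liminf (\<lambda>n. ereal (type_I_error (m n) (K n) + type_II_error (m n) (K n) (h n))) + ereal e"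
        by (rule add_right_mono)
      then show "1 \<le> liminf (\<lambda>n. ereal (type_I_error (m n) (K n) + type_II_error (m n) (K n) (fourier_remainder f (i n)))) + ereal e"
        by (simp add: h_def one_ereal_def)
    qed
  qed
  show ?thesis
  proof (rule exI[of _ i], rule exI[of _ m], rule exI[of _ "1/2"], rule exI[of _ C1], intro conjI allI impI)
    show "0 < i n" "0 < m n" for n using i1[of n] m1[of n] by auto
  qed (use ilim C1 bd1 bd2 main in \<open>auto simp: v_def\<close>)
qed

end

theorem theorem6p1:
  fixes r s P0 c :: real
  assumes "0 < r" and "r < 1/2" and "s = r / (2 - 4 * r)" and "0 < P0" and "0 < c"
  shows "\<exists>c0>0. \<forall>k :: nat \<Rightarrow> nat.
    same_order (\<lambda>n. real (k n)) (\<lambda>n. real n powr (2 - 4 * r)) \<longrightarrow>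
    (\<forall>n\<ge>1. real (k n) > c0 * real n powr (2 - 4 * r)) \<longrightarrow>
    (\<forall>\<alpha>. 0 < \<alpha> \<and> \<alpha> < 1 \<longrightarrow>
       (\<exists>K :: nat \<Rightarrow> (nat \<Rightarrow> real) set.
          (\<forall>n. generated_by (K n) (chi2_stat n (k n))) \<and>
          (\<lambda>n. type_I_error n (K n)) \<longlonglongrightarrow> \<alpha> \<and>
          limsup (\<lambda>n. ereal (type_I_error n (K n)) +
            type_II_error_sup n (K n)
              {g \<in> besov_ball s P0. perturbs_to_density g \<and> L2_norm g \<ge> c * real n powr (- r)})
          < 1)) \<and>
    (\<forall>f \<in> L2_per. f \<notin> besov_space s \<longrightarrow> (LINT x:{0<..<1}|lborel. f x) = 0 \<longrightarrow>
       (\<exists>(i :: nat \<Rightarrow> nat) (m :: nat \<Rightarrow> nat) c1 C1.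
          (\<forall>n. 0 < i n \<and> 0 < m n) \<and> filterlim i at_top sequentially \<and> 0 < c1 \<and> c1 < C1 \<and>
          (\<forall>n. c1 * real (m n) powr (- r) < L2_norm (fourier_remainder f (i n)) \<and>
               L2_norm (fourier_remainder f (i n)) < C1 * real (m n) powr (- r)) \<and>
          ((\<forall>n. \<forall>x\<in>{0..1}. 0 \<le> 1 + fourier_remainder f (i n) x) \<longrightarrow>
             (\<forall>\<alpha> (K :: nat \<Rightarrow> (nat \<Rightarrow> real) set).
                0 < \<alpha> \<and> \<alpha> < 1 \<longrightarrow>
                (\<forall>n. generated_by (K n) (chi2_stat (m n) (k (m n)))) \<longrightarrow>
                (\<lambda>n. type_I_error (m n) (K n)) \<longlonglongrightarrow> \<alpha> \<longrightarrow>
                liminf (\<lambda>n. ereal (type_I_error (m n) (K n) +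
                  type_II_error (m n) (K n) (fourier_remainder f (i n)))) \<ge> 1))))"
proof -
  \<comment> \<open>The constant of \<open>consistency_on_ball\<close>; it depends on
    \<open>P0\<close>, \<open>c\<close> and \<open>s\<close> only and is thus fixed before
    \<open>k\<close>.\<close>
  define c0 where "c0 = 20 * (10 * P0 / c\<^sup>2) powr (1 / (2 * s))"
  have c0: "c0 > 0" using assms by (simp add: c0_def)
  have growth: "\<exists>b C. cell_growth r k b C"
    if so: "same_order (\<lambda>n. real (k n)) (\<lambda>n. real n powr (2 - 4 * r))"
      and kc0: "\<forall>n\<ge>1. real (k n) > c0 * real n powr (2 - 4 * r)" for k :: "nat \<Rightarrow> nat"
  proof -
    obtain b C where bC: "0 < b" "b \<le> C" "\<forall>n\<ge>1. b * real (k n) \<le> real n powr (2 - 4 * r) \<and> real n powr (2 - 4 * r) \<le> C * real (k n)"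
      using so unfolding same_order_def by blast
    \<comment> \<open>The strict lower bound with \<open>c0\<close> excludes empty
      partitions.\<close>
    have "k n > 0" if "n \<ge> 1" for n
    proof -
      have "0 < c0 * real n powr (2 - 4 * r)" using c0 that by simp
      then show ?thesis using kc0 that by fastforce
    qed
    then have "cell_growth r k b C" using bC assms(1,2) by unfold_locales auto
    then show ?thesis by blast
  qed
  show ?thesis
  proof (rule exI[of _ c0], intro conjI allI impI ballI)
    fix k :: "nat \<Rightarrow> nat" and \<alpha> :: real
    assume so: "same_order (\<lambda>n. real (k n)) (\<lambda>n. real n powr (2 - 4 * r))"
      and kc0: "\<forall>n\<ge>1. real (k n) > c0 * real n powr (2 - 4 * r)" and \<alpha>: "0 < \<alpha> \<and> \<alpha> < 1"
    obtain b C where "cell_growth r k b C" using growth[OF so kc0] by blast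
    then interpret cell_growth r k b C .
    show "\<exists>K :: nat \<Rightarrow> (nat \<Rightarrow> real) set.
          (\<forall>n. generated_by (K n) (chi2_stat n (k n))) \<and>
          (\<lambda>n. type_I_error n (K n)) \<longlonglongrightarrow> \<alpha> \<and>
          limsup (\<lambda>n. ereal (type_I_error n (K n)) +
            type_II_error_sup n (K n)
              {g \<in> besov_ball s P0. perturbs_to_density g \<and> L2_norm g \<ge> c * real n powr (- r)})
          < 1"
      by (rule maxiset_i[OF assms(5,4,3) c0_def]) (use kc0 \<alpha> in auto)
  next
    fix k :: "nat \<Rightarrow> nat" and f
    assume so: "same_order (\<lambda>n. real (k n)) (\<lambda>n. real n powr (2 - 4 * r))"
      and kc0: "\<forall>n\<ge>1. real (k n) > c0 * real n powr (2 - 4 * r)"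
      and f: "f \<in> L2_per" "f \<notin> besov_space s" "(LINT x:{0<..<1}|lborel. f x) = 0"
    obtain b C where "cell_growth r k b C" using growth[OF so kc0] by blast
    then interpret cell_growth r k b C .
    show "\<exists>(i :: nat \<Rightarrow> nat) (m :: nat \<Rightarrow> nat) c1 C1.
          (\<forall>n. 0 < i n \<and> 0 < m n) \<and> filterlim i at_top sequentially \<and> 0 < c1 \<and> c1 < C1 \<and>
          (\<forall>n. c1 * real (m n) powr (- r) < L2_norm (fourier_remainder f (i n)) \<and>
               L2_norm (fourier_remainder f (i n)) < C1 * real (m n) powr (- r)) \<and>
          ((\<forall>n. \<forall>x\<in>{0..1}. 0 \<le> 1 + fourier_remainder f (i n) x) \<longrightarrow>
             (\<forall>\<alpha> (K :: nat \<Rightarrow> (nat \<Rightarrow> real) set).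
                0 < \<alpha> \<and> \<alpha> < 1 \<longrightarrow>
                (\<forall>n. generated_by (K n) (chi2_stat (m n) (k (m n)))) \<longrightarrow>
                (\<lambda>n. type_I_error (m n) (K n)) \<longlonglongrightarrow> \<alpha> \<longrightarrow>
                liminf (\<lambda>n. ereal (type_I_error (m n) (K n) +
                  type_II_error (m n) (K n) (fourier_remainder f (i n)))) \<ge> 1))"
      by (rule maxiset_ii[OF assms(3) f])
  qed (fact c0)
qed

end
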